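(* Let $(D,\phi)$ and $(D',\phi')$ be basic pairs for $U$. Then $$\xi_{D,\phi}\star\xi_{D',\phi'}=\delta_{D,D'}\,\delta_{\phi,\phi'}\,\frac{|U|\,\langle\xi_{D,\phi},\xi_{D,\phi}\rangle}{\xi_{D,\phi}(1)}\,\xi_{D,\phi}.$$ In other words, $$\frac{1}{|U|}\sum_{x\in U}\xi_{D,\phi}(x)\,\xi_{D',\phi'}(zx^{-1})=\delta_{D,D'}\,\delta_{\phi,\phi'}\,\frac{\langle\xi_{D,\phi},\xi_{D,\phi}\rangle\,\xi_{D,\phi}(z)}{\xi_{D,\phi}(1)}$$ for all $z\in U$.
   Context: Let $p$ be an odd prime, $q=p^{e}$ ($e\ge 1$), $\mathbb{F}_q$ the field with $q$ elements, $\mathbb{F}_q^{\times}=\mathbb{F}_q\setminus\{0\}$, and $n\ge 1$. Let $G$ be one of $Sp_{2n}(q)$, $O_{2n}(q)$, $O_{2n+1}(q)$; put $m=2n$ in the first two cases and $m=2n+1$ in the third. $U_m(q)$ is the group of unipotent upper-triangular $m\times m$ matrices over $\mathbb{F}_q$, and $U=G\cap U_m(q)$. Explicitly, with $J$ the $n\times n$ matrix with $1$'s on the anti-diagonal and $0$'s elsewhere, $U$ consists of all block matrices $\begin{pmatrix} x & xv & xw\\ 0 & I_r & -v^{T}J\\ 0&0&Jx^{-T}J\end{pmatrix}$ with $x\in U_n(q)$, $v$ an $n\times r$ matrix, $w$ an $n\times n$ matrix over $\mathbb{F}_q$, where: $r=0$ and $Jw^T-wJ=0$ if $G=Sp_{2n}(q)$;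 $r=0$ and $Jw^T+wJ=0$ if $G=O_{2n}(q)$; $r=1$ and $Jw^T+wJ=-vv^T$ if $G=O_{2n+1}(q)$. Characters are complex characters, and $\langle\cdot,\cdot\rangle$ is the Frobenius scalar product of class functions on $U$. For functions $\xi,\zeta:U\to\mathbb{C}$ the convolution is $(\xi\star\zeta)(z)=\sum_{x\in U}\xi(x)\zeta(zx^{-1})$, $z\in U$. Indexing. Rows and columns of $m\times m$ matrices are indexed by $1\prec 2\prec\cdots\prec n\prec 0\prec -n\prec\cdots\prec -2\prec -1$ (index $0$ present only if $G=O_{2n+1}(q)$). Roots. $\varepsilon_1,\dots,\varepsilon_n$ are formal independent symbols; $\Phi=\{\varepsilon_i\pm\varepsilon_j:1\le i<j\le n\}\cup\Phi'$ with $\Phi'=\{2\varepsilon_i:1\le i\le n\}$ if $G=Sp_{2n}(q)$, $\Phi'=\emptyset$ if $G=O_{2n}(q)$, $\Phi'=\{\varepsilon_i:1\le i\le n\}$ if $G=O_{2n+1}(q)$. For $\alpha\in\Phi$ let $\mathcal{E}(\alpha)$ be: $\{(i,j),(-j,-i)\}$ if $\alpha=\varepsilon_i-\varepsilon_j$; $\{(i,-j),(j,-i)\}$ if $\alpha=\varepsilon_i+\varepsilon_j$ ($i<j$); $\{(i,-i)\}$ if $\alpha=2\varepsilon_i$; $\{(i,0),(0,-i)\}$ if $\alpha=\varepsilon_i$. For $\Psi\subseteq\Phi$, $\mathcal{E}(\Psi)=\bigcup_{\alpha\in\Psi}\mathcal{E}(\alpha)$. Each $\mathcal{E}(\alpha)$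 contains exactly one entry $(i,j)$ with $1\le i\le n$ and $i\prec j\preceq -i$; it is called the positive entry of $\alpha$. Basic pairs. $D\subseteq\Phi$ is basic if $\mathcal{E}(D)$ contains at most one entry from each row and at most one from each column. A basic pair for $U$ is $(D,\phi)$ with $D\subseteq\Phi$ basic (possibly empty) and $\phi:D\to\mathbb{F}_q^\times$ a map. The product $\delta_{D,D'}\delta_{\phi,\phi'}$ is $1$ if $(D,\phi)=(D',\phi')$ and $0$ otherwise. Supercharacters. Fix a nontrivial linear character $\vartheta:\mathbb{F}_q\to\mathbb{C}^\times$ of the additive group of $\mathbb{F}_q$. Define subgroups $U_\alpha\le U$: if $\alpha=\varepsilon_i-\varepsilon_j$, $U_\alpha=\{x\in U:x_{i,k}=0,\ i<k<j\}$; if $\alpha=\varepsilon_i+\varepsilon_j$ ($i<j$), $U_\alpha=\{x\in U:x_{i,k}=x_{j,l}=0,\ i<k\le n,\ j\prec l\preceq 0\}$ (when the index $0$ is absent, $l$ runs over $j<l\le n$); if $\alpha=2\varepsilon_i$ or $\alpha=\varepsilon_i$, $U_\alpha=\{x\in U:x_{i,k}=0,\ i<k\le n\}$. For $r\in\mathbb{F}_q^\times$, $\lambda_{\alpha,r}(x)=\vartheta(r x_{i,j})$, with $(i,j)$ the positive entry of $\alpha$, is a linear character of $U_\alpha$; the elementary character is the induced character $\xi_{\alpha,r}=(\lambda_{\alpha,r})^U$. The supercharacter of a basic pair is $\xi_{D,\phi}=\prod_{\alpha\in D}\xi_{\alpha,\phi(\alpha)}$ (the trivial character $1_U$ if $D=\emptyset$).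 *)

theory Defs
  imports "Jordan_Normal_Form.Determinant" "HOL-Library.FuncSet" "HOL-Library.Cardinality"
    "HOL-Computational_Algebra.Primes"
begin

section \<open>Class functions on finite groups\<close>

text \<open>Functions on a group are total functions on the ambient type; only their values on the
  carrier matter.\<close>

definition induced_fun ::
    "('g, 'b) monoid_scheme \<Rightarrow> 'g set \<Rightarrow> ('g \<Rightarrow> complex) \<Rightarrow> 'g \<Rightarrow> complex" where
  "induced_fun G H f g =
     (\<Sum>x\<in>{x \<in> carrier G. x \<otimes>\<^bsub>G\<^esub> g \<otimes>\<^bsub>G\<^esub> inv\<^bsub>G\<^esub> x \<in> H}.
        f (x \<otimes>\<^bsub>G\<^esub> g \<otimes>\<^bsub>G\<^esub> inv\<^bsub>G\<^esub> x)) / of_nat (card H)"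

definition frobenius_prod ::
    "('g, 'b) monoid_scheme \<Rightarrow> ('g \<Rightarrow> complex) \<Rightarrow> ('g \<Rightarrow> complex) \<Rightarrow> complex" where
  "frobenius_prod G f h = (\<Sum>x\<in>carrier G. f x * cnj (h x)) / of_nat (card (carrier G))"

definition convolution ::
    "('g, 'b) monoid_scheme \<Rightarrow> ('g \<Rightarrow> complex) \<Rightarrow> ('g \<Rightarrow> complex) \<Rightarrow> 'g \<Rightarrow> complex" where
  "convolution G f h z = (\<Sum>x\<in>carrier G. f x * h (z \<otimes>\<^bsub>G\<^esub> inv\<^bsub>G\<^esub> x))"

definition additive_character :: "('a::ab_group_add \<Rightarrow> complex) \<Rightarrow> bool" where
  "additive_character \<theta> \<longleftrightarrow> (\<forall>a b. \<theta> (a + b) = \<theta> a * \<theta> b) \<and> (\<forall>a. \<theta> a \<noteq> 0)"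

definition nontrivial_additive_character :: "('a::ab_group_add \<Rightarrow> complex) \<Rightarrow> bool" where
  "nontrivial_additive_character \<theta> \<longleftrightarrow> additive_character \<theta> \<and> (\<exists>a. \<theta> a \<noteq> 1)"


section \<open>The classical groups and their unipotent subgroups\<close>

datatype family = Sp | O_even | O_odd

fun mid :: "family \<Rightarrow> nat" where
  "mid Sp = 0" | "mid O_even = 0" | "mid O_odd = 1"

definition msize :: "family \<Rightarrow> nat \<Rightarrow> nat" where
  "msize G n = 2 * n + mid G"

text \<open>\<open>block3 n r B\<close> is the matrix of size \<open>2 * n + r\<close> with the \<open>3 \<times> 3\<close> array of blocks
  \<open>B\<close> (given by rows), the rows and columns being cut into pieces of lengths \<open>n\<close>, \<open>r\<close>, \<open>n\<close>.\<close>

definition blk :: "nat \<Rightarrow> nat \<Rightarrow> nat \<Rightarrow> nat" where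
  "blk n r a = (if a < n then 0 else if a < n + r then 1 else 2)"

definition off :: "nat \<Rightarrow> nat \<Rightarrow> nat \<Rightarrow> nat" where
  "off n r a = (if a < n then a else if a < n + r then a - n else a - (n + r))"

definition block3 :: "nat \<Rightarrow> nat \<Rightarrow> 'a mat list list \<Rightarrow> 'a mat" where
  "block3 n r B = mat (2 * n + r) (2 * n + r)
     (\<lambda>(a, b). (B ! blk n r a ! blk n r b) $$ (off n r a, off n r b))"

definition antidiag :: "nat \<Rightarrow> 'a::{zero,one} mat" where
  "antidiag n = mat n n (\<lambda>(a, b). if a + b = n - 1 then 1 else 0)"

text \<open>The Gram matrix of the form defining the group: anti-diagonal with entries \<open>1\<close>, except that
  in the symplectic case the lower left half is negated. This is the choice of form for which the
  unipotent upper triangular isometries are the block matrices of \<open>unip_eq_blocks\<close> below.\<close>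

definition gram :: "family \<Rightarrow> nat \<Rightarrow> 'a::field mat" where
  "gram G n = block3 n (mid G)
     [[0\<^sub>m n n, 0\<^sub>m n (mid G), antidiag n],
      [0\<^sub>m (mid G) n, 1\<^sub>m (mid G), 0\<^sub>m (mid G) n],
      [if G = Sp then - antidiag n else antidiag n, 0\<^sub>m n (mid G), 0\<^sub>m n n]]"

definition classical_group :: "family \<Rightarrow> nat \<Rightarrow> 'a::field mat set" where
  "classical_group G n =
     {g \<in> carrier_mat (msize G n) (msize G n). transpose_mat g * gram G n * g = gram G n}"

definition unitri :: "nat \<Rightarrow> 'a::field mat set" where
  "unitri k = {x \<in> carrier_mat k k. upper_triangular x \<and> (\<forall>i<k. x $$ (i, i) = 1)}"

definition unip :: "family \<Rightarrow> nat \<Rightarrow> 'a::field mat set" where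
  "unip G n = classical_group G n \<inter> unitri (msize G n)"

definition unip_group :: "family \<Rightarrow> nat \<Rightarrow> 'a::field mat monoid" where
  "unip_group G n = \<lparr>carrier = unip G n, monoid.mult = (*), one = 1\<^sub>m (msize G n)\<rparr>"


section \<open>Signed indices\<close>

text \<open>Rows and columns carry the labels \<open>1, \<dots>, n, 0, -n, \<dots>, -1\<close>, in this order (the label
  \<open>0\<close> only for odd orthogonal groups), whereas the entries of a matrix are numbered from zero.\<close>

definition labels :: "family \<Rightarrow> nat \<Rightarrow> int set" where
  "labels G n = {i. 1 \<le> \<bar>i\<bar> \<and> \<bar>i\<bar> \<le> int n} \<union> (if G = O_odd then {0} else {})"

definition prec :: "int \<Rightarrow> int \<Rightarrow> bool"  (infix \<open>\<prec>\<^sub>l\<close> 50) where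
  "i \<prec>\<^sub>l j \<longleftrightarrow> (if 0 < i then i < j \<or> j \<le> 0 else if i = 0 then j < 0 else i < j \<and> j < 0)"

abbreviation preceq :: "int \<Rightarrow> int \<Rightarrow> bool"  (infix \<open>\<preceq>\<^sub>l\<close> 50) where
  "i \<preceq>\<^sub>l j \<equiv> i \<prec>\<^sub>l j \<or> i = j"

definition pos :: "family \<Rightarrow> nat \<Rightarrow> int \<Rightarrow> nat" where
  "pos G n i =
     nat (if 0 < i then i - 1 else if i = 0 then int n else int (msize G n) + i)"

definition entry :: "family \<Rightarrow> nat \<Rightarrow> 'a mat \<Rightarrow> int \<Rightarrow> int \<Rightarrow> 'a" where
  "entry G n x i j = x $$ (pos G n i, pos G n j)"


lemma pos_bij: "bij_betw (pos G n) (labels G n) {..<msize G n}"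
proof (rule bij_betwI[where g = "\<lambda>a. if a < n then int a + 1 else if a < n + mid G then 0
    else int a - int (msize G n)"])
qed (cases G; force simp: pos_def labels_def msize_def split: if_splits)+

lemma pos_less_iff:
  assumes "i \<in> labels G n" "j \<in> labels G n"
  shows "pos G n i < pos G n j \<longleftrightarrow> i \<prec>\<^sub>l j"
  using assms by (cases G) (auto simp: pos_def labels_def msize_def prec_def split: if_splits)


section \<open>Roots and basic pairs\<close>

text \<open>\<open>Diff i j\<close>, \<open>Plus i j\<close>, \<open>Twice i\<close>, \<open>Single i\<close> stand for
  \<open>\<epsilon>\<^sub>i - \<epsilon>\<^sub>j\<close>, \<open>\<epsilon>\<^sub>i + \<epsilon>\<^sub>j\<close>, \<open>2\<epsilon>\<^sub>i\<close>, \<open>\<epsilon>\<^sub>i\<close>; in the first two cases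
  only \<open>i < j\<close> is used, so distinct terms are distinct roots.\<close>

datatype root = Diff nat nat | Plus nat nat | Twice nat | Single nat

definition roots :: "family \<Rightarrow> nat \<Rightarrow> root set" where
  "roots G n =
     {Diff i j | i j. 1 \<le> i \<and> i < j \<and> j \<le> n} \<union> {Plus i j | i j. 1 \<le> i \<and> i < j \<and> j \<le> n} \<union>
     (case G of Sp \<Rightarrow> {Twice i | i. 1 \<le> i \<and> i \<le> n}
      | O_even \<Rightarrow> {}
      | O_odd \<Rightarrow> {Single i | i. 1 \<le> i \<and> i \<le> n})"

fun entries :: "root \<Rightarrow> (int \<times> int) set" where
  "entries (Diff i j) = {(int i, int j), (- int j, - int i)}"
| "entries (Plus i j) = {(int i, - int j), (int j, - int i)}"
| "entries (Twice i) = {(int i, - int i)}"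
| "entries (Single i) = {(int i, 0), (0, - int i)}"

definition positive_entry :: "nat \<Rightarrow> root \<Rightarrow> int \<times> int" where
  "positive_entry n \<alpha> =
     (THE (i, j). (i, j) \<in> entries \<alpha> \<and> 1 \<le> i \<and> i \<le> int n \<and> i \<prec>\<^sub>l j \<and> j \<preceq>\<^sub>l - i)"

lemma positive_entry_simps:
  "1 \<le> i \<Longrightarrow> i < j \<Longrightarrow> j \<le> n \<Longrightarrow> positive_entry n (Diff i j) = (int i, int j)"
  "1 \<le> i \<Longrightarrow> i < j \<Longrightarrow> j \<le> n \<Longrightarrow> positive_entry n (Plus i j) = (int i, - int j)"
  "1 \<le> i \<Longrightarrow> i \<le> n \<Longrightarrow> positive_entry n (Twice i) = (int i, - int i)"
  "1 \<le> i \<Longrightarrow> i \<le> n \<Longrightarrow> positive_entry n (Single i) = (int i, 0)"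
  unfolding positive_entry_def by (rule the_equality; auto simp: prec_def)+

definition basic_set :: "family \<Rightarrow> nat \<Rightarrow> root set \<Rightarrow> bool" where
  "basic_set G n D \<longleftrightarrow> D \<subseteq> roots G n \<and>
     (\<forall>i j j'. (i, j) \<in> \<Union> (entries ` D) \<and> (i, j') \<in> \<Union> (entries ` D) \<longrightarrow> j = j') \<and>
     (\<forall>i i' j. (i, j) \<in> \<Union> (entries ` D) \<and> (i', j) \<in> \<Union> (entries ` D) \<longrightarrow> i = i')"

text \<open>A map \<open>D \<rightarrow> \<F>\<^sub>q\<^sup>\<times>\<close> is an extensional function, hence determined by its values on \<open>D\<close>.\<close>

definition basic_pair :: "family \<Rightarrow> nat \<Rightarrow> root set \<Rightarrow> (root \<Rightarrow> 'a::field) \<Rightarrow> bool" where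
  "basic_pair G n D \<phi> \<longleftrightarrow> basic_set G n D \<and> \<phi> \<in> D \<rightarrow>\<^sub>E (UNIV - {0})"


section \<open>Elementary characters and supercharacters\<close>

fun root_subgroup :: "family \<Rightarrow> nat \<Rightarrow> root \<Rightarrow> 'a::field mat set" where
  "root_subgroup G n (Diff i j) =
     {x \<in> unip G n. \<forall>k. int i < k \<and> k < int j \<longrightarrow> entry G n x (int i) k = 0}"
| "root_subgroup G n (Plus i j) =
     {x \<in> unip G n. (\<forall>k. int i < k \<and> k \<le> int n \<longrightarrow> entry G n x (int i) k = 0) \<and>
        (\<forall>l\<in>labels G n. int j \<prec>\<^sub>l l \<and> l \<preceq>\<^sub>l 0 \<longrightarrow> entry G n x (int j) l = 0)}"
| "root_subgroup G n (Twice i) =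
     {x \<in> unip G n. \<forall>k. int i < k \<and> k \<le> int n \<longrightarrow> entry G n x (int i) k = 0}"
| "root_subgroup G n (Single i) =
     {x \<in> unip G n. \<forall>k. int i < k \<and> k \<le> int n \<longrightarrow> entry G n x (int i) k = 0}"

definition root_char ::
    "family \<Rightarrow> nat \<Rightarrow> ('a::field \<Rightarrow> complex) \<Rightarrow> root \<Rightarrow> 'a \<Rightarrow> 'a mat \<Rightarrow> complex" where
  "root_char G n \<theta> \<alpha> r x = (case positive_entry n \<alpha> of (i, j) \<Rightarrow> \<theta> (r * entry G n x i j))"

definition elementary_char ::
    "family \<Rightarrow> nat \<Rightarrow> ('a::field \<Rightarrow> complex) \<Rightarrow> root \<Rightarrow> 'a \<Rightarrow> 'a mat \<Rightarrow> complex" where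
  "elementary_char G n \<theta> \<alpha> r =
     induced_fun (unip_group G n) (root_subgroup G n \<alpha>) (root_char G n \<theta> \<alpha> r)"

definition supercharacter ::
    "family \<Rightarrow> nat \<Rightarrow> ('a::field \<Rightarrow> complex) \<Rightarrow> root set \<Rightarrow> (root \<Rightarrow> 'a) \<Rightarrow> 'a mat \<Rightarrow> complex" where
  "supercharacter G n \<theta> D \<phi> x = (\<Prod>\<alpha>\<in>D. elementary_char G n \<theta> \<alpha> (\<phi> \<alpha>) x)"


section \<open>The block description of the unipotent groups\<close>

text \<open>The definition of \<open>unip\<close> as the unitriangular isometries agrees with the explicit
  description by block matrices (\<open>unip_eq_blocks\<close>), and it yields a group (\<open>unip_group\<close>).
  In the proof \<open>3 \<times> 3\<close> block matrices are handled as functions of the two block indices.\<close>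

definition bd :: "nat \<Rightarrow> nat \<Rightarrow> nat \<Rightarrow> nat" where
  "bd n r i = (if i = 1 then r else n)"

definition bf :: "nat \<Rightarrow> nat \<Rightarrow> (nat \<Rightarrow> nat \<Rightarrow> 'a mat) \<Rightarrow> 'a mat" where
  "bf n r f = mat (2 * n + r) (2 * n + r)
     (\<lambda>(a, b). f (blk n r a) (blk n r b) $$ (off n r a, off n r b))"

definition bdims :: "nat \<Rightarrow> nat \<Rightarrow> (nat \<Rightarrow> nat \<Rightarrow> 'a mat) \<Rightarrow> bool" where
  "bdims n r f \<longleftrightarrow> (\<forall>i<3. \<forall>j<3. f i j \<in> carrier_mat (bd n r i) (bd n r j))"

lemma block3_bf: "block3 n r B = bf n r (\<lambda>i j. B ! i ! j)"
  by (simp add: block3_def bf_def)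

lemma sum_split3:
  fixes h :: "nat \<Rightarrow> 'a::comm_monoid_add"
  shows "(\<Sum>k = 0..<2 * n + r. h k) =
    (\<Sum>k = 0..<n. h k) + (\<Sum>k = 0..<r. h (n + k)) + (\<Sum>k = 0..<n. h (n + r + k))"
proof -
  have "2 * n + r = n + r + n" by simp
  then have "(\<Sum>k = 0..<2 * n + r. h k) = (\<Sum>k = 0..<n. h k) + (\<Sum>k = n..<n+r. h k) + (\<Sum>k = n+r..<n+r+n. h k)"
    by (simp only: sum.atLeastLessThan_concat le0 le_add1)
  also have "(\<Sum>k = n..<n+r. h k) = (\<Sum>k = 0..<r. h (n + k))"
    using sum.shift_bounds_nat_ivl[of h 0 n r] by (simp add: ac_simps)
  also have "(\<Sum>k = n+r..<n+r+n. h k) = (\<Sum>k = 0..<n. h (n + r + k))"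
    using sum.shift_bounds_nat_ivl[of h 0 "n+r" n] by (simp add: ac_simps)
  finally show ?thesis .
qed

lemma blk_off:
  assumes "a < 2 * n + r"
  shows "blk n r a < 3" "off n r a < bd n r (blk n r a)"
  using assms by (auto simp: blk_def off_def bd_def)

lemma blk_off_simps [simp]:
  "k < n \<Longrightarrow> blk n r k = 0" "k < n \<Longrightarrow> off n r k = k"
  "k < r \<Longrightarrow> blk n r (n + k) = 1" "k < r \<Longrightarrow> off n r (n + k) = k"
  "blk n r (n + r + k) = 2" "off n r (n + r + k) = k"
  by (auto simp: blk_def off_def)

lemma bf_mult:
  fixes f g :: "nat \<Rightarrow> nat \<Rightarrow> 'a::semiring_0 mat"
  assumes f: "bdims n r f" and g: "bdims n r g"
  shows "bf n r f * bf n r g = bf n r (\<lambda>i j. f i 0 * g 0 j + f i 1 * g 1 j + f i 2 * g 2 j)"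
proof (rule eq_matI)
  fix a b assume ab: "a < dim_row (bf n r (\<lambda>i j. f i 0 * g 0 j + f i 1 * g 1 j + f i 2 * g 2 j))"
    "b < dim_col (bf n r (\<lambda>i j. f i 0 * g 0 j + f i 1 * g 1 j + f i 2 * g 2 j))"
  then have a: "a < 2 * n + r" and b: "b < 2 * n + r" by (auto simp: bf_def)
  let ?i = "blk n r a" and ?j = "blk n r b" and ?p = "off n r a" and ?q = "off n r b"
  note A = blk_off[OF a] and B = blk_off[OF b]
  have cf: "f ?i k \<in> carrier_mat (bd n r ?i) (bd n r k)" if "k < 3" for k
    using f A(1) that by (auto simp: bdims_def)
  have cg: "g k ?j \<in> carrier_mat (bd n r k) (bd n r ?j)" if "k < 3" for k
    using g B(1) that by (auto simp: bdims_def)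
  have pr: "(f ?i k * g k ?j) $$ (?p, ?q) = (\<Sum>l = 0..<bd n r k. f ?i k $$ (?p, l) * g k ?j $$ (l, ?q))"
    if "k < 3" for k
    using cf[OF that] cg[OF that] A(2) B(2) by (auto simp: scalar_prod_def)
  have "(bf n r f * bf n r g) $$ (a, b) = (\<Sum>k = 0..<2 * n + r. bf n r f $$ (a, k) * bf n r g $$ (k, b))"
    using a b by (auto simp: bf_def scalar_prod_def)
  also have "\<dots> = (f ?i 0 * g 0 ?j) $$ (?p, ?q) + (f ?i 1 * g 1 ?j) $$ (?p, ?q)
      + (f ?i 2 * g 2 ?j) $$ (?p, ?q)"
    unfolding sum_split3 using a b
    by (simp add: pr bf_def) (simp add: bd_def)
  also have "\<dots> = (f ?i 0 * g 0 ?j + f ?i 1 * g 1 ?j + f ?i 2 * g 2 ?j) $$ (?p, ?q)"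
    using cf[of 0] cg[of 0] cf[of 1] cg[of 1] cf[of 2] cg[of 2] A(2) B(2) by simp
  also have "\<dots> = bf n r (\<lambda>i j. f i 0 * g 0 j + f i 1 * g 1 j + f i 2 * g 2 j) $$ (a, b)"
    using a b by (simp add: bf_def)
  finally show "(bf n r f * bf n r g) $$ (a, b) =
    bf n r (\<lambda>i j. f i 0 * g 0 j + f i 1 * g 1 j + f i 2 * g 2 j) $$ (a, b)" .
qed (auto simp: bf_def)

lemma bf_transpose:
  assumes f: "bdims n r f"
  shows "transpose_mat (bf n r f) = bf n r (\<lambda>i j. transpose_mat (f j i))"
proof (rule eq_matI)
  fix a b assume "a < dim_row (bf n r (\<lambda>i j. transpose_mat (f j i)))"
    "b < dim_col (bf n r (\<lambda>i j. transpose_mat (f j i)))"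
  then have a: "a < 2 * n + r" and b: "b < 2 * n + r" by (auto simp: bf_def)
  have "f (blk n r b) (blk n r a) \<in> carrier_mat (bd n r (blk n r b)) (bd n r (blk n r a))"
    using f blk_off(1)[OF a] blk_off(1)[OF b] by (auto simp: bdims_def)
  then show "transpose_mat (bf n r f) $$ (a, b) = bf n r (\<lambda>i j. transpose_mat (f j i)) $$ (a, b)"
    using a b blk_off(2)[OF a] blk_off(2)[OF b] by (auto simp: bf_def)
qed (auto simp: bf_def)

lemma bf_eq:
  assumes f: "bdims n r f" and g: "bdims n r g"
  shows "bf n r f = bf n r g \<longleftrightarrow> (\<forall>i<3. \<forall>j<3. f i j = g i j)"
proof
  assume eq: "bf n r f = bf n r g"
  let ?s = "\<lambda>i::nat. if i = 0 then 0 else if i = 1 then n else n + r"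
  have s: "?s i + p < 2 * n + r" "blk n r (?s i + p) = i" "off n r (?s i + p) = p"
    if "i < 3" "p < bd n r i" for i p
    using that by (auto simp: bd_def blk_def off_def less_Suc_eq numeral_eq_Suc split: if_splits)
  show "\<forall>i<3. \<forall>j<3. f i j = g i j"
  proof (intro allI impI)
    fix i j :: nat assume ij: "i < 3" "j < 3"
    have cf: "f i j \<in> carrier_mat (bd n r i) (bd n r j)" "g i j \<in> carrier_mat (bd n r i) (bd n r j)"
      using f g ij by (auto simp: bdims_def)
    show "f i j = g i j"
    proof (rule eq_matI)
      fix p q assume "p < dim_row (g i j)" "q < dim_col (g i j)"
      then have pq: "p < bd n r i" "q < bd n r j" using cf by auto
      have "bf n r f $$ (?s i + p, ?s j + q) = bf n r g $$ (?s i + p, ?s j + q)" by (simp only: eq)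
      then show "f i j $$ (p, q) = g i j $$ (p, q)"
        using s(1)[OF ij(1) pq(1)] s(1)[OF ij(2) pq(2)]
        unfolding bf_def by (simp only: index_mat prod.case s[OF ij(1) pq(1)] s[OF ij(2) pq(2)])
    qed (use cf in auto)
  qed
next
  assume "\<forall>i<3. \<forall>j<3. f i j = g i j"
  then show "bf n r f = bf n r g"
    by (intro eq_matI) (auto simp: bf_def blk_off)
qed

lemma bf_all:
  assumes "g \<in> carrier_mat (2 * n + r) (2 * n + r)"
  shows "\<exists>f. bdims n r f \<and> g = bf n r f \<and> (\<forall>i<3. \<forall>j<3. \<forall>p<bd n r i. \<forall>q<bd n r j.
    f i j $$ (p, q) = g $$ ((if i = 0 then 0 else if i = 1 then n else n + r) + p,
      (if j = 0 then 0 else if j = 1 then n else n + r) + q))"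
proof -
  let ?s = "\<lambda>i::nat. if i = 0 then 0 else if i = 1 then n else n + r"
  define f where "f i j = mat (bd n r i) (bd n r j) (\<lambda>(p, q). g $$ (?s i + p, ?s j + q))" for i j
  have b: "?s (blk n r a) + off n r a = a" if "a < 2 * n + r" for a
    using that by (auto simp: blk_def off_def)
  have "bdims n r f" by (simp add: bdims_def f_def)
  moreover have "g = bf n r f"
  proof (rule eq_matI)
    fix a c assume "a < dim_row (bf n r f)" "c < dim_col (bf n r f)"
    then have ac: "a < 2 * n + r" "c < 2 * n + r" by (auto simp: bf_def)
    then show "g $$ (a, c) = bf n r f $$ (a, c)"
      unfolding bf_def f_def by (simp only: index_mat prod.case blk_off b)
  qed (use assms in \<open>auto simp: bf_def\<close>)
  moreover have "\<forall>i<3. \<forall>j<3. \<forall>p<bd n r i. \<forall>q<bd n r j. f i j $$ (p, q) = g $$ (?s i + p, ?s j + q)"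
    by (simp add: f_def)
  ultimately show ?thesis by blast
qed

lemma all3: "(\<forall>i<3. P i) \<longleftrightarrow> P 0 \<and> P 1 \<and> P (2::nat)"
  by (auto simp: numeral_eq_Suc less_Suc_eq)

lemma unitri_right_inverse:
  fixes x :: "'a::field mat"
  assumes x: "x \<in> unitri k" and y: "y \<in> carrier_mat k k" and xy: "x * y = 1\<^sub>m k"
  shows "y \<in> unitri k"
proof -
  have xc: "x \<in> carrier_mat k k" using x by (simp add: unitri_def)
  have *: "\<forall>j\<le>i. y $$ (i, j) = (if i = j then 1 else 0)" if "i < k" for i
    using that
  proof (induction "k - i" arbitrary: i rule: less_induct)
    case less
    show ?case
    proof (intro allI impI)
      fix j assume j: "j \<le> i"
      have "(x * y) $$ (i, j) = (\<Sum>l = 0..<k. x $$ (i, l) * y $$ (l, j))"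
        using xc y less.prems j by (auto simp: scalar_prod_def)
      also have "\<dots> = (\<Sum>l = 0..<k. if l = i then y $$ (i, j) else 0)"
      proof (rule sum.cong)
        fix l assume l: "l \<in> {0..<k}"
        show "x $$ (i, l) * y $$ (l, j) = (if l = i then y $$ (i, j) else 0)"
        proof (cases l i rule: linorder_cases)
          case less
          then show ?thesis using x \<open>i < k\<close> by (auto simp: unitri_def)
        next
          case equal
          then show ?thesis using x \<open>i < k\<close> by (auto simp: unitri_def)
        next
          case greater
          then show ?thesis using less.hyps[of l] l j by auto
        qed
      qed simp
      also have "\<dots> = y $$ (i, j)" using less.prems by simp
      finally show "y $$ (i, j) = (if i = j then 1 else 0)"
        using xy less.prems j by simp
    qed
  qed
  show ?thesis
    unfolding unitri_def using y * by (auto intro!: upper_triangularI)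
qed

lemma unitri_inverse:
  fixes x :: "'a::field mat"
  assumes "x \<in> unitri k"
  obtains y where "y \<in> unitri k" "x * y = 1\<^sub>m k" "y * x = 1\<^sub>m k"
proof -
  have xc: "x \<in> carrier_mat k k" using assms by (simp add: unitri_def)
  have "diag_mat x = replicate k 1"
    using assms by (intro nth_equalityI) (auto simp: unitri_def diag_mat_def)
  then have "det x \<noteq> 0" using assms xc det_upper_triangular[of x k] by (simp add: unitri_def)
  then obtain y where y: "y \<in> carrier_mat k k" "y * x = 1\<^sub>m k" "x * y = 1\<^sub>m k"
    using det_non_zero_imp_unit[OF xc] by (auto simp: Units_def ring_mat_def)
  then show ?thesis using that unitri_right_inverse[OF assms] by blast
qed


lemma antidiag_carrier [simp]: "antidiag n \<in> carrier_mat n n"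
  by (simp add: antidiag_def)

lemma antidiag_transpose [simp]: "transpose_mat (antidiag n) = antidiag n"
  by (intro eq_matI) (auto simp: antidiag_def ac_simps)

lemma antidiag_square [simp]: "antidiag n * antidiag n = (1\<^sub>m n :: 'a::field mat)"
proof (intro eq_matI)
  fix i j assume ij: "i < dim_row (1\<^sub>m n :: 'a mat)" "j < dim_col (1\<^sub>m n :: 'a mat)"
  have "(antidiag n * antidiag n :: 'a mat) $$ (i, j) =
    (\<Sum>k = 0..<n. (if i + k = n - 1 then 1 else 0) * (if k + j = n - 1 then 1 else 0))"
    using ij by (simp add: antidiag_def scalar_prod_def)
  also have "\<dots> = (\<Sum>k = 0..<n. if k = n - 1 - i then (if i = j then 1 else 0) else 0)"
    using ij by (intro sum.cong) auto
  also have "\<dots> = (1\<^sub>m n :: 'a mat) $$ (i, j)" using ij by simp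
  finally show "(antidiag n * antidiag n :: 'a mat) $$ (i, j) = (1\<^sub>m n :: 'a mat) $$ (i, j)" .
qed (auto simp: antidiag_def)

definition lowJ :: "family \<Rightarrow> nat \<Rightarrow> 'a::field mat" where
  "lowJ G n = (if G = Sp then - antidiag n else antidiag n)"

lemma lowJ [simp]: "lowJ G n \<in> carrier_mat n n" "transpose_mat (lowJ G n) = lowJ G n"
  by (auto simp: lowJ_def transpose_uminus)

definition ublocks :: "nat \<Rightarrow> nat \<Rightarrow> 'a::field mat \<Rightarrow> 'a mat \<Rightarrow> 'a mat \<Rightarrow> 'a mat \<Rightarrow> 'a mat \<Rightarrow> 'a mat" where
  "ublocks n r A B C F H =
     block3 n r [[A, B, C], [0\<^sub>m r n, 1\<^sub>m r, F], [0\<^sub>m n n, 0\<^sub>m n r, H]]"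

lemma mult_one_zero:
  assumes "(X :: 'a::field mat) \<in> carrier_mat a b"
  shows "1\<^sub>m a * X = X" "X * 1\<^sub>m b = X" "0\<^sub>m c a * X = 0\<^sub>m c b" "X * 0\<^sub>m b c = 0\<^sub>m a c"
    "X + 0\<^sub>m a b = X" "0\<^sub>m a b + X = X"
  using assms by auto

lemma isometry_ublocks:
  fixes G :: family and n :: nat and A :: "'a::field mat"
  defines "r \<equiv> mid G" and "J \<equiv> antidiag n :: 'a mat" and "S \<equiv> lowJ G n :: 'a mat"
  assumes c: "A \<in> carrier_mat n n" "B \<in> carrier_mat n r" "C \<in> carrier_mat n n"
    "F \<in> carrier_mat r n" "H \<in> carrier_mat n n"
  defines "g \<equiv> ublocks n r A B C F H"
  shows "transpose_mat g * gram G n * g = gram G n \<longleftrightarrow>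
    transpose_mat A * (J * H) = J \<and>
    transpose_mat B * (J * H) + F = 0\<^sub>m r n \<and>
    transpose_mat H * (S * A) = S \<and>
    transpose_mat H * (S * B) + transpose_mat F = 0\<^sub>m n r \<and>
    transpose_mat C * (J * H) + transpose_mat F * F + transpose_mat H * (S * C) = 0\<^sub>m n n"
proof -
  have JS: "J \<in> carrier_mat n n" "S \<in> carrier_mat n n" by (auto simp: J_def S_def)
  let ?g = "\<lambda>i j. [[A, B, C], [0\<^sub>m r n, 1\<^sub>m r, F], [0\<^sub>m n n, 0\<^sub>m n r, H]] ! i ! j"
  let ?K = "\<lambda>i j. [[0\<^sub>m n n, 0\<^sub>m n r, J], [0\<^sub>m r n, 1\<^sub>m r, 0\<^sub>m r n], [S, 0\<^sub>m n r, 0\<^sub>m n n]] ! i ! j"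
  let ?Kg = "\<lambda>i j. ?K i 0 * ?g 0 j + ?K i 1 * ?g 1 j + ?K i 2 * ?g 2 j"
  let ?t = "\<lambda>i j. transpose_mat (?g j i)"
  let ?R = "\<lambda>i j. ?t i 0 * ?Kg 0 j + ?t i 1 * ?Kg 1 j + ?t i 2 * ?Kg 2 j"
  have g: "g = bf n r ?g" by (simp add: g_def ublocks_def block3_bf)
  have K: "gram G n = bf n r ?K" by (simp add: gram_def block3_bf r_def J_def S_def lowJ_def)
  have bg: "bdims n r ?g" using c by (simp add: bdims_def all3 bd_def)
  have bK: "bdims n r ?K" using JS by (simp add: bdims_def all3 bd_def)
  have bKg: "bdims n r ?Kg" using JS c by (simp add: bdims_def all3 bd_def)
  have bt: "bdims n r ?t" using c by (simp add: bdims_def all3 bd_def)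
  have bR: "bdims n r ?R" using JS c by (simp add: bdims_def all3 bd_def)
  have car: "g \<in> carrier_mat (2*n+r) (2*n+r)" "(gram G n :: 'a mat) \<in> carrier_mat (2*n+r) (2*n+r)"
    unfolding g K by (simp_all add: bf_def)
  have "transpose_mat g * gram G n * g = transpose_mat g * (gram G n * g)"
    using car by (intro assoc_mult_mat) auto
  also have "\<dots> = bf n r ?R"
    unfolding g K bf_transpose[OF bg] bf_mult[OF bK bg] bf_mult[OF bt bKg] ..
  finally have "transpose_mat g * gram G n * g = gram G n \<longleftrightarrow> (\<forall>i<3. \<forall>j<3. ?R i j = ?K i j)"
    unfolding K using bf_eq[OF bR bK] by simp
  also have "\<dots> \<longleftrightarrow> transpose_mat A * (J * H) = J \<and>
    transpose_mat B * (J * H) + F = 0\<^sub>m r n \<and>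
    transpose_mat H * (S * A) = S \<and>
    transpose_mat H * (S * B) + transpose_mat F = 0\<^sub>m n r \<and>
    transpose_mat C * (J * H) + transpose_mat F * F + transpose_mat H * (S * C) = 0\<^sub>m n n"
    using c JS comm_add_mat[of "transpose_mat F" n r "transpose_mat H * (S * B)"]
    by (auto simp: all3 mult_one_zero)
  finally show ?thesis .
qed


lemma unitri_ublocks:
  assumes c: "A \<in> carrier_mat n n" "B \<in> carrier_mat n r" "C \<in> carrier_mat n n"
    "F \<in> carrier_mat r n" "H \<in> carrier_mat n n" and A: "A \<in> unitri n" and H: "H \<in> unitri n"
  shows "ublocks n r A B C F H \<in> unitri (2 * n + r)"
  unfolding unitri_def
proof (intro CollectI conjI allI impI upper_triangularI)
  show "ublocks n r A B C F H \<in> carrier_mat (2 * n + r) (2 * n + r)"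
    by (simp add: ublocks_def block3_def)
next
  fix i j assume ij: "j < i" "i < dim_row (ublocks n r A B C F H)"
  then have i: "i < 2 * n + r" by (simp add: ublocks_def block3_def)
  have "upper_triangular A" "upper_triangular H" using A H by (auto simp: unitri_def)
  then show "ublocks n r A B C F H $$ (i, j) = 0"
    using ij(1) i c by (auto simp: ublocks_def block3_def blk_def off_def)
next
  fix i assume i: "i < 2 * n + r"
  then show "ublocks n r A B C F H $$ (i, i) = 1"
    using A H by (auto simp: unitri_def ublocks_def block3_def blk_def off_def)
qed

lemma unitri_ex_ublocks:
  assumes g: "g \<in> unitri (2 * n + r)" and r: "r \<le> 1"
  obtains A B C F H where "A \<in> carrier_mat n n" "B \<in> carrier_mat n r" "C \<in> carrier_mat n n"
    "F \<in> carrier_mat r n" "H \<in> carrier_mat n n" "A \<in> unitri n" "H \<in> unitri n"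
    "g = ublocks n r A B C F H"
proof -
  have gc: "g \<in> carrier_mat (2 * n + r) (2 * n + r)" and ut: "upper_triangular g"
    and dg: "\<And>i. i < 2 * n + r \<Longrightarrow> g $$ (i, i) = 1" using g by (auto simp: unitri_def)
  have low: "g $$ (i, j) = 0" if "j < i" "i < 2 * n + r" for i j
    using upper_triangularD[OF ut that(1)] gc that by auto
  from bf_all[OF gc] obtain f where bd: "bdims n r f" and gf: "g = bf n r f" and
    fe: "\<And>i j p q. i < 3 \<Longrightarrow> j < 3 \<Longrightarrow> p < bd n r i \<Longrightarrow> q < bd n r j \<Longrightarrow>
      f i j $$ (p, q) = g $$ ((if i = 0 then 0 else if i = 1 then n else n + r) + p,
        (if j = 0 then 0 else if j = 1 then n else n + r) + q)" by metis
  have fc: "f i j \<in> carrier_mat (bd n r i) (bd n r j)" if "i < 3" "j < 3" for i j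
    using bd that by (auto simp: bdims_def)
  have fcs: "f 0 0 \<in> carrier_mat n n" "f 0 1 \<in> carrier_mat n r" "f 0 2 \<in> carrier_mat n n"
    "f 1 0 \<in> carrier_mat r n" "f 1 1 \<in> carrier_mat r r" "f 1 2 \<in> carrier_mat r n"
    "f 2 0 \<in> carrier_mat n n" "f 2 1 \<in> carrier_mat n r" "f 2 2 \<in> carrier_mat n n"
    using fc[of 0 0] fc[of 0 1] fc[of 0 2] fc[of 1 0] fc[of 1 1] fc[of 1 2] fc[of 2 0] fc[of 2 1]
      fc[of 2 2] by (auto simp: bd_def)
  have "f 1 0 = 0\<^sub>m r n" "f 2 0 = 0\<^sub>m n n" "f 2 1 = 0\<^sub>m n r"
    using fcs by (auto intro!: eq_matI simp: fe bd_def low)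
  moreover have "f 1 1 = 1\<^sub>m r"
    using fcs r by (intro eq_matI) (auto simp: fe bd_def dg le_Suc_eq)
  ultimately have gb: "g = ublocks n r (f 0 0) (f 0 1) (f 0 2) (f 1 2) (f 2 2)"
    unfolding gf ublocks_def block3_bf using fcs bd
    by (subst bf_eq) (auto simp: bdims_def all3 bd_def)
  have "f 0 0 \<in> unitri n" "f 2 2 \<in> unitri n"
    using fcs by (auto simp: unitri_def fe bd_def low dg intro!: upper_triangularI)
  with fcs gb show ?thesis using that by blast
qed

lemma antidiag_cancel:
  fixes X :: "'a::field mat"
  assumes "X \<in> carrier_mat n k"
  shows "antidiag n * (antidiag n * X) = X"
proof -
  have "antidiag n * (antidiag n * X) = antidiag n * antidiag n * X"
    using assms by (intro assoc_mult_mat[of _ n n _ n _ k, symmetric]) auto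
  then show ?thesis using assms by simp
qed

lemma antidiag_sandwich:
  fixes X Y :: "'a::field mat"
  assumes "X \<in> carrier_mat n n" "Y \<in> carrier_mat n n"
  shows "antidiag n * X * antidiag n = antidiag n * Y * antidiag n \<longleftrightarrow> X = Y"
proof
  assume *: "antidiag n * X * antidiag n = antidiag n * Y * antidiag n"
  have "antidiag n * (antidiag n * Z * antidiag n) * antidiag n = Z" if Z: "Z \<in> carrier_mat n n" for Z :: "'a mat"
  proof -
    have "antidiag n * (antidiag n * Z * antidiag n) = antidiag n * (antidiag n * (Z * antidiag n))"
      using Z by (simp add: assoc_mult_mat[of _ n n _ n _ n])
    also have "\<dots> = Z * antidiag n" using Z by (intro antidiag_cancel[of _ n n]) auto
    finally show ?thesis using Z by (simp add: assoc_mult_mat[of _ n n _ n _ n])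
  qed
  from this[OF assms(1)] this[OF assms(2)] * show "X = Y" by metis
qed auto

lemma isometry_core:
  fixes G :: family and n :: nat and A :: "'a::field mat"
  defines "r \<equiv> mid G" and "J \<equiv> antidiag n :: 'a mat" and "S \<equiv> lowJ G n :: 'a mat"
  assumes c: "A \<in> carrier_mat n n" "y \<in> carrier_mat n n" "v \<in> carrier_mat n r" "w \<in> carrier_mat n n"
    "F \<in> carrier_mat r n" "H \<in> carrier_mat n n" and Ay: "A * y = 1\<^sub>m n"
  shows "transpose_mat (ublocks n r A (A * v) (A * w) F H) * gram G n * ublocks n r A (A * v) (A * w) F H
      = gram G n \<longleftrightarrow>
    H = J * transpose_mat y * J \<and> F = - (transpose_mat v * J) \<and>
    transpose_mat w * J + J * (v * transpose_mat v) * J + S * w = 0\<^sub>m n n"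
proof -
  note as = assoc_mult_mat[of _ n n _ n]
  have J: "J \<in> carrier_mat n n" "J * J = 1\<^sub>m n" "transpose_mat J = J" by (auto simp: J_def)
  have S: "S \<in> carrier_mat n n" "transpose_mat S = S" by (auto simp: S_def)
  note [simp] = J(2,3) S(2)
  note c = c J(1) S(1)
  have yA: "transpose_mat y * transpose_mat A = 1\<^sub>m n"
    using arg_cong[OF Ay, of transpose_mat] c by (simp add: transpose_mult[of _ n n _ n])
  have Ay': "transpose_mat A * transpose_mat y = 1\<^sub>m n"
    using mat_mult_left_right_inverse[OF _ _ yA] c by simp
  have JJ: "J * (J * X) = X" if "X \<in> carrier_mat n k" for X k
    using antidiag_cancel[OF that] by (simp add: J_def)
  have 1: "transpose_mat A * (J * H) = J \<longleftrightarrow> H = J * transpose_mat y * J" (is "?a \<longleftrightarrow> ?b")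
  proof
    assume ?a
    then have "transpose_mat y * (transpose_mat A * (J * H)) = transpose_mat y * J" by simp
    moreover have "transpose_mat y * (transpose_mat A * (J * H)) = J * H"
      using c yA as[of "transpose_mat y" "transpose_mat A" "J * H" n]
        mult_carrier_mat[OF J(1) c(6)] left_mult_one_mat[OF mult_carrier_mat[OF J(1) c(6)]]
      by simp
    ultimately have "J * (J * H) = J * (transpose_mat y * J)" by simp
    then show ?b using c JJ[of H n] as[of J "transpose_mat y" J n] by simp
  next
    assume b: ?b
    then have "J * H = transpose_mat y * J"
      using c JJ[of "transpose_mat y * J" n] as[of J "transpose_mat y" J n] by simp
    then show ?a using c Ay' as[of "transpose_mat A" "transpose_mat y" J n]
        left_mult_one_mat[OF J(1)] by simp
  qed
  have main: "transpose_mat (A * v) * (J * H) = transpose_mat v * J"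
      "transpose_mat H * (S * A) = S"
      "transpose_mat H * (S * (A * v)) = S * v"
      "transpose_mat (A * w) * (J * H) = transpose_mat w * J"
      "transpose_mat H * (S * (A * w)) = S * w"
    if a: "transpose_mat A * (J * H) = J"
  proof -
    have "transpose_mat (A * v) * (J * H) = transpose_mat v * transpose_mat A * (J * H)"
      using c by (simp add: transpose_mult[of _ n n _ r])
    also have "\<dots> = transpose_mat v * (transpose_mat A * (J * H))"
      using c by (intro assoc_mult_mat) auto
    finally show "transpose_mat (A * v) * (J * H) = transpose_mat v * J" using a by simp
    have "transpose_mat (A * w) * (J * H) = transpose_mat w * transpose_mat A * (J * H)"
      using c by (simp add: transpose_mult[of _ n n _ n])
    also have "\<dots> = transpose_mat w * (transpose_mat A * (J * H))"
      using c by (intro assoc_mult_mat) auto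
    finally show "transpose_mat (A * w) * (J * H) = transpose_mat w * J" using a by simp
    have "transpose_mat (transpose_mat A * (J * H)) = J" using a by simp
    then have h: "transpose_mat H * (J * A) = J"
      using c by (simp add: transpose_mult[of _ n n _ n] as)
    show s: "transpose_mat H * (S * A) = S"
      using h carrier_matD[OF c(1)] carrier_matD[OF c(6)] carrier_matD[OF J(1)]
      by (simp add: S_def lowJ_def J_def[symmetric])
    have "transpose_mat H * (S * (A * X)) = transpose_mat H * (S * A) * X"
      if "X \<in> carrier_mat n k" for X k
      using c that by (simp add: as[of _ _ _ k])
    with s show "transpose_mat H * (S * (A * v)) = S * v" "transpose_mat H * (S * (A * w)) = S * w"
      using c by auto
  qed
  have 2: "transpose_mat v * J + F = 0\<^sub>m r n \<longleftrightarrow> F = - (transpose_mat v * J)" (is "?X + F = _ \<longleftrightarrow> _")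
  proof -
    have "?X \<in> carrier_mat r n" using c by simp
    then show ?thesis using c
      by (auto simp: mat_eq_iff minus_unique[symmetric] add_eq_0_iff)
  qed
  have 3: "S * v + transpose_mat F = 0\<^sub>m n r" if "F = - (transpose_mat v * J)"
  proof (cases "G = Sp")
    case True
    then show ?thesis using c by (intro eq_matI) (auto simp: r_def)
  next
    case False
    have "transpose_mat F = - (J * v)"
      unfolding that using c by (simp add: transpose_uminus transpose_mult[of _ r n _ n])
    moreover have "J * v + - (J * v) = 0\<^sub>m n r"
    proof -
      have "X + - X = 0\<^sub>m n r" if "X \<in> carrier_mat n r" for X :: "'a mat"
        using that by (intro eq_matI) auto
      from this[OF mult_carrier_mat[OF J(1) c(3)]] show ?thesis .
    qed
    ultimately show ?thesis using False by (simp add: S_def lowJ_def J_def)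
  qed
  have 4: "transpose_mat F * F = J * (v * transpose_mat v) * J" if "F = - (transpose_mat v * J)"
  proof -
    have "transpose_mat F = - (J * v)"
      unfolding that using c by (simp add: transpose_uminus transpose_mult[of _ r n _ n])
    then have "transpose_mat F * F = (J * v) * (transpose_mat v * J)"
      using that c by simp
    also have "\<dots> = J * (v * (transpose_mat v * J))"
      using c by (intro assoc_mult_mat) auto
    also have "v * (transpose_mat v * J) = v * transpose_mat v * J"
      using c by (intro assoc_mult_mat[symmetric]) auto
    finally show ?thesis using c by (simp add: as)
  qed
  have carB: "A * v \<in> carrier_mat n r" "A * w \<in> carrier_mat n n" using c by auto
  show ?thesis
    unfolding isometry_ublocks[OF c(1)  carB[unfolded r_def] c(5)[unfolded r_def] c(6), folded r_def J_def S_def]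
    using 1 2 3 4 main by metis
qed

lemma unip_eq_blocks:
  "(unip G n :: 'a::field mat set) = {block3 n (mid G)
       [[x, x * v, x * w],
        [0\<^sub>m (mid G) n, 1\<^sub>m (mid G), - (transpose_mat v * antidiag n)],
        [0\<^sub>m n n, 0\<^sub>m n (mid G), antidiag n * transpose_mat y * antidiag n]]
     | x y v w. x \<in> unitri n \<and> y \<in> carrier_mat n n \<and> x * y = 1\<^sub>m n \<and>
         v \<in> carrier_mat n (mid G) \<and> w \<in> carrier_mat n n \<and>
         (case G of
            Sp \<Rightarrow> antidiag n * transpose_mat w - w * antidiag n = 0\<^sub>m n n
          | O_even \<Rightarrow> antidiag n * transpose_mat w + w * antidiag n = 0\<^sub>m n n
          | O_odd \<Rightarrow> antidiag n * transpose_mat w + w * antidiag n = - (v * transpose_mat v))}"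
proof -
  define J :: "'a mat" where "J = antidiag n"
  define r where "r = mid G"
  have J: "J \<in> carrier_mat n n" "J * J = 1\<^sub>m n" "transpose_mat J = J" by (auto simp: J_def)
  note [simp] = J(2,3)
  let ?Q = "\<lambda>v w. case G of Sp \<Rightarrow> J * transpose_mat w - w * J = 0\<^sub>m n n
          | O_even \<Rightarrow> J * transpose_mat w + w * J = 0\<^sub>m n n
          | O_odd \<Rightarrow> J * transpose_mat w + w * J = - (v * transpose_mat v)"
  have cond: "transpose_mat w * J + J * (v * transpose_mat v) * J + lowJ G n * w = 0\<^sub>m n n \<longleftrightarrow> ?Q v w"
    if c: "v \<in> carrier_mat n r" "w \<in> carrier_mat n n" for v w
  proof -
    note as = assoc_mult_mat[of _ n n _ n _ n]
    note c = c J(1)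
    let ?T = "J * transpose_mat w + v * transpose_mat v + (if G = Sp then - (w * J) else w * J)"
    have vv: "v * transpose_mat v \<in> carrier_mat n n" using c by auto
    have JJ: "J * (J * X) = X" if "X \<in> carrier_mat n n" for X
      using antidiag_cancel[OF that] by (simp add: J_def)
    have JXJ: "X * J * J = X" if "X \<in> carrier_mat n n" for X
      using that J(1) by (simp add: as)
    have distr: "J * (P + V + W) * J = J * P * J + J * V * J + J * W * J"
      if "P \<in> carrier_mat n n" "V \<in> carrier_mat n n" "W \<in> carrier_mat n n" for P V W
    proof -
      have "J * (P + V + W) = J * P + J * V + J * W"
        using that J(1) mult_add_distrib_mat[of J n n "P + V" n W] mult_add_distrib_mat[of J n n P n V]
        by simp
      then show ?thesis
        using that J(1) add_mult_distrib_mat[of "J * P + J * V" n n "J * W" J n]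
          add_mult_distrib_mat[of "J * P" n n "J * V" J n] by simp
    qed
    have W: "J * (if G = Sp then - (w * J) else w * J) * J = lowJ G n * w"
    proof -
      have "J * (w * J) * J = J * w" using c JXJ[of w] as[of J "w * J" J] by simp
      moreover have "J * (- (w * J)) * J = - (J * (w * J) * J)"
        using c carrier_matD[OF J(1)] by simp
      moreover have "- J * w = - (J * w)" using c carrier_matD[OF J(1)] by simp
      ultimately show ?thesis by (simp add: lowJ_def J_def[symmetric])
    qed
    have P: "J * (J * transpose_mat w) * J = transpose_mat w * J"
      using c JJ[of "transpose_mat w"] by simp
    have "J * ?T * J = transpose_mat w * J + J * (v * transpose_mat v) * J + lowJ G n * w"
      by (subst distr) (use c vv in \<open>auto simp: W P\<close>)
    moreover have "J * 0\<^sub>m n n * J = 0\<^sub>m n n" using J(1) by simp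
    moreover have "J * ?T * J = J * 0\<^sub>m n n * J \<longleftrightarrow> ?T = 0\<^sub>m n n"
      unfolding J_def by (rule antidiag_sandwich) (use c in \<open>auto simp: J_def\<close>)
    ultimately have "transpose_mat w * J + J * (v * transpose_mat v) * J + lowJ G n * w = 0\<^sub>m n n
      \<longleftrightarrow> ?T = 0\<^sub>m n n" by metis
    also have "\<dots> \<longleftrightarrow> ?Q v w"
    proof (cases "G = O_odd")
      case False
      then have "v * transpose_mat v = 0\<^sub>m n n"
        using c by (cases G) (auto intro!: eq_matI simp: r_def scalar_prod_def)
      then show ?thesis using False c
        by (cases G) (auto simp: minus_add_uminus_mat[of _ n n])
    next
      case True
      let ?X = "J * transpose_mat w" and ?Y = "w * J" and ?V = "v * transpose_mat v"
      have XY: "?X \<in> carrier_mat n n" "?Y \<in> carrier_mat n n" using c by auto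
      have "X + V + Y = 0\<^sub>m n n \<longleftrightarrow> X + Y = - V"
        if "X \<in> carrier_mat n n" "V \<in> carrier_mat n n" "Y \<in> carrier_mat n n" for X Y V :: "'a mat"
        using that by (auto simp: mat_eq_iff eq_neg_iff_add_eq_0 ac_simps)
      from this[OF XY(1) vv XY(2)] show ?thesis using True by simp
    qed
    finally show ?thesis .
  qed
  have rr: "r \<le> 1" by (cases G) (auto simp: r_def)
  have ms: "msize G n = 2 * n + r" by (simp add: msize_def r_def)
  show ?thesis (is "_ = ?B")
  proof (intro equalityI subsetI)
    fix g :: "'a mat" assume "g \<in> unip G n"
    then have iso: "transpose_mat g * gram G n * g = gram G n" and gu: "g \<in> unitri (2 * n + r)"
      by (auto simp: unip_def classical_group_def ms)
    from unitri_ex_ublocks[OF gu rr] obtain A B C F H where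
      c: "A \<in> carrier_mat n n" "B \<in> carrier_mat n r" "C \<in> carrier_mat n n"
        "F \<in> carrier_mat r n" "H \<in> carrier_mat n n" "A \<in> unitri n" "H \<in> unitri n"
      and g: "g = ublocks n r A B C F H" .
    note c = c J(1)
    from unitri_inverse[OF c(6)] obtain y where y: "y \<in> unitri n" "A * y = 1\<^sub>m n" "y * A = 1\<^sub>m n" .
    have yc: "y \<in> carrier_mat n n" using y by (simp add: unitri_def)
    have BC: "A * (y * B) = B" "A * (y * C) = C"
      using c yc y(2) assoc_mult_mat[of A n n y n B r] assoc_mult_mat[of A n n y n C n] by auto
    have v: "y * B \<in> carrier_mat n r" and w: "y * C \<in> carrier_mat n n" using c yc by auto
    have *: "H = J * transpose_mat y * J \<and> F = - (transpose_mat (y * B) * J) \<and>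
        transpose_mat (y * C) * J + J * ((y * B) * transpose_mat (y * B)) * J + lowJ G n * (y * C) = 0\<^sub>m n n"
      using isometry_core[of A n y "y * B" G "y * C" F H, folded J_def r_def,
          OF c(1) yc v w c(4,5) y(2), unfolded BC, THEN iffD1, OF iso[unfolded g]] .
    then have "?Q (y * B) (y * C)" using cond[OF v w] by blast
    with * have "H = J * transpose_mat y * J" "F = - (transpose_mat (y * B) * J)" "?Q (y * B) (y * C)"
      by blast+
    then show "g \<in> ?B"
      unfolding g ublocks_def J_def r_def using c yc y v w BC
      by - (rule CollectI, rule exI[of _ A], rule exI[of _ y], rule exI[of _ "y * B"],
        rule exI[of _ "y * C"], simp add: J_def r_def)
  next
    fix g :: "'a mat" assume "g \<in> ?B"
    then obtain x y v w where c: "x \<in> unitri n" "y \<in> carrier_mat n n" "x * y = 1\<^sub>m n"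
        "v \<in> carrier_mat n r" "w \<in> carrier_mat n n" and Q: "?Q v w"
      and g: "g = ublocks n r x (x * v) (x * w) (- (transpose_mat v * J)) (J * transpose_mat y * J)"
      unfolding J_def r_def ublocks_def by blast
    note c = c J(1)
    let ?H = "J * transpose_mat y * J"
    have xc: "x \<in> carrier_mat n n" using c by (simp add: unitri_def)
    have yu: "y \<in> unitri n" by (rule unitri_right_inverse[OF c(1,2,3)])
    have Hc: "?H \<in> carrier_mat n n" and Fc: "- (transpose_mat v * J) \<in> carrier_mat r n"
      using c by auto
    have iso: "transpose_mat g * gram G n * g = gram G n"
      using isometry_core[of x n y v G w "- (transpose_mat v * J)" ?H, folded J_def r_def,
          OF xc c(2,4,5) Fc Hc c(3)] Q cond[OF c(4,5)] unfolding g by blast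
    have He: "?H $$ (i, j) = y $$ (n - 1 - j, n - 1 - i)" if "i < n" "j < n" for i j
    proof -
      have L: "(J * Z) $$ (i, j) = Z $$ (n - 1 - i, j)" if "Z \<in> carrier_mat n n" "i < n" "j < n" for Z i j
      proof -
        have "(J * Z) $$ (i, j) = (\<Sum>k = 0..<n. J $$ (i, k) * Z $$ (k, j))"
          using that by (auto simp: J_def antidiag_def scalar_prod_def)
        also have "\<dots> = (\<Sum>k = 0..<n. if k = n - 1 - i then Z $$ (n - 1 - i, j) else 0)"
          using that by (intro sum.cong) (auto simp: J_def antidiag_def)
        finally have "(J * Z) $$ (i, j) = (\<Sum>k = 0..<n. if k = n - 1 - i then Z $$ (n - 1 - i, j) else 0)" .
        then show ?thesis using that by simp
      qed
      have "?H $$ (i, j) = (transpose_mat (J * (J * transpose_mat y * J))) $$ (j, n - 1 - i)"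
        using that c L[of "J * transpose_mat y * J" "n - 1 - i" j] by auto
      also have "J * (J * transpose_mat y * J) = transpose_mat y * J"
        using c antidiag_cancel[of "transpose_mat y * J" n n]
        by (simp add: assoc_mult_mat[of _ n n _ n _ n] J_def)
      also have "transpose_mat (transpose_mat y * J) = J * y"
        using c by (simp add: transpose_mult[of _ n n _ n])
      also have "\<dots> $$ (j, n - 1 - i) = y $$ (n - 1 - j, n - 1 - i)"
        using that c by (intro L) auto
      finally show ?thesis .
    qed
    have Hu: "?H \<in> unitri n"
      unfolding unitri_def using Hc yu
      by (auto simp: He unitri_def carrier_matD[OF J(1)] simp del: index_mult_mat(1)
          intro!: upper_triangularI upper_triangularD[of y])
    have "g \<in> unitri (2 * n + r)"
      unfolding g using c xc Hc Fc Hu by (intro unitri_ublocks) auto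
    then show "g \<in> unip G n"
      using iso by (simp add: unip_def classical_group_def ms unitri_def)
  qed
qed


lemma gram_carrier: "gram G n \<in> carrier_mat (msize G n) (msize G n)"
  by (simp add: gram_def block3_def msize_def)

lemma gram_transpose_mult: "transpose_mat (gram G n) * gram G n = (1\<^sub>m (msize G n) :: 'a::field mat)"
proof -
  let ?r = "mid G"
  define J where "J = (antidiag n :: 'a mat)"
  define S where "S = (lowJ G n :: 'a mat)"
  have JS: "J \<in> carrier_mat n n" "S \<in> carrier_mat n n" "transpose_mat J = J" "transpose_mat S = S"
    "J * J = 1\<^sub>m n" "S * S = 1\<^sub>m n" by (auto simp: J_def S_def) (simp add: lowJ_def carrier_matD[OF antidiag_carrier])
  let ?K = "\<lambda>i j. [[0\<^sub>m n n, 0\<^sub>m n ?r, J], [0\<^sub>m ?r n, 1\<^sub>m ?r, 0\<^sub>m ?r n], [S, 0\<^sub>m n ?r, 0\<^sub>m n n]] ! i ! j"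
  let ?I = "\<lambda>i j. [[1\<^sub>m n, 0\<^sub>m n ?r, 0\<^sub>m n n], [0\<^sub>m ?r n, 1\<^sub>m ?r, 0\<^sub>m ?r n], [0\<^sub>m n n, 0\<^sub>m n ?r, 1\<^sub>m n]] ! i ! j"
  let ?t = "\<lambda>i j. transpose_mat (?K j i)"
  let ?P = "\<lambda>i j. ?t i 0 * ?K 0 j + ?t i 1 * ?K 1 j + ?t i 2 * ?K 2 j"
  have K: "gram G n = bf n ?r ?K" by (simp add: gram_def block3_bf lowJ_def J_def S_def)
  have bK: "bdims n ?r ?K" using JS by (simp add: bdims_def all3 bd_def)
  have bt: "bdims n ?r ?t" using JS by (simp add: bdims_def all3 bd_def)
  have bI: "bdims n ?r ?I" using JS by (simp add: bdims_def all3 bd_def)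
  have bP: "bdims n ?r ?P" using JS by (simp add: bdims_def all3 bd_def)
  have "transpose_mat (gram G n) * gram G n = bf n ?r ?P"
    unfolding K bf_transpose[OF bK] bf_mult[OF bt bK] ..
  also have "\<dots> = bf n ?r ?I"
    unfolding bf_eq[OF bP bI] using JS by (simp add: all3 mult_one_zero)
  also have "\<dots> = 1\<^sub>m (2 * n + ?r)"
    by (intro eq_matI) (auto simp: bf_def blk_def off_def)
  finally show ?thesis by (simp add: msize_def)
qed

lemma unitri_mult:
  fixes x y :: "'a::field mat"
  assumes x: "x \<in> unitri k" and y: "y \<in> unitri k"
  shows "x * y \<in> unitri k"
proof -
  have c: "x \<in> carrier_mat k k" "y \<in> carrier_mat k k" using x y by (auto simp: unitri_def)
  have *: "(x * y) $$ (i, j) = (if i = j then 1 else 0)" if "j \<le> i" "i < k" for i j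
  proof -
    have "(x * y) $$ (i, j) = (\<Sum>l = 0..<k. x $$ (i, l) * y $$ (l, j))"
      using c that by (auto simp: scalar_prod_def)
    also have "\<dots> = (\<Sum>l = 0..<k. if l = i then (if i = j then 1 else 0) else 0)"
    proof (rule sum.cong)
      fix l assume l: "l \<in> {0..<k}"
      show "x $$ (i, l) * y $$ (l, j) = (if l = i then (if i = j then 1 else 0) else 0)"
        using x y l that upper_triangularD[of x l i] upper_triangularD[of y j l]
          upper_triangularD[of y j i]
        by (cases l i rule: linorder_cases; cases "i = j") (auto simp: unitri_def)
    qed simp
    finally show ?thesis using that by simp
  qed
  then show ?thesis using c by (auto simp: unitri_def intro!: upper_triangularI simp del: index_mult_mat(1))
qed

lemma unip_group: "group (unip_group G n :: 'a::field mat monoid)"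
proof -
  let ?m = "msize G n"
  let ?K = "gram G n :: 'a mat"
  note K = gram_carrier[of G n, where 'a = 'a]
  note as = assoc_mult_mat[of _ ?m ?m _ ?m _ ?m]
  have car: "x \<in> carrier_mat ?m ?m" if "x \<in> unip G n" for x :: "'a mat"
    using that by (simp add: unip_def unitri_def)
  have iso: "transpose_mat x * (?K * x) = ?K" if "x \<in> unip G n" for x
    using that car[OF that] K by (simp add: unip_def classical_group_def as)
  have mem: "x \<in> unip G n" if "x \<in> unitri ?m" "transpose_mat x * (?K * x) = ?K" for x
    using that K by (simp add: unip_def classical_group_def unitri_def as)
  show ?thesis
  proof (rule groupI)
    fix x y :: "'a mat" assume "x \<in> carrier (unip_group G n)" "y \<in> carrier (unip_group G n)"
    then have x: "x \<in> unip G n" and y: "y \<in> unip G n" by (auto simp: unip_group_def)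
    note c = car[OF x] car[OF y]
    have "transpose_mat (x * y) * (?K * (x * y)) = transpose_mat y * (transpose_mat x * (?K * x) * y)"
      using c K by (simp add: transpose_mult[of _ ?m ?m _ ?m] as)
    also have "\<dots> = ?K" using iso[OF x] iso[OF y] by simp
    finally show "x \<otimes>\<^bsub>unip_group G n\<^esub> y \<in> carrier (unip_group G n)"
      using mem unitri_mult[of x ?m y] x y by (auto simp: unip_group_def unip_def)
  next
    have "1\<^sub>m ?m \<in> (unip G n :: 'a mat set)"
      using K by (intro mem) (auto simp: unitri_def)
    then show "\<one>\<^bsub>unip_group G n\<^esub> \<in> carrier (unip_group G n :: 'a mat monoid)" by (simp add: unip_group_def)
  next
    fix x y z :: "'a mat"
    assume "x \<in> carrier (unip_group G n)" "y \<in> carrier (unip_group G n)" "z \<in> carrier (unip_group G n)"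
    then show "x \<otimes>\<^bsub>unip_group G n\<^esub> y \<otimes>\<^bsub>unip_group G n\<^esub> z =
        x \<otimes>\<^bsub>unip_group G n\<^esub> (y \<otimes>\<^bsub>unip_group G n\<^esub> z)"
      using car by (simp add: unip_group_def as)
  next
    fix x :: "'a mat" assume "x \<in> carrier (unip_group G n)"
    then show "\<one>\<^bsub>unip_group G n\<^esub> \<otimes>\<^bsub>unip_group G n\<^esub> x = x"
      using car[of x] by (simp add: unip_group_def)
  next
    fix x :: "'a mat" assume "x \<in> carrier (unip_group G n)"
    then have x: "x \<in> unip G n" by (simp add: unip_group_def)
    then have "x \<in> unitri ?m" by (simp add: unip_def)
    from unitri_inverse[OF this] obtain y where y: "y \<in> unitri ?m" "x * y = 1\<^sub>m ?m" "y * x = 1\<^sub>m ?m" .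
    have c: "x \<in> carrier_mat ?m ?m" "y \<in> carrier_mat ?m ?m" using car[OF x] y by (auto simp: unitri_def)
    have "transpose_mat y * (?K * y) = transpose_mat y * (transpose_mat x * (?K * x) * y)"
      using iso[OF x] by simp
    also have "\<dots> = transpose_mat (x * y) * (?K * (x * y))"
      using c K by (simp add: transpose_mult[of _ ?m ?m _ ?m] as)
    also have "\<dots> = ?K" using K y by simp
    finally have "y \<in> unip G n" using mem y by blast
    then show "\<exists>y\<in>carrier (unip_group G n). y \<otimes>\<^bsub>unip_group G n\<^esub> x = \<one>\<^bsub>unip_group G n\<^esub>"
      using y by (auto simp: unip_group_def)
  qed
qed

end

theory Submission
  imports Defs
begin

text \<open>The Cayley transform identifies the unipotent group \<open>U\<close> with a space of symmetric or
  skew-symmetric forms supported below the antidiagonal, conjugation becoming congruence. On this space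
  the full group \<open>T\<close> of unitriangular matrices acts by congruence, and an elementary character is,
  up to a scalar, the mean over \<open>g \<in> T\<close> of \<open>\<theta>\<close> applied to a multiple of one entry of
  \<open>g\<^sup>T S g\<close>. Distinct columns of a random element of \<open>T\<close> are independent, so the
  supercharacter of a basic pair is the mean of \<open>\<theta>\<close> over the \<open>T\<close>-orbit of a
  monomial form. By Gaussian elimination these orbits partition the dual space. Hence supercharacters of
  distinct basic pairs are orthogonal and a positive combination of all of them is the regular
  character. Since they are functions of positive type, orthogonality forces vanishing
  convolution, and convolving with the regular character gives the diagonal case.\<close>

section \<open>Functions of positive type on a finite group\<close>

text \<open>The obstacle is that inside \<open>U\<close> the columns of a matrix are tied together
  by the form, so a product of averages over \<open>U\<close> is not an average over one orbit.
  Passing to all of \<open>T\<close> makes the columns free, and two facts make this passage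
  harmless. In the inducing sum, membership in \<open>U_\<alpha>\<close> and then the value of the
  linear character depend only on the middle and bottom rows, and in these rows \<open>U\<close> and
  \<open>T\<close> cannot be told apart. The membership condition may then be dropped, because over
  \<open>T\<close> the terms violating it cancel in additive character sums. The Cayley transform is
  chosen because it asks only that 2 be invertible, whereas an exponential would need a large
  characteristic. No representations are used: positive type replaces being a character. It is
  inherited by induction from a linear character and by products, and it strengthens the vanishing
  of one scalar product to the vanishing of the scalar products of all the Gram vectors, from which
  the convolution is composed.\<close>

definition positive_type :: "('g, 'b) monoid_scheme \<Rightarrow> ('g \<Rightarrow> complex) \<Rightarrow> bool" where
  "positive_type U f \<longleftrightarrow> (\<exists>(N::nat) v. \<forall>x\<in>carrier U. \<forall>y\<in>carrier U.
     f (x \<otimes>\<^bsub>U\<^esub> inv\<^bsub>U\<^esub> y) = (\<Sum>k<N. v k x * cnj (v k y)))"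

text \<open>The Gram vectors in the definition are numbered, because an existential cannot range
  over index types; this rule restores arbitrary finite index sets, such as pairs of group
  elements.\<close>

lemma positive_typeI:
  assumes "finite I"
    and "\<And>x y. x \<in> carrier U \<Longrightarrow> y \<in> carrier U \<Longrightarrow>
      f (x \<otimes>\<^bsub>U\<^esub> inv\<^bsub>U\<^esub> y) = (\<Sum>k\<in>I. v k x * cnj (v k y))"
  shows "positive_type U f"
proof -
  obtain h where h: "bij_betw h {0..<card I} I" using ex_bij_betw_nat_finite[OF assms(1)] by blast
  have "f (x \<otimes>\<^bsub>U\<^esub> inv\<^bsub>U\<^esub> y) = (\<Sum>k<card I. v (h k) x * cnj (v (h k) y))"
    if "x \<in> carrier U" "y \<in> carrier U" for x y
    using sum.reindex_bij_betw[OF h, of "\<lambda>k. v k x * cnj (v k y)"] assms(2)[OF that]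
    by (simp add: atLeast0LessThan)
  then show ?thesis unfolding positive_type_def by (intro exI[of _ "card I"] exI[of _ "\<lambda>k. v (h k)"]) blast
qed

lemma positive_type_one: "positive_type U (\<lambda>x. 1)"
  by (rule positive_typeI[of "{()}" _ _ "\<lambda>_ _. 1"]) auto

text \<open>Schur's product theorem: the products of the Gram vectors are Gram vectors for the
  product kernel.\<close>

lemma positive_type_mult:
  assumes "positive_type U f" "positive_type U g"
  shows "positive_type U (\<lambda>x. f x * g x)"
proof -
  obtain N :: nat and v where v: "f (x \<otimes>\<^bsub>U\<^esub> inv\<^bsub>U\<^esub> y) = (\<Sum>k<N. v k x * cnj (v k y))"
    if "x \<in> carrier U" "y \<in> carrier U" for x y
    using assms(1) unfolding positive_type_def by metis
  obtain M :: nat and w where w: "g (x \<otimes>\<^bsub>U\<^esub> inv\<^bsub>U\<^esub> y) = (\<Sum>k<M. w k x * cnj (w k y))"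
    if "x \<in> carrier U" "y \<in> carrier U" for x y
    using assms(2) unfolding positive_type_def by metis
  show ?thesis
  proof (rule positive_typeI[of "{..<N} \<times> {..<M}" _ _ "\<lambda>(k, l) x. v k x * w l x"])
    fix x y assume *: "x \<in> carrier U" "y \<in> carrier U"
    show "f (x \<otimes>\<^bsub>U\<^esub> inv\<^bsub>U\<^esub> y) * g (x \<otimes>\<^bsub>U\<^esub> inv\<^bsub>U\<^esub> y) =
      (\<Sum>k\<in>{..<N} \<times> {..<M}. (case k of (k, l) \<Rightarrow> \<lambda>x. v k x * w l x) x *
         cnj ((case k of (k, l) \<Rightarrow> \<lambda>x. v k x * w l x) y))"
      unfolding v[OF *] w[OF *] sum_product sum.cartesian_product
      by (intro sum.cong) (auto simp: ac_simps)
  qed auto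
qed

lemma positive_type_prod:
  assumes "finite D" "\<And>\<alpha>. \<alpha> \<in> D \<Longrightarrow> positive_type U (f \<alpha>)"
  shows "positive_type U (\<lambda>x. \<Prod>\<alpha>\<in>D. f \<alpha> x)"
  using assms
proof (induction D rule: finite_induct)
  case empty then show ?case using positive_type_one by simp
next
  case (insert \<alpha> D)
  then show ?case using positive_type_mult[of U "f \<alpha>"] by simp
qed

lemma (in group) positive_type_inv:
  assumes "positive_type G f" "x \<in> carrier G"
  shows "f (inv x) = cnj (f x)"
proof -
  obtain N :: nat and v where v: "f (x \<otimes> inv y) = (\<Sum>k<N. v k x * cnj (v k y))"
    if "x \<in> carrier G" "y \<in> carrier G" for x y
    using assms(1) unfolding positive_type_def by metis
  show ?thesis using v[of x \<one>] v[of \<one> x] assms(2) by (simp add: mult.commute)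
qed

lemma (in group) sum_inverse: "(\<Sum>x\<in>carrier G. f (inv x)) = (\<Sum>x\<in>carrier G. f x)"
  by (rule sum.reindex_bij_witness[of _ "\<lambda>x. inv x" "\<lambda>x. inv x"]) auto

text \<open>Translating the scalar product of \<open>f\<close> and \<open>g\<close> by every
  \<open>y\<close> and summing gives the sum of the squares of all \<open>cmod (p k l)\<close>,
  where \<open>p k l\<close> is the scalar product of \<open>v k\<close> and \<open>w l\<close>.
  Orthogonality therefore kills each \<open>p k l\<close>, and the convolution is a linear
  combination of them.\<close>

lemma (in group) convolution_zero:
  assumes fin: "finite (carrier G)" and f: "positive_type G f" and g: "positive_type G g"
    and orth: "(\<Sum>x\<in>carrier G. f x * cnj (g x)) = 0" and z: "z \<in> carrier G"
  shows "(\<Sum>x\<in>carrier G. f x * g (z \<otimes> inv x)) = 0"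
proof -
  obtain N :: nat and v where v: "f (x \<otimes> inv y) = (\<Sum>k<N. v k x * cnj (v k y))"
    if "x \<in> carrier G" "y \<in> carrier G" for x y
    using f unfolding positive_type_def by metis
  obtain M :: nat and w where w: "g (x \<otimes> inv y) = (\<Sum>k<M. w k x * cnj (w k y))"
    if "x \<in> carrier G" "y \<in> carrier G" for x y
    using g unfolding positive_type_def by metis
  define p where "p k l = (\<Sum>x\<in>carrier G. v k x * cnj (w l x))" for k l
  have "(\<Sum>y\<in>carrier G. \<Sum>x\<in>carrier G. f (x \<otimes> inv y) * cnj (g (x \<otimes> inv y))) = 0"
  proof (rule sum.neutral, rule ballI)
    fix y assume y: "y \<in> carrier G"
    have "(\<Sum>x\<in>carrier G. f (x \<otimes> inv y) * cnj (g (x \<otimes> inv y))) = (\<Sum>x\<in>carrier G. f x * cnj (g x))"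
      by (rule sum.reindex_bij_witness[of _ "\<lambda>x. x \<otimes> y" "\<lambda>x. x \<otimes> inv y"])
        (use y in \<open>auto simp: m_assoc\<close>)
    then show "(\<Sum>x\<in>carrier G. f (x \<otimes> inv y) * cnj (g (x \<otimes> inv y))) = 0" using orth by simp
  qed
  also have "(\<Sum>y\<in>carrier G. \<Sum>x\<in>carrier G. f (x \<otimes> inv y) * cnj (g (x \<otimes> inv y))) =
    (\<Sum>y\<in>carrier G. \<Sum>x\<in>carrier G. \<Sum>k<N. \<Sum>l<M. (v k x * cnj (w l x)) * cnj (v k y * cnj (w l y)))"
    by (intro sum.cong) (auto simp: v w sum_product ac_simps)
  also have "\<dots> = (\<Sum>y\<in>carrier G. \<Sum>k<N. \<Sum>l<M. \<Sum>x\<in>carrier G. (v k x * cnj (w l x)) * cnj (v k y * cnj (w l y)))"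
    by (intro sum.cong refl, subst sum.swap, intro sum.cong refl, subst sum.swap) (rule refl)
  also have "\<dots> = (\<Sum>k<N. \<Sum>l<M. \<Sum>y\<in>carrier G. \<Sum>x\<in>carrier G. (v k x * cnj (w l x)) * cnj (v k y * cnj (w l y)))"
    by (subst sum.swap, intro sum.cong refl, subst sum.swap) (rule refl)
  also have "\<dots> = (\<Sum>k<N. \<Sum>l<M. p k l * cnj (p k l))"
    unfolding p_def cnj_sum sum_product
    by (rule sum.cong[OF refl], rule sum.cong[OF refl], rule sum.swap)
  also have "\<dots> = of_real (\<Sum>k<N. \<Sum>l<M. (cmod (p k l))\<^sup>2)"
    by (simp only: of_real_sum complex_norm_square)
  finally have 0: "(\<Sum>k<N. \<Sum>l<M. (cmod (p k l))\<^sup>2) = 0" using of_real_eq_0_iff by blast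
  have p0: "p k l = 0" if "k < N" "l < M" for k l
  proof -
    have "(\<Sum>l<M. (cmod (p k l))\<^sup>2) = 0"
      using 0 that sum_nonneg_eq_0_iff[of "{..<N}" "\<lambda>k. \<Sum>l<M. (cmod (p k l))\<^sup>2"]
      by (simp add: sum_nonneg)
    then show ?thesis
      using that sum_nonneg_eq_0_iff[of "{..<M}" "\<lambda>l. (cmod (p k l))\<^sup>2"] by simp
  qed
  \<comment> \<open>With \<open>f x\<close> read at the pair \<open>x\<close>,
    \<open>\<one>\<close>, the summation variable occurs only in
    \<open>v k x * cnj (w l x)\<close>.\<close>
  have "(\<Sum>x\<in>carrier G. f x * g (z \<otimes> inv x)) =
    (\<Sum>x\<in>carrier G. \<Sum>k<N. \<Sum>l<M. (cnj (v k \<one>) * w l z) * (v k x * cnj (w l x)))"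
  proof (intro sum.cong refl)
    fix x assume x: "x \<in> carrier G"
    have fx: "f x = (\<Sum>k<N. v k x * cnj (v k \<one>))" using v[OF x one_closed] x by simp
    then show "f x * g (z \<otimes> inv x) = (\<Sum>k<N. \<Sum>l<M. (cnj (v k \<one>) * w l z) * (v k x * cnj (w l x)))"
      unfolding fx w[OF z x] sum_product by (intro sum.cong refl) (simp add: ac_simps)
  qed
  also have "\<dots> = (\<Sum>k<N. \<Sum>l<M. (cnj (v k \<one>) * w l z) * p k l)"
    unfolding p_def sum_distrib_left
    by (subst sum.swap, intro sum.cong refl, subst sum.swap) (rule refl)
  also have "\<dots> = 0" by (simp add: p0)
  finally show ?thesis .
qed

text \<open>A linear character extended by zero is, up to the factor \<open>card H\<close>, its own
  Gram kernel under right translation. Induction only adds conjugations, and conjugating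
  \<open>x \<otimes> inv y\<close> by \<open>g\<close> gives the same kind of quotient for
  \<open>g \<otimes> x\<close> and \<open>g \<otimes> y\<close>.\<close>

lemma (in group) positive_type_induced:
  assumes fin: "finite (carrier G)" and H: "subgroup H G"
    and hom: "\<And>a b. a \<in> H \<Longrightarrow> b \<in> H \<Longrightarrow> f (a \<otimes> b) = f a * f b"
    and unit: "\<And>a. a \<in> H \<Longrightarrow> f a * cnj (f a) = 1"
  shows "positive_type G (induced_fun G H f)"
proof -
  define E where "E x = (if x \<in> H then f x else 0)" for x
  have finH: "finite H" using subgroup.subset[OF H] fin finite_subset by blast
  have Hsub: "H \<subseteq> carrier G" using subgroup.subset[OF H] .
  have cH: "(of_nat (card H) :: complex) \<noteq> 0"
    using finH subgroup.one_closed[OF H] by auto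
  \<comment> \<open>A nonzero term needs \<open>t \<otimes> k\<close> in \<open>H\<close>, and then
    \<open>s \<otimes> k\<close> lies in \<open>H\<close> exactly when
    \<open>s \<otimes> inv t\<close> does. There are \<open>card H\<close> such
    \<open>k\<close>.\<close>
  have E: "of_nat (card H) * E (s \<otimes> inv t) = (\<Sum>k\<in>carrier G. E (s \<otimes> k) * cnj (E (t \<otimes> k)))"
    if s: "s \<in> carrier G" and t: "t \<in> carrier G" for s t
  proof -
    have st: "s \<otimes> inv t = (s \<otimes> k) \<otimes> inv (t \<otimes> k)" if "k \<in> carrier G" for k
      using that s t by (simp add: inv_mult_group m_assoc) (simp add: m_assoc[symmetric])
    have "(\<Sum>k\<in>carrier G. E (s \<otimes> k) * cnj (E (t \<otimes> k))) =
      (\<Sum>k\<in>carrier G. if t \<otimes> k \<in> H then E (s \<otimes> inv t) else 0)"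
    proof (intro sum.cong refl)
      fix k assume k: "k \<in> carrier G"
      show "E (s \<otimes> k) * cnj (E (t \<otimes> k)) = (if t \<otimes> k \<in> H then E (s \<otimes> inv t) else 0)"
      proof (cases "t \<otimes> k \<in> H")
        case tk: True
        show ?thesis
        proof (cases "s \<otimes> inv t \<in> H")
          case True
          have e: "s \<otimes> k = (s \<otimes> inv t) \<otimes> (t \<otimes> k)"
            using s t k by (simp add: m_assoc) (simp add: m_assoc[symmetric])
          then have "s \<otimes> k \<in> H" using subgroup.m_closed[OF H True tk] by simp
          moreover have "f (s \<otimes> k) = f (s \<otimes> inv t) * f (t \<otimes> k)" using hom[OF True tk] e by simp
          ultimately show ?thesis using True tk unit[OF tk] by (simp add: E_def mult.assoc)
        next
          case False
          then have "s \<otimes> k \<notin> H"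
            using st[OF k] tk subgroup.m_closed[OF H] subgroup.m_inv_closed[OF H] by metis
          then show ?thesis using False by (simp add: E_def)
        qed
      qed (simp add: E_def)
    qed
    also have "\<dots> = of_nat (card {k \<in> carrier G. t \<otimes> k \<in> H}) * E (s \<otimes> inv t)"
      using fin by (simp add: sum.If_cases Int_def)
    also have "card {k \<in> carrier G. t \<otimes> k \<in> H} = card H"
      by (rule bij_betw_same_card[of "\<lambda>k. t \<otimes> k"], rule bij_betwI[of _ _ _ "\<lambda>k. inv t \<otimes> k"])
        (use t Hsub in \<open>auto simp: m_assoc[symmetric] subset_iff\<close>)
    finally show ?thesis by simp
  qed
  show ?thesis
  proof (rule positive_typeI[of "carrier G \<times> carrier G" _ _ "\<lambda>(g, k) x. E (g \<otimes> x \<otimes> k) / of_nat (card H)"])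
    fix x y assume x: "x \<in> carrier G" and y: "y \<in> carrier G"
    have "induced_fun G H f (x \<otimes> inv y) =
      (\<Sum>g\<in>carrier G. E (g \<otimes> (x \<otimes> inv y) \<otimes> inv g)) / of_nat (card H)"
      unfolding induced_fun_def E_def using fin by (simp add: sum.inter_filter[symmetric])
    also have "\<dots> = (\<Sum>g\<in>carrier G. E ((g \<otimes> x) \<otimes> inv (g \<otimes> y))) / of_nat (card H)"
      using x y by (simp add: inv_mult_group m_assoc cong: sum.cong)
    also have "\<dots> = (\<Sum>g\<in>carrier G. (\<Sum>k\<in>carrier G. E (g \<otimes> x \<otimes> k) * cnj (E (g \<otimes> y \<otimes> k))) / of_nat (card H)) / of_nat (card H)"
      using x y cH by (simp add: E[symmetric])
    finally show "induced_fun G H f (x \<otimes> inv y) =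
      (\<Sum>k\<in>carrier G \<times> carrier G. (case k of (g, k) \<Rightarrow> \<lambda>x. E (g \<otimes> x \<otimes> k) / of_nat (card H)) x *
         cnj ((case k of (g, k) \<Rightarrow> \<lambda>x. E (g \<otimes> x \<otimes> k) / of_nat (card H)) y))"
      by (simp add: sum.cartesian_product sum_divide_distrib split_def divide_divide_eq_left)
  qed (use fin in auto)
qed

section \<open>Additive characters of a finite field\<close>

context
  fixes \<theta> :: "'a::{field,finite} \<Rightarrow> complex"
  assumes nt: "nontrivial_additive_character \<theta>"
begin

lemma additive_character_add: "\<theta> (a + b) = \<theta> a * \<theta> b"
  and additive_character_nonzero: "\<theta> a \<noteq> 0"
  using nt by (auto simp: nontrivial_additive_character_def additive_character_def)

lemma additive_character_zero: "\<theta> 0 = 1"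
  using additive_character_add[of 0 0] additive_character_nonzero[of 0] by simp

text \<open>A largest modulus is attained, and translating its argument cannot increase it, so every
  modulus is at most 1. This is applied to \<open>a\<close> and to \<open>- a\<close>.\<close>

lemma additive_character_norm: "cmod (\<theta> a) = 1"
proof -
  have le: "cmod (\<theta> a) \<le> 1" for a
  proof -
    define M where "M = Max (range (\<lambda>a. cmod (\<theta> a)))"
    have "M \<in> range (\<lambda>a. cmod (\<theta> a))" unfolding M_def by (rule Max_in) auto
    then obtain b where b: "M = cmod (\<theta> b)" by auto
    have "cmod (\<theta> (a + b)) \<le> M" unfolding M_def by (rule Max_ge) auto
    then have "cmod (\<theta> a) * M \<le> 1 * M" by (simp add: b additive_character_add norm_mult)
    moreover have "M > 0" using b additive_character_nonzero[of b] by simp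
    ultimately show ?thesis using mult_le_cancel_right_pos by blast
  qed
  have "cmod (\<theta> a) * cmod (\<theta> (- a)) = 1"
    using additive_character_add[of a "- a"] additive_character_zero by (simp add: norm_mult[symmetric])
  then show ?thesis using le[of a] le[of "- a"]
    by (smt (verit) mult_left_le norm_ge_zero)
qed

lemma additive_character_unit: "\<theta> a * cnj (\<theta> a) = 1"
  using additive_character_norm[of a] by (simp add: complex_norm_square[symmetric])

lemma additive_character_cnj: "cnj (\<theta> a) = \<theta> (- a)"
proof -
  have "\<theta> a * cnj (\<theta> a) = \<theta> a * \<theta> (- a)"
    using additive_character_unit[of a] additive_character_add[of a "- a"] additive_character_zero by simp
  then show ?thesis using additive_character_nonzero[of a] by simp
qed

lemma additive_character_sum: "\<theta> (\<Sum>i\<in>I. f i) = (\<Prod>i\<in>I. \<theta> (f i))"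
  by (induction I rule: infinite_finite_induct) (auto simp: additive_character_zero additive_character_add)

lemma additive_character_ex:
  assumes v: "v \<noteq> 0"
  shows "\<exists>t. \<theta> (t * v) \<noteq> 1"
proof -
  obtain a where "\<theta> a \<noteq> 1" using nt by (auto simp: nontrivial_additive_character_def)
  then show ?thesis using v by (intro exI[of _ "a / v"]) simp
qed

text \<open>The cancellation scheme for sums over \<open>T\<close>. Each move
  \<open>\<tau> i t\<close> multiplies \<open>F\<close> by a character of \<open>t\<close> with
  frequency \<open>v i x\<close>, and averaging over \<open>t\<close> removes the points of nonzero
  frequency. Since no move changes any frequency, the set cut out by the indices already treated
  stays stable and the removal can be iterated.\<close>

lemma sum_restrict_kernel:
  fixes \<tau> :: "'i \<Rightarrow> 'a \<Rightarrow> 'x \<Rightarrow> 'x" and v :: "'i \<Rightarrow> 'x \<Rightarrow> 'a"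
  assumes "finite I" and X: "finite X"
    and \<tau>: "\<And>i t x. i \<in> I \<Longrightarrow> x \<in> X \<Longrightarrow> \<tau> i t x \<in> X"
    and inv: "\<And>i t x. i \<in> I \<Longrightarrow> x \<in> X \<Longrightarrow> \<tau> i (- t) (\<tau> i t x) = x"
    and v: "\<And>i j t x. i \<in> I \<Longrightarrow> j \<in> I \<Longrightarrow> x \<in> X \<Longrightarrow> v j (\<tau> i t x) = v j x"
    and F: "\<And>i t x. i \<in> I \<Longrightarrow> x \<in> X \<Longrightarrow> F (\<tau> i t x) = F x * \<theta> (t * v i x)"
  shows "(\<Sum>x\<in>X. F x) = (\<Sum>x | x \<in> X \<and> (\<forall>i\<in>I. v i x = 0). F x)"
  using assms(1) \<tau> inv v F
proof (induction I rule: finite_induct)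
  case empty
  then show ?case by simp
next
  case (insert i I)
  define Y where "Y = {x \<in> X. \<forall>i\<in>I. v i x = 0}"
  define Z where "Z = {x \<in> Y. v i x \<noteq> 0}"
  have fin: "finite Y" "finite Z" using X by (auto simp: Y_def Z_def)
  have Zt: "\<tau> i t x \<in> Z" if "x \<in> Z" for t x
    using that insert.prems(1,3) by (auto simp: Y_def Z_def)
  have shift: "(\<Sum>x\<in>Z. F x) = (\<Sum>x\<in>Z. F x * \<theta> (t * v i x))" for t
  proof -
    have "(\<Sum>x\<in>Z. F x) = (\<Sum>x\<in>Z. F (\<tau> i t x))"
      by (rule sum.reindex_bij_witness[of _ "\<lambda>x. \<tau> i t x" "\<lambda>x. \<tau> i (- t) x"])
        (use Zt insert.prems(2)[of i _ t] insert.prems(2)[of i _ "- t"] in \<open>auto simp: Z_def Y_def\<close>)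
    also have "\<dots> = (\<Sum>x\<in>Z. F x * \<theta> (t * v i x))"
      using insert.prems(4) by (intro sum.cong) (auto simp: Z_def Y_def)
    finally show ?thesis .
  qed
  have c0: "(\<Sum>t\<in>UNIV. \<theta> (t * c)) = 0" if c: "c \<noteq> 0" for c
  proof -
    obtain s where s: "\<theta> (s * c) \<noteq> 1" using additive_character_ex[OF c] by blast
    have "(\<Sum>t\<in>UNIV. \<theta> (t * c)) = (\<Sum>t\<in>UNIV. \<theta> ((s + t) * c))"
      by (rule sum.reindex_bij_witness[of _ "\<lambda>t. s + t" "\<lambda>t. t - s"]) auto
    also have "\<dots> = \<theta> (s * c) * (\<Sum>t\<in>UNIV. \<theta> (t * c))"
      by (simp add: distrib_right additive_character_add sum_distrib_left)
    finally show ?thesis using s by (metis mult_cancel_right1)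
  qed
  \<comment> \<open>The sum over \<open>Z\<close> is unchanged by every shift, so it equals its mean
    over all \<open>t\<close>, in which only complete character sums at nonzero frequencies
    occur.\<close>
  have "of_nat CARD('a) * (\<Sum>x\<in>Z. F x) = (\<Sum>t\<in>(UNIV::'a set). \<Sum>x\<in>Z. F x)" by simp
  also have "\<dots> = (\<Sum>t\<in>UNIV. \<Sum>x\<in>Z. F x * \<theta> (t * v i x))"
    by (rule sum.cong[OF refl], rule shift)
  also have "\<dots> = (\<Sum>x\<in>Z. F x * (\<Sum>t\<in>UNIV. \<theta> (t * v i x)))"
    by (subst sum.swap) (simp add: sum_distrib_left)
  also have "\<dots> = 0" by (rule sum.neutral) (auto simp: Z_def c0)
  finally have Z0: "(\<Sum>x\<in>Z. F x) = 0" by simp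
  have "(\<Sum>x\<in>X. F x) = (\<Sum>x\<in>Y. F x)"
    unfolding Y_def by (rule insert.IH) (use insert.prems in auto)
  also have "\<dots> = (\<Sum>x\<in>Y - Z. F x) + (\<Sum>x\<in>Z. F x)"
    using fin by (intro sum.subset_diff) (auto simp: Z_def)
  also have "Y - Z = {x \<in> X. \<forall>i\<in>insert i I. v i x = 0}" by (auto simp: Y_def Z_def)
  finally show ?case using Z0 by simp
qed

end

section \<open>Congruence by unitriangular matrices\<close>

definition monomial :: "(nat \<Rightarrow> nat \<Rightarrow> 'a::zero) \<Rightarrow> bool" where
  "monomial C \<longleftrightarrow> (\<forall>i j j'. C i j \<noteq> 0 \<and> C i j' \<noteq> 0 \<longrightarrow> j = j') \<and>
     (\<forall>i i' j. C i j \<noteq> 0 \<and> C i' j \<noteq> 0 \<longrightarrow> i = i')"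

lemma unitriD:
  assumes "g \<in> unitri m"
  shows "g \<in> carrier_mat m m" "i < m \<Longrightarrow> g $$ (i, i) = 1" "j < i \<Longrightarrow> i < m \<Longrightarrow> g $$ (i, j) = 0"
  using assms upper_triangularD[of g j i] by (auto simp: unitri_def)

text \<open>The \<open>g k\<close> are the columns of an upper unitriangular matrix. Functions with
  a finite index set replace matrices because elimination deletes indices from the middle of the
  range. Making the existential statement an inductive predicate lets \<open>cases\<close> unpack
  it.\<close>

inductive monomial_form :: "'a::field \<Rightarrow> nat set \<Rightarrow> (nat \<Rightarrow> nat \<Rightarrow> 'a) \<Rightarrow> bool" for \<epsilon> I C where
  monomial_formI: "(\<And>k. k \<in> I \<Longrightarrow> g k k = 1 \<and> (\<forall>a. k < a \<longrightarrow> g k a = 0)) \<Longrightarrow>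
    (\<And>i j. M j i = \<epsilon> * M i j) \<Longrightarrow> (\<And>i j. i \<notin> I \<Longrightarrow> M i j = 0) \<Longrightarrow>
    (\<And>i j j'. M i j \<noteq> 0 \<Longrightarrow> M i j' \<noteq> 0 \<Longrightarrow> j = j') \<Longrightarrow>
    (\<And>i j. C i j = (\<Sum>k\<in>I. \<Sum>l\<in>I. M k l * g k i * g l j)) \<Longrightarrow>
    monomial_form \<epsilon> I C"

text \<open>Gaussian elimination on the rows and columns of index \<open>Max I\<close>: either its diagonal entry is
  a pivot, or its last nonzero entry gives a hyperbolic pair of pivots.\<close>

lemma monomial_reduction:
  fixes C :: "nat \<Rightarrow> nat \<Rightarrow> 'a::field"
  assumes "finite I" and \<epsilon>: "\<epsilon> = 1 \<or> \<epsilon> = - 1" and two: "(2::'a) \<noteq> 0"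
    and "\<And>i j. C j i = \<epsilon> * C i j" and "\<And>i j. i \<notin> I \<Longrightarrow> C i j = 0"
  shows "monomial_form \<epsilon> I C"
  using assms(1,4,5)
proof (induction I arbitrary: C rule: finite_psubset_induct)
  case (psubset I C)
  note sym = psubset.prems(1) and supp = psubset.prems(2) and fin = psubset.hyps
  have supp': "C j i = 0" if "i \<notin> I" for i j using sym[of j i] supp[OF that] by simp
  have ee: "\<epsilon> * \<epsilon> = 1" using \<epsilon> by auto
  show ?case
  proof (cases "I = {}")
    case True
    then show ?thesis using supp by (intro monomial_formI[where g = "\<lambda>_ _. 0" and M = "\<lambda>_ _. 0"]) auto
  next
    case False
    define a where "a = Max I"
    have aI: "a \<in> I" and amax: "\<And>k. k \<in> I \<Longrightarrow> k \<le> a"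
      using fin False by (auto simp: a_def)
    consider (zero) "\<forall>j. C a j = 0" | (diag) "C a a \<noteq> 0" | (hyp) "C a a = 0" "\<exists>j. C a j \<noteq> 0" by blast
    then show ?thesis
    proof cases
      case zero
      let ?I = "I - {a}"
      have z2: "\<And>i j. i \<notin> ?I \<Longrightarrow> C i j = 0" using zero supp by auto
      have "monomial_form \<epsilon> ?I C" using aI by (intro psubset.IH sym z2) auto
      then show ?thesis
      proof cases
        case (monomial_formI g M)
        note g = this(1) and M = this(2-4) and C = this(5)
      have M0: "M i a = 0" for i using M(1)[of i a] M(2)[of a] by simp
      have z3: "M i j = 0" if "i \<notin> I" for i j using M(2) that by simp
      \<comment> \<open>The row of \<open>M\<close> at \<open>a\<close> is zero, so the vector at
        \<open>a\<close> may be chosen freely; the unit vector has the triangular shape.\<close>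
      define h where "h = g(a := (\<lambda>x. if x = a then 1 else 0))"
      have Ch: "C i j = (\<Sum>k\<in>I. \<Sum>l\<in>I. M k l * h k i * h l j)" for i j
      proof -
        have "(\<Sum>k\<in>I. \<Sum>l\<in>I. M k l * h k i * h l j) = (\<Sum>k\<in>?I. \<Sum>l\<in>?I. M k l * h k i * h l j)"
          using fin aI M(2)[of a] M0 by (simp add: sum.remove[of I a])
        then show ?thesis unfolding C by (simp add: h_def)
      qed
      have h: "h k k = 1 \<and> (\<forall>a. k < a \<longrightarrow> h k a = 0)" if "k \<in> I" for k
        using g that by (auto simp: h_def)
      show ?thesis by (rule monomial_form.intros[OF h M(1) z3 M(3) Ch])
      qed
    next
      case diag
      let ?I = "I - {a}"
      define p where "p = C a a"
      have p: "p \<noteq> 0" using diag by (simp add: p_def)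
      have e1: "\<epsilon> = 1"
      proof (rule ccontr)
        assume "\<epsilon> \<noteq> 1"
        then have "C a a = - C a a" using \<epsilon> sym[of a a] by simp
        then have "2 * C a a = 0" unfolding eq_neg_iff_add_eq_0 mult_2 .
        then show False using two diag by simp
      qed
      have s: "C j i = C i j" for i j using sym e1 by simp
      define w where "w k = C a k / p" for k
      \<comment> \<open>Completing the square: \<open>w\<close> is row \<open>a\<close> scaled to
        \<open>w a = 1\<close>, and subtracting \<open>p\<close> times its square clears row and
        column \<open>a\<close>.\<close>
      define C' where "C' i j = C i j - p * w i * w j" for i j
      have "C' j i = \<epsilon> * C' i j" for i j using s[of i j] e1 by (simp add: C'_def)
      moreover have "C' i j = 0" if "i \<notin> ?I" for i j
        using that supp[of i j] supp'[of i a] p by (cases "i = a") (auto simp: C'_def w_def p_def)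
      ultimately have "monomial_form \<epsilon> ?I C'" using aI by (intro psubset.IH) blast+
      then show ?thesis
      proof cases
        case (monomial_formI g M)
        note g = this(1) and M = this(2-4) and C = this(5)
      have M0: "M i a = 0" for i using M(1)[of i a] M(2)[of a] by simp
      define h where "h = g(a := w)"
      define N where "N i j = (if i = a \<and> j = a then p else M i j)" for i j
      have Ch: "C i j = (\<Sum>k\<in>I. \<Sum>l\<in>I. N k l * h k i * h l j)" for i j
      proof -
        have "(\<Sum>k\<in>I. \<Sum>l\<in>I. N k l * h k i * h l j) = p * w i * w j + (\<Sum>k\<in>?I. \<Sum>l\<in>?I. M k l * g k i * g l j)"
          using fin aI M(2)[of a] M0 by (simp add: sum.remove[of I a] N_def h_def)
        then show ?thesis unfolding C[symmetric] by (simp add: C'_def)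
      qed
      have w0: "w x = 0" if "a < x" for x
      proof -
        have "x \<notin> I" using that amax by fastforce
        then show ?thesis using supp' by (simp add: w_def)
      qed
      have h: "h k k = 1 \<and> (\<forall>a. k < a \<longrightarrow> h k a = 0)" if "k \<in> I" for k
        using g[of k] p w0 that by (cases "k = a") (auto simp: h_def w_def p_def)
      have Ns: "N j i = \<epsilon> * N i j" for i j using M(1)[of j i] e1 by (auto simp: N_def)
      have N0: "N i j = 0" if "i \<notin> I" for i j using M(2) aI that by (auto simp: N_def)
      have Nr: "j = j'" if "N i j \<noteq> 0" "N i j' \<noteq> 0" for i j j'
        using M(2)[of a] M0 M(3)[of i j j'] that by (auto simp: N_def split: if_splits)
      show ?thesis by (rule monomial_form.intros[OF h Ns N0 Nr Ch])
      qed
    next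
      case hyp
      define b where "b = Max {j. C a j \<noteq> 0}"
      have "{j. C a j \<noteq> 0} \<subseteq> I" using supp' by auto
      then have finj: "finite {j. C a j \<noteq> 0}" using fin finite_subset by blast
      have "b \<in> {j. C a j \<noteq> 0}" unfolding b_def using finj hyp(2) by (intro Max_in) auto
      then have Cab: "C a b \<noteq> 0" by simp
      have bmax: "C a k = 0" if "b < k" for k
        using that Max_ge[OF finj, of k] by (fastforce simp: b_def)
      have bI: "b \<in> I" using Cab supp' by blast
      have ab: "a \<noteq> b" using Cab hyp(1) by auto
      let ?I = "I - {a} - {b}"
      have I: "I = insert a (insert b ?I)" using aI bI by auto
      have sumI: "(\<Sum>k\<in>I. f k) = f a + f b + (\<Sum>k\<in>?I. f k)" for f :: "nat \<Rightarrow> 'a"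
        using fin aI bI ab by (simp add: sum.remove[of I a] sum.remove[of "I - {a}" b] add.assoc)
      define p where "p = C a b"
      have p: "p \<noteq> 0" using Cab by (simp add: p_def)
      \<comment> \<open>The hyperbolic pair. Row \<open>a\<close>, scaled to 1 at its last nonzero
        place \<open>b\<close>, has the shape required of the vector at \<open>b\<close>. Clearing
        row \<open>b\<close> as well forces
        \<open>u k = \<epsilon> * (C b k / p - u b * w k)\<close>. The constant \<open>c\<close> is
        the value of \<open>u b\<close> consistent with this: half of \<open>C b b / p\<close>,
        which is zero in the skew case.\<close>
      define w where "w k = C a k / p" for k
      define c where "c = C b b / (2 * p)"
      define u where "u k = \<epsilon> * (C b k / p - c * w k)" for k
      have wa: "w a = 0" and wb: "w b = 1" using hyp(1) p by (auto simp: w_def p_def)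
      have Cba: "C b a = \<epsilon> * p" using sym[of b a] by (simp add: p_def)
      have ua: "u a = 1" using p ee by (simp add: u_def wa Cba mult.assoc[symmetric])
      have ec: "\<epsilon> * c = c"
      proof (cases "\<epsilon> = 1")
        case False
        then have "C b b = - C b b" using \<epsilon> sym[of b b] by simp
        then have "2 * C b b = 0" unfolding eq_neg_iff_add_eq_0 mult_2 .
        then show ?thesis using two by (simp add: c_def)
      qed simp
      have ub: "u b = c"
      proof -
        have "C b b / p = 2 * c" using two p by (simp add: c_def)
        then show ?thesis using ec by (simp add: u_def wb)
      qed
      define C' where "C' i j = C i j - p * (u i * w j + \<epsilon> * w i * u j)" for i j
      have sC': "C' j i = \<epsilon> * C' i j" for i j
      proof -
        have "\<epsilon> * C' i j = \<epsilon> * C i j - p * (\<epsilon> * u i * w j + (\<epsilon> * \<epsilon>) * w i * u j)"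
          by (simp add: C'_def algebra_simps)
        then show ?thesis using sym[of j i] ee by (simp add: C'_def algebra_simps)
      qed
      have C'a: "C' a j = 0" for j using p by (simp add: C'_def wa ua) (simp add: w_def)
      have C'b: "C' b j = 0" for j
      proof -
        have "\<epsilon> * u j = C b j / p - c * w j" using ee by (simp add: u_def mult.assoc[symmetric])
        then show ?thesis using p by (simp add: C'_def wb ub)
      qed
      have C'0: "C' i j = 0" if "i \<notin> ?I" for i j
        using that supp[of i j] supp'[of i a] supp'[of i b] C'a C'b
        by (cases "i = a"; cases "i = b") (auto simp: C'_def w_def u_def)
      have "monomial_form \<epsilon> ?I C'" using aI by (intro psubset.IH sC' C'0) auto
      then show ?thesis
      proof cases
        case (monomial_formI g M)
        note g = this(1) and M = this(2-4) and C = this(5)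
      have Ma: "M a i = 0" "M i a = 0" "M b i = 0" "M i b = 0" for i
        using M(1)[of i a] M(1)[of i b] M(2)[of a] M(2)[of b] by simp_all
      \<comment> \<open>Both vectors are admissible: \<open>u\<close> vanishes beyond
        \<open>a\<close> because \<open>a\<close> is the largest index, and \<open>w\<close> beyond
        \<open>b\<close> by the choice of \<open>b\<close>.\<close>
      define h where "h = g(a := u, b := w)"
      define N where "N i j = (if i = a \<and> j = b then p else if i = b \<and> j = a then \<epsilon> * p else M i j)" for i j
      have Ch: "C i j = (\<Sum>k\<in>I. \<Sum>l\<in>I. N k l * h k i * h l j)" for i j
      proof -
        have "(\<Sum>k\<in>I. \<Sum>l\<in>I. N k l * h k i * h l j) =
          p * u i * w j + \<epsilon> * p * w i * u j + (\<Sum>k\<in>?I. \<Sum>l\<in>?I. M k l * g k i * g l j)"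
          using ab by (simp add: sumI N_def h_def Ma)
        then show ?thesis unfolding C[symmetric] by (simp add: C'_def algebra_simps)
      qed
      have h: "h k k = 1 \<and> (\<forall>x. k < x \<longrightarrow> h k x = 0)" if k: "k \<in> I" for k
      proof -
        consider "k = a" | "k = b" | "k \<in> ?I" using k by blast
        then show ?thesis
        proof cases
          case 1
          have "u x = 0" if "a < x" for x
          proof -
            have "x \<notin> I" using that amax by fastforce
            then show ?thesis using supp' by (simp add: u_def w_def)
          qed
          then show ?thesis using 1 ab ua by (simp add: h_def)
        next
          case 2
          then show ?thesis using wb bmax by (simp add: h_def w_def)
        next
          case 3
          then show ?thesis using g by (simp add: h_def)
        qed
      qed
      have Ns: "N j i = \<epsilon> * N i j" for i j
        using M(1)[of j i] ab ee by (auto simp: N_def mult.assoc[symmetric])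
      have N0: "N i j = 0" if "i \<notin> I" for i j using M(2) aI bI that by (auto simp: N_def)
      have Nr: "j = j'" if "N i j \<noteq> 0" "N i j' \<noteq> 0" for i j j'
        using Ma M(3)[of i j j'] ab that by (auto simp: N_def split: if_splits)
      show ?thesis by (rule monomial_form.intros[OF h Ns N0 Nr Ch])
      qed
    qed
  qed
qed

text \<open>Pivots are matched starting from the bottom right corner. Row \<open>a\<close> of
  \<open>C'\<close> must have its pivot at some \<open>b' \<ge> b\<close>. Were
  \<open>b' > b\<close>, column \<open>b'\<close> would hold a pivot of \<open>C\<close> in a row
  \<open>a' > a\<close>, which by induction is a pivot of \<open>C'\<close> too, giving
  \<open>C'\<close> two entries in one column.\<close>

lemma monomial_rigid_le:
  fixes C C' :: "nat \<Rightarrow> nat \<Rightarrow> 'a::field"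
  assumes g: "g \<in> unitri m" and h: "h \<in> unitri m"
    and C: "monomial C" "\<And>i j. C i j \<noteq> 0 \<Longrightarrow> i < m \<and> j < m \<and> m \<le> i + j"
    and C': "monomial C'" "\<And>i j. C' i j \<noteq> 0 \<Longrightarrow> i < m \<and> j < m \<and> m \<le> i + j"
    and eq: "\<And>a b. a < m \<Longrightarrow> b < m \<Longrightarrow> m \<le> a + b \<Longrightarrow>
      (\<Sum>k<m. g $$ (a, k) * C k b) = (\<Sum>k<m. C' a k * h $$ (b, k))"
  shows "C a b \<noteq> 0 \<Longrightarrow> C' a b = C a b"
proof (induction "2 * m - (a + b)" arbitrary: a b rule: less_induct)
  case less
  have ab: "a < m" "b < m" "m \<le> a + b" using C(2)[OF less.prems] by auto
  have Crow: "C i j \<noteq> 0 \<Longrightarrow> C i j' \<noteq> 0 \<Longrightarrow> j = j'" and Ccol: "C i j \<noteq> 0 \<Longrightarrow> C i' j \<noteq> 0 \<Longrightarrow> i = i'"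
    and Crow': "C' i j \<noteq> 0 \<Longrightarrow> C' i j' \<noteq> 0 \<Longrightarrow> j = j'" and Ccol': "C' i j \<noteq> 0 \<Longrightarrow> C' i' j \<noteq> 0 \<Longrightarrow> i = i'" for i i' j j'
    using C(1) C'(1) unfolding monomial_def by blast+
  \<comment> \<open>Column \<open>b\<close> of \<open>C\<close> has its only entry in row
    \<open>a\<close>, and row \<open>a\<close> of \<open>C'\<close> its only entry in column
    \<open>b'\<close>, so both sides of \<open>eq\<close> reduce to single products.\<close>
  have L: "(\<Sum>k<m. g $$ (a, k) * C k b) = g $$ (a, a) * C a b"
    using ab Ccol[OF less.prems] by (subst sum.remove[of _ a]) (auto intro!: sum.neutral)
  then have "(\<Sum>k<m. C' a k * h $$ (b, k)) \<noteq> 0"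
    using eq[OF ab] less.prems unitriD(2)[OF g ab(1)] by simp
  then obtain b' where b': "b' < m" "C' a b' * h $$ (b, b') \<noteq> 0"
    by (meson lessThan_iff sum.not_neutral_contains_not_neutral)
  have "C' a b' \<noteq> 0" using b'(2) by auto
  then have z: "C' a k = 0" if "k \<noteq> b'" for k using Crow'[of a b' k] that by blast
  have R: "(\<Sum>k<m. C' a k * h $$ (c, k)) = C' a b' * h $$ (c, b')" for c
    using b'(1) by (subst sum.remove[of _ b']) (auto simp: z)
  have le: "b \<le> b'"
  proof (rule ccontr)
    assume "\<not> b \<le> b'"
    then have "h $$ (b, b') = 0" using unitriD(3)[OF h _ ab(2), of b'] by simp
    then show False using b'(2) by simp
  qed
  show ?case
  proof (cases "b' = b")
    case True
    then show ?thesis using R[of b] eq[OF ab] L unitriD(2)[OF g ab(1)] unitriD(2)[OF h ab(2)] by simp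
  next
    case False
    then have lt: "b < b'" using le by simp
    \<comment> \<open>The place \<open>(a, b')\<close> lies further inside the region, and there the
      right-hand side is the pivot of \<open>C'\<close> itself, because \<open>h\<close> has ones on
      the diagonal.\<close>
    have "(\<Sum>k<m. g $$ (a, k) * C k b') \<noteq> 0"
      using eq[of a b'] ab lt b' R[of b'] unitriD(2)[OF h b'(1)] by auto
    then obtain a' where a': "a' < m" "g $$ (a, a') * C a' b' \<noteq> 0"
      by (meson lessThan_iff sum.not_neutral_contains_not_neutral)
    have "a \<le> a'"
    proof (rule ccontr)
      assume "\<not> a \<le> a'"
      then have "g $$ (a, a') = 0" using unitriD(3)[OF g _ ab(1), of a'] by simp
      then show False using a'(2) by simp
    qed
    moreover have "a' \<noteq> a" using Crow[OF less.prems, of b'] a'(2) False by auto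
    ultimately have lt': "a < a'" by simp
    have "C' a' b' = C a' b'" using less.hyps[of a' b'] lt lt' a' b'(1) by auto
    then have "a = a'" using Ccol'[of a b' a'] b'(2) a'(2) by auto
    then show ?thesis using lt' by simp
  qed
qed

text \<open>Only the region \<open>m \<le> i + j\<close> strictly below the antidiagonal is seen here: it carries the
  coordinates of the Lie algebra of the unipotent group.\<close>

lemma monomial_rigid:
  fixes C C' :: "nat \<Rightarrow> nat \<Rightarrow> 'a::field"
  assumes g: "g \<in> unitri m" and h: "h \<in> unitri m"
    and C: "monomial C" "\<And>i j. C i j \<noteq> 0 \<Longrightarrow> i < m \<and> j < m \<and> m \<le> i + j"
    and C': "monomial C'" "\<And>i j. C' i j \<noteq> 0 \<Longrightarrow> i < m \<and> j < m \<and> m \<le> i + j"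
    and eq: "\<And>a b. a < m \<Longrightarrow> b < m \<Longrightarrow> m \<le> a + b \<Longrightarrow>
      (\<Sum>k<m. g $$ (a, k) * C k b) = (\<Sum>k<m. C' a k * h $$ (b, k))"
  shows "C = C'"
proof -
  have 1: "C a b \<noteq> 0 \<Longrightarrow> C' a b = C a b" for a b
    by (rule monomial_rigid_le[OF assms])
  have t: "monomial (\<lambda>i j. D j i)" if "monomial D" for D :: "nat \<Rightarrow> nat \<Rightarrow> 'a"
    using that unfolding monomial_def by blast
  have r: "i < m \<and> j < m \<and> m \<le> i + j" if "D j i \<noteq> 0"
    and "\<And>i j. D i j \<noteq> 0 \<Longrightarrow> i < m \<and> j < m \<and> m \<le> i + j" for D :: "nat \<Rightarrow> nat \<Rightarrow> 'a" and i j
    using that(2)[OF that(1)] by auto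
  have e: "(\<Sum>k<m. h $$ (b, k) * C' a k) = (\<Sum>k<m. C k b * g $$ (a, k))"
    if "b < m" "a < m" "m \<le> b + a" for a b
    using eq[of a b] that by (simp add: mult.commute)
  \<comment> \<open>The mirror image: transposition exchanges the two forms and the two
    unitriangular matrices.\<close>
  have 2: "C' a b \<noteq> 0 \<Longrightarrow> C a b = C' a b" for a b
    by (rule monomial_rigid_le[OF h g t[OF C'(1)] r[OF _ C'(2)] t[OF C(1)] r[OF _ C(2)] e])
  have "C a b = C' a b" for a b using 1[of a b] 2[of a b] by (cases "C a b = 0") auto
  then show ?thesis by blast
qed

section \<open>The Cayley transform\<close>

lemma finite_carrier_mat: "finite (carrier_mat r c :: 'a::finite mat set)"
proof (rule finite_subset)
  show "carrier_mat r c \<subseteq> (\<lambda>f. mat r c f) ` (({..<r} \<times> {..<c}) \<rightarrow>\<^sub>E (UNIV :: 'a set))"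
  proof
    fix A :: "'a mat" assume A: "A \<in> carrier_mat r c"
    have "A = mat r c (restrict (\<lambda>p. A $$ p) ({..<r} \<times> {..<c}))"
      using A by (intro eq_matI) auto
    moreover have "restrict (\<lambda>p. A $$ p) ({..<r} \<times> {..<c}) \<in> ({..<r} \<times> {..<c}) \<rightarrow>\<^sub>E UNIV" by simp
    ultimately show "A \<in> (\<lambda>f. mat r c f) ` (({..<r} \<times> {..<c}) \<rightarrow>\<^sub>E UNIV)"
      by (rule image_eqI)
  qed
qed (auto intro!: finite_PiE)

lemma finite_unitri: "finite (unitri m :: 'a::{field,finite} mat set)"
  by (rule finite_subset[OF _ finite_carrier_mat[of m m]]) (auto simp: unitri_def)

lemma finite_unip: "finite (unip G n :: 'a::{field,finite} mat set)"
  by (rule finite_subset[OF _ finite_unitri[of "msize G n"]]) (auto simp: unip_def)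

lemma unitri_one: "1\<^sub>m m \<in> unitri m"
  by (auto simp: unitri_def)

lemma unitriI:
  assumes "x \<in> carrier_mat m m" "\<And>i. i < m \<Longrightarrow> x $$ (i, i) = 1"
    "\<And>i j. j < i \<Longrightarrow> i < m \<Longrightarrow> x $$ (i, j) = 0"
  shows "x \<in> unitri m"
  using assms by (auto simp: unitri_def intro!: upper_triangularI)

lemma index_mult:
  assumes "A \<in> carrier_mat r k" "B \<in> carrier_mat k c" "i < r" "j < c"
  shows "(A * B) $$ (i, j) = (\<Sum>l<k. A $$ (i, l) * B $$ (l, j))"
  using assms by (auto simp: scalar_prod_def atLeast0LessThan)

lemma left_right_inverse_eq:
  fixes h :: "'a::field mat"
  assumes "h \<in> carrier_mat m m" "y \<in> carrier_mat m m" "z \<in> carrier_mat m m"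
    and "h * y = 1\<^sub>m m" "z * h = 1\<^sub>m m"
  shows "z = y"
proof -
  have "z = z * (h * y)" using assms by simp
  also have "\<dots> = z * h * y" using assms(1-3) by (simp add: assoc_mult_mat[of _ m m _ m _ m])
  finally show ?thesis using assms by simp
qed

text \<open>When 2 is invertible, halving keeps the diagonal of a unitriangular matrix at 1, so that
  the transform and its inverse never leave \<open>unitri\<close>.\<close>

definition half :: "nat \<Rightarrow> 'a::field mat \<Rightarrow> 'a mat" where
  "half m x = mat m m (\<lambda>(i, j). (x $$ (i, j) + (if i = j then 1 else 0)) / 2)"

definition half_inv :: "nat \<Rightarrow> 'a::field mat \<Rightarrow> 'a mat" where
  "half_inv m x = (SOME y. y \<in> unitri m \<and> half m x * y = 1\<^sub>m m \<and> y * half m x = 1\<^sub>m m)"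

text \<open>With \<open>h = (x + 1) / 2\<close> the Cayley transform \<open>(x - 1) (x + 1)\<inverse>\<close> equals \<open>1 - h\<inverse>\<close>. Multiplied by
  the Gram matrix it becomes a symmetric or skew-symmetric matrix.\<close>

definition cayley :: "family \<Rightarrow> nat \<Rightarrow> 'a::field mat \<Rightarrow> 'a mat" where
  "cayley G n x = gram G n - gram G n * half_inv (msize G n) x"

definition form_sign :: "family \<Rightarrow> 'a::field" where
  "form_sign G = (if G = Sp then 1 else - 1)"

text \<open>This is \<open>gram\<close> times the Lie algebra of the unipotent group. Multiplication
  by \<open>gram\<close> reverses rows up to sign, which moves the strictly upper triangular support
  to \<open>i + j \<ge> msize G n\<close>; the Lie algebra condition becomes symmetry for
  \<open>Sp\<close> and skew symmetry otherwise.\<close>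

definition lie_forms :: "family \<Rightarrow> nat \<Rightarrow> 'a::field mat set" where
  "lie_forms G n = {S \<in> carrier_mat (msize G n) (msize G n).
     (\<forall>i<msize G n. \<forall>j<msize G n. S $$ (j, i) = form_sign G * S $$ (i, j)) \<and>
     (\<forall>i<msize G n. \<forall>j<msize G n. i + j < msize G n \<longrightarrow> S $$ (i, j) = 0)}"

lemma lie_formsD:
  assumes "S \<in> lie_forms G n"
  shows "S \<in> carrier_mat (msize G n) (msize G n)"
    and "i < msize G n \<Longrightarrow> j < msize G n \<Longrightarrow> S $$ (j, i) = form_sign G * S $$ (i, j)"
    and "i < msize G n \<Longrightarrow> j < msize G n \<Longrightarrow> i + j < msize G n \<Longrightarrow> S $$ (i, j) = 0"
  using assms unfolding lie_forms_def by blast+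

lemma lie_formsI:
  assumes "S \<in> carrier_mat (msize G n) (msize G n)"
    and "\<And>i j. i < msize G n \<Longrightarrow> j < msize G n \<Longrightarrow> S $$ (j, i) = form_sign G * S $$ (i, j)"
    and "\<And>i j. i < msize G n \<Longrightarrow> j < msize G n \<Longrightarrow> i + j < msize G n \<Longrightarrow> S $$ (i, j) = 0"
  shows "S \<in> lie_forms G n"
  using assms unfolding lie_forms_def by blast

section \<open>The Gram matrix in coordinates\<close>

lemma gram_index:
  assumes "a < msize G n" "b < msize G n"
  shows "gram G n $$ (a, b) =
    (if a + b = msize G n - 1 then if G = Sp \<and> n \<le> a then - 1 else 1 else (0::'a::field))"
  using assms
  by (cases G) (auto simp: gram_def block3_def msize_def blk_def off_def antidiag_def)

lemma gram_mult_index: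
  fixes A :: "'a::field mat"
  assumes A: "A \<in> carrier_mat (msize G n) k" and ab: "a < msize G n" "b < k"
  shows "(gram G n * A) $$ (a, b) =
    (if G = Sp \<and> n \<le> a then - 1 else 1) * A $$ (msize G n - 1 - a, b)"
proof -
  let ?m = "msize G n"
  have "(gram G n * A) $$ (a, b) = (\<Sum>l<?m. gram G n $$ (a, l) * A $$ (l, b))"
    by (rule index_mult[OF gram_carrier A ab])
  also have "\<dots> = (\<Sum>l<?m. if l = ?m - 1 - a then
      (if G = Sp \<and> n \<le> a then - 1 else 1) * A $$ (?m - 1 - a, b) else 0)"
    using ab by (intro sum.cong) (auto simp: gram_index)
  finally show ?thesis using ab by simp
qed

lemma gram_transpose: "transpose_mat (gram G n) = - form_sign G \<cdot>\<^sub>m (gram G n :: 'a::field mat)"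
  using gram_carrier[of G n, where 'a = 'a]
  by (intro eq_matI) (cases G; auto simp: gram_index form_sign_def msize_def)+

lemma gram_mult_transpose: "gram G n * transpose_mat (gram G n) = (1\<^sub>m (msize G n) :: 'a::field mat)"
  using mat_mult_left_right_inverse[OF _ _ gram_transpose_mult] gram_carrier[of G n, where 'a = 'a]
  by simp

lemma half_carrier: "half m x \<in> carrier_mat m m"
  by (simp add: half_def)

section \<open>Isometries as solutions of a linear equation\<close>

context
  fixes G :: family and n :: nat and tyvar :: "'a::field itself"
  assumes two: "(2::'a) \<noteq> 0"
begin

private abbreviation (input) "m \<equiv> msize G n"
private abbreviation (input) "K \<equiv> gram G n :: 'a mat"

lemma half_unitri:
  fixes x :: "'a mat"
  assumes "x \<in> unitri m"
  shows "half m x \<in> unitri m"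
  using two unitriD[OF assms] by (intro unitriI) (auto simp: half_def)

lemma half_inv:
  fixes x :: "'a mat"
  assumes "x \<in> unitri m"
  shows "half_inv m x \<in> unitri m" "half m x * half_inv m x = 1\<^sub>m m" "half_inv m x * half m x = 1\<^sub>m m"
proof -
  have "\<exists>y. y \<in> unitri m \<and> half m x * y = 1\<^sub>m m \<and> y * half m x = 1\<^sub>m m"
    using unitri_inverse[OF half_unitri[OF assms]] by metis
  from someI_ex[OF this, folded half_inv_def]
  show "half_inv m x \<in> unitri m" "half m x * half_inv m x = 1\<^sub>m m" "half_inv m x * half m x = 1\<^sub>m m"
    by blast+
qed

lemma half_inv_unique:
  fixes x y :: "'a mat"
  assumes x: "x \<in> unitri m" and y: "y \<in> carrier_mat m m" "half m x * y = 1\<^sub>m m"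
  shows "half_inv m x = y"
  by (rule left_right_inverse_eq[OF half_carrier[of m x] y(1) _ y(2) half_inv(3)[OF x]])
    (use half_inv(1)[OF x] in \<open>simp add: unitri_def\<close>)

lemma half_eq:
  fixes x :: "'a mat"
  assumes "x \<in> carrier_mat m m"
  shows "x = (2 \<cdot>\<^sub>m half m x) - 1\<^sub>m m"
  using assms two by (intro eq_matI) (auto simp: half_def field_simps)

text \<open>Substituting \<open>x = 2 h - 1\<close> leaves \<open>2 h^T K h = h^T K + K h\<close>.
  Stripping \<open>h\<close> from both sides with its inverse \<open>y\<close> turns this quadratic
  condition into one that is linear in \<open>y\<close>, which is what makes the group a vector
  space in Cayley coordinates.\<close>

lemma isometry_iff:
  fixes x y h :: "'a mat"
  assumes x: "x \<in> carrier_mat m m" and y: "y \<in> carrier_mat m m"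
    and hy: "half m x * y = 1\<^sub>m m" "y * half m x = 1\<^sub>m m"
  shows "transpose_mat x * K * x = K \<longleftrightarrow> K * y + transpose_mat y * K = 2 \<cdot>\<^sub>m K"
proof -
  define h where "h = half m x"
  have h: "h \<in> carrier_mat m m" by (simp add: h_def half_carrier)
  have K: "K \<in> carrier_mat m m" by (rule gram_carrier)
  note hy = hy[folded h_def]
  note as = assoc_mult_mat[of _ m m _ m _ m]
  have ht: "transpose_mat h \<in> carrier_mat m m" "transpose_mat y \<in> carrier_mat m m" using h y by auto
  have hyt: "transpose_mat y * transpose_mat h = 1\<^sub>m m" "transpose_mat h * transpose_mat y = 1\<^sub>m m"
    unfolding transpose_mult[OF h y, symmetric] transpose_mult[OF y h, symmetric] hy by simp_all
  define P where "P = transpose_mat h * (K * h)"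
  define Q where "Q = transpose_mat h * K"
  define R where "R = K * h"
  have c: "P \<in> carrier_mat m m" "Q \<in> carrier_mat m m" "R \<in> carrier_mat m m"
    using h ht K by (auto simp: P_def Q_def R_def)
  have xh: "x = 2 \<cdot>\<^sub>m h - 1\<^sub>m m" unfolding h_def by (rule half_eq[OF x])
  have tx: "transpose_mat x = 2 \<cdot>\<^sub>m transpose_mat h - 1\<^sub>m m"
    unfolding xh using h by (intro eq_matI) auto
  have Kx: "K * x = 2 \<cdot>\<^sub>m R - K"
    unfolding xh using h K by (simp add: mult_minus_distrib_mat[of _ m m _ m] mult_smult_distrib[of _ m m _ m] R_def)
  have "transpose_mat x * K * x = transpose_mat x * (K * x)"
    using x K by (simp add: as)
  also have "\<dots> = (2 \<cdot>\<^sub>m transpose_mat h) * (2 \<cdot>\<^sub>m R - K) - (2 \<cdot>\<^sub>m R - K)"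
    unfolding tx Kx using ht c K by (subst minus_mult_distrib_mat[of _ m m _ _ m]) auto
  also have "(2 \<cdot>\<^sub>m transpose_mat h) * (2 \<cdot>\<^sub>m R - K) = 2 \<cdot>\<^sub>m (2 \<cdot>\<^sub>m P) - 2 \<cdot>\<^sub>m Q"
    using ht c K
    by (simp add: mult_minus_distrib_mat[of _ m m _ m] mult_smult_distrib[of _ m m _ m]
        mult_smult_assoc_mat[of _ m m _ m] P_def Q_def R_def)
  finally have e: "transpose_mat x * K * x = (2 \<cdot>\<^sub>m (2 \<cdot>\<^sub>m P) - 2 \<cdot>\<^sub>m Q) - (2 \<cdot>\<^sub>m R - K)" .
  have "transpose_mat x * K * x = K \<longleftrightarrow> 2 \<cdot>\<^sub>m P = Q + R"
  proof -
    have "2 * (2 * p) - 2 * q - (2 * r - k) = k \<longleftrightarrow> 2 * p = q + r" for p q r k :: 'a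
    proof -
      have "2 * (2 * p) - 2 * q - (2 * r - k) = k \<longleftrightarrow> 2 * (2 * p) = 2 * (q + r)"
        by (auto simp: algebra_simps)
      then show ?thesis by (simp only: mult_left_cancel[OF two])
    qed
    then show ?thesis unfolding e using c K by (simp add: mat_eq_iff)
  qed
  also have "2 \<cdot>\<^sub>m P = Q + R \<longleftrightarrow> K * y + transpose_mat y * K = 2 \<cdot>\<^sub>m K"
  proof
    assume "2 \<cdot>\<^sub>m P = Q + R"
    then have "transpose_mat y * (2 \<cdot>\<^sub>m P) * y = transpose_mat y * (Q + R) * y" by simp
    moreover have "transpose_mat y * (2 \<cdot>\<^sub>m P) * y = 2 \<cdot>\<^sub>m K"
    proof -
      have "transpose_mat y * P * y = (transpose_mat y * transpose_mat h) * K * (h * y)"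
        unfolding P_def using ht h y K by (simp add: as)
      also have "\<dots> = K" using hy hyt K by simp
      finally show ?thesis using ht c y
        by (simp add: mult_smult_distrib[of _ m m _ m] mult_smult_assoc_mat[of _ m m _ m])
    qed
    moreover have "transpose_mat y * (Q + R) * y = K * y + transpose_mat y * K"
    proof -
      have "transpose_mat y * Q = (transpose_mat y * transpose_mat h) * K"
        unfolding Q_def using ht h y K by (simp add: as)
      then have Q: "transpose_mat y * Q = K" using hyt K by simp
      have "transpose_mat y * R * y = transpose_mat y * (K * (h * y))"
        unfolding R_def using ht h y K by (simp add: as)
      then have R: "transpose_mat y * R * y = transpose_mat y * K" using hy K by simp
      have "transpose_mat y * (Q + R) * y = (transpose_mat y * Q + transpose_mat y * R) * y"
        using ht c by (simp add: mult_add_distrib_mat[of _ m m _ m])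
      also have "\<dots> = K * y + transpose_mat y * K"
        using Q R ht c y K by (subst add_mult_distrib_mat[of _ m m _ _ m]) auto
      finally show ?thesis .
    qed
    ultimately show "K * y + transpose_mat y * K = 2 \<cdot>\<^sub>m K" by simp
  next
    assume "K * y + transpose_mat y * K = 2 \<cdot>\<^sub>m K"
    then have "transpose_mat h * (2 \<cdot>\<^sub>m K) * h = transpose_mat h * (K * y + transpose_mat y * K) * h" by simp
    moreover have "transpose_mat h * (2 \<cdot>\<^sub>m K) * h = 2 \<cdot>\<^sub>m P"
      unfolding P_def using ht h K
      by (simp add: mult_smult_distrib[of _ m m _ m] mult_smult_assoc_mat[of _ m m _ m] as)
    moreover have "transpose_mat h * (K * y + transpose_mat y * K) * h = Q + R"
    proof -
      have a: "transpose_mat h * (K * y) * h = transpose_mat h * (K * (y * h))"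
        using ht h y K by (simp add: as)
      have b: "transpose_mat h * (transpose_mat y * K) * h = (transpose_mat h * transpose_mat y) * (K * h)"
        using ht h y K by (simp add: as)
      have "transpose_mat h * (K * y + transpose_mat y * K) * h =
        (transpose_mat h * (K * y) + transpose_mat h * (transpose_mat y * K)) * h"
        using ht y K by (subst mult_add_distrib_mat[of _ m m _ m]) auto
      also have "\<dots> = transpose_mat h * (K * y) * h + transpose_mat h * (transpose_mat y * K) * h"
        using ht h y K by (subst add_mult_distrib_mat[of _ m m _ _ m]) auto
      also have "\<dots> = Q + R" unfolding a b using hy hyt h K by (simp add: Q_def R_def)
      finally show ?thesis .
    qed
    ultimately show "2 \<cdot>\<^sub>m P = Q + R" by simp
  qed
  finally show ?thesis .
qed

text \<open>The transpose of \<open>gram\<close> is \<open>- form_sign G\<close> times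
  \<open>gram\<close>, so transposing \<open>K * y\<close> produces the second term of the equation
  up to this sign.\<close>

lemma skew_iff:
  fixes y :: "'a mat"
  assumes y: "y \<in> carrier_mat m m"
  shows "K * y + transpose_mat y * K = 2 \<cdot>\<^sub>m K \<longleftrightarrow>
    (\<forall>i<m. \<forall>j<m. (K - K * y) $$ (j, i) = form_sign G * (K - K * y) $$ (i, j))"
proof -
  have K: "K \<in> carrier_mat m m" by (rule gram_carrier)
  define s where "s = (form_sign G :: 'a)"
  have s: "s * s = 1" by (simp add: s_def form_sign_def)
  have Kt: "K $$ (i, j) = - s * K $$ (j, i)" if "i < m" "j < m" for i j
  proof -
    have "K $$ (i, j) = transpose_mat K $$ (j, i)" using that K by simp
    also have "\<dots> = - s * K $$ (j, i)" unfolding gram_transpose s_def[symmetric] using that K by simp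
    finally show ?thesis .
  qed
  have t: "transpose_mat y * K = transpose_mat (transpose_mat K * y)"
    using K y by (simp add: transpose_mult[of _ m m _ m])
  have tK: "(transpose_mat y * K) $$ (i, j) = - s * (K * y) $$ (j, i)" if "i < m" "j < m" for i j
    unfolding t gram_transpose s_def[symmetric] using that K y by (simp add: mult_smult_assoc_mat[of _ m m _ m])
  have "K * y + transpose_mat y * K = 2 \<cdot>\<^sub>m K \<longleftrightarrow>
    (\<forall>i<m. \<forall>j<m. (K * y) $$ (i, j) + (transpose_mat y * K) $$ (i, j) = 2 * K $$ (i, j))"
    using K y by (simp add: mat_eq_iff)
  also have "\<dots> \<longleftrightarrow> (\<forall>i<m. \<forall>j<m. (K - K * y) $$ (j, i) = s * (K - K * y) $$ (i, j))"
  proof -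
    have "p + - s * q = 2 * k \<longleftrightarrow> k' - q = s * (k - p)"
      if k: "k' = - s * k" for p q k k' :: 'a
    proof -
      have "k' - q = s * (k - p) \<longleftrightarrow> s * (k' - q) = s * (s * (k - p))" using s by auto
      also have "\<dots> \<longleftrightarrow> p + - s * q = 2 * k"
        unfolding k using s by (auto simp: algebra_simps mult.assoc[symmetric])
      finally show ?thesis by blast
    qed
    note eq = this
    have "(K * y) $$ (i, j) + (transpose_mat y * K) $$ (i, j) = 2 * K $$ (i, j) \<longleftrightarrow>
      (K - K * y) $$ (j, i) = s * (K - K * y) $$ (i, j)" if ij: "i < m" "j < m" for i j
    proof -
      have "(K - K * y) $$ (j, i) = K $$ (j, i) - (K * y) $$ (j, i)"
        "(K - K * y) $$ (i, j) = K $$ (i, j) - (K * y) $$ (i, j)" using ij K y by auto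
      then show ?thesis unfolding tK[OF ij] using eq[OF Kt[OF ij(2,1)]] by simp
    qed
    then show ?thesis by blast
  qed
  finally show ?thesis unfolding s_def .
qed

lemma unip_iff_skew:
  fixes x :: "'a mat"
  assumes x: "x \<in> unitri m"
  shows "x \<in> unip G n \<longleftrightarrow> (\<forall>i<m. \<forall>j<m. cayley G n x $$ (j, i) = form_sign G * cayley G n x $$ (i, j))"
proof -
  have c: "x \<in> carrier_mat m m" "half_inv m x \<in> carrier_mat m m"
    using x half_inv(1)[OF x] by (auto simp: unitri_def)
  have "x \<in> unip G n \<longleftrightarrow> transpose_mat x * K * x = K"
    using x c by (simp add: unip_def classical_group_def)
  then show ?thesis
    using isometry_iff[OF c half_inv(2,3)[OF x]] skew_iff[OF c(2)] by (simp add: cayley_def)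
qed

lemma cayley_mult:
  fixes x :: "'a mat"
  assumes x: "x \<in> unitri m"
  shows "cayley G n x = K * (1\<^sub>m m - half_inv m x)"
proof -
  have "half_inv m x \<in> carrier_mat m m" using half_inv(1)[OF x] by (simp add: unitri_def)
  then show ?thesis unfolding cayley_def using gram_carrier[of G n, where 'a = 'a]
    by (simp add: mult_minus_distrib_mat[of _ m m _ m])
qed

lemma cayley_index:
  fixes x :: "'a mat"
  assumes x: "x \<in> unitri m" and ab: "a < m" "b < m"
  shows "cayley G n x $$ (a, b) =
    (if G = Sp \<and> n \<le> a then - 1 else 1) * (1\<^sub>m m - half_inv m x) $$ (m - 1 - a, b)"
  unfolding cayley_mult[OF x] using half_inv(1)[OF x] ab
  by (intro gram_mult_index) (auto simp: unitri_def)

lemma cayley_carrier: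
  fixes x :: "'a mat"
  assumes "x \<in> unitri m"
  shows "cayley G n x \<in> carrier_mat m m"
  using gram_carrier[of G n, where 'a = 'a] half_inv(1)[OF assms] by (auto simp: cayley_def unitri_def)

lemma cayley_zero:
  fixes x :: "'a mat"
  assumes x: "x \<in> unitri m" and ab: "a < m" "b < m" "a + b < m"
  shows "cayley G n x $$ (a, b) = 0"
proof -
  note y = half_inv(1)[OF x]
  have "(1\<^sub>m m - half_inv m x) $$ (m - 1 - a, b) = 0"
  proof (cases "b = m - 1 - a")
    case True
    then show ?thesis using ab unitriD(1)[OF y] unitriD(2)[OF y, of b] by simp
  next
    case False
    then have "b < m - 1 - a" using ab by simp
    then show ?thesis using ab unitriD(1)[OF y] unitriD(3)[OF y, of b "m - 1 - a"] by simp
  qed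
  then show ?thesis by (simp add: cayley_index[OF x ab(1,2)])
qed

lemma cayley_bij: "bij_betw (cayley G n) (unip G n :: 'a mat set) (lie_forms G n)"
  unfolding bij_betw_def
proof (intro conjI equalityI subsetI)
  have K: "K \<in> carrier_mat m m" by (rule gram_carrier)
  note as = assoc_mult_mat[of _ m m _ m _ m]
  show "inj_on (cayley G n) (unip G n :: 'a mat set)"
  proof (rule inj_onI)
    fix x x' :: "'a mat" assume "x \<in> unip G n" "x' \<in> unip G n" and eq: "cayley G n x = cayley G n x'"
    then have u: "x \<in> unitri m" "x' \<in> unitri m" by (auto simp: unip_def)
    let ?y = "half_inv m x" and ?y' = "half_inv m x'"
    have c: "x \<in> carrier_mat m m" "x' \<in> carrier_mat m m" "?y \<in> carrier_mat m m" "?y' \<in> carrier_mat m m"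
      using u half_inv(1)[OF u(1)] half_inv(1)[OF u(2)] by (auto simp: unitri_def)
    have "K * ?y = K * ?y'" using eq K c by (auto simp: cayley_def mat_eq_iff)
    then have "transpose_mat K * (K * ?y) = transpose_mat K * (K * ?y')" by simp
    moreover have "transpose_mat K * (K * z) = z" if "z \<in> carrier_mat m m" for z
    proof -
      have "transpose_mat K * (K * z) = transpose_mat K * K * z" using that K by (simp add: as)
      then show ?thesis using that by (simp add: gram_transpose_mult)
    qed
    ultimately have yy: "?y = ?y'" using c by simp
    have "half m x = half m x'"
      by (rule left_right_inverse_eq[of ?y m])
        (use c half_carrier half_inv(3)[OF u(2)] half_inv(2)[OF u(1)] yy in auto)
    then show "x = x'" using half_eq[OF c(1)] half_eq[OF c(2)] by simp
  qed
next
  fix S assume "S \<in> cayley G n ` (unip G n :: 'a mat set)"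
  then obtain x :: "'a mat" where x: "x \<in> unip G n" "S = cayley G n x" by blast
  then have u: "x \<in> unitri m" by (simp add: unip_def)
  show "S \<in> lie_forms G n"
    unfolding x(2) using unip_iff_skew[OF u] x(1) cayley_carrier[OF u] cayley_zero[OF u]
    by (intro lie_formsI) blast+
next
  fix S :: "'a mat" assume S: "S \<in> lie_forms G n"
  have K: "K \<in> carrier_mat m m" by (rule gram_carrier)
  note as = assoc_mult_mat[of _ m m _ m _ m]
  note Sc = lie_formsD(1)[OF S]
  \<comment> \<open>The transpose of \<open>gram\<close> is its inverse, so \<open>A\<close> solves
    \<open>K * A = S\<close>; the support of \<open>S\<close> makes it strictly upper
    triangular.\<close>
  define A where "A = transpose_mat K * S"
  have Ac: "A \<in> carrier_mat m m" using K Sc by (simp add: A_def)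
  have KA: "K * A = S"
  proof -
    have "K * A = K * transpose_mat K * S" unfolding A_def using K Sc by (simp add: as)
    then show ?thesis using Sc by (simp add: gram_mult_transpose)
  qed
  have A0: "A $$ (i, j) = 0" if "j \<le> i" "i < m" for i j
  proof -
    have "(K * A) $$ (m - 1 - i, j) = 0"
      unfolding KA using lie_formsD(3)[OF S, of "m - 1 - i" j] that by simp
    then show ?thesis using gram_mult_index[OF Ac, of "m - 1 - i" j] that by (auto split: if_splits)
  qed
  have y: "1\<^sub>m m - A \<in> unitri m" by (rule unitriI) (use Ac A0 in auto)
  then obtain h where h: "h \<in> unitri m" "(1\<^sub>m m - A) * h = 1\<^sub>m m" "h * (1\<^sub>m m - A) = 1\<^sub>m m"
    using unitri_inverse by metis
  \<comment> \<open>The inverse Cayley transform: \<open>h\<close> is the inverse of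
    \<open>1 - A\<close>, and \<open>x\<close> is recovered from its half sum with 1.\<close>
  define x where "x = 2 \<cdot>\<^sub>m h - 1\<^sub>m m"
  have hc: "h \<in> carrier_mat m m" using h by (simp add: unitri_def)
  have xu: "x \<in> unitri m"
    using unitriD[OF h(1)] by (intro unitriI) (auto simp: x_def)
  have hx: "half m x = h"
    using hc two by (intro eq_matI) (auto simp: half_def x_def)
  have hi: "half_inv m x = 1\<^sub>m m - A"
    by (rule half_inv_unique[OF xu]) (use y h hx in \<open>auto simp: unitri_def\<close>)
  have "1\<^sub>m m - (1\<^sub>m m - A) = A" using Ac by (intro eq_matI) auto
  then have cx: "cayley G n x = S" using cayley_mult[OF xu] hi KA by simp
  then have "x \<in> unip G n" using unip_iff_skew[OF xu] lie_formsD(2)[OF S] by blast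
  then show "S \<in> cayley G n ` unip G n" using cx by blast
qed

text \<open>For an isometry \<open>g\<close> with inverse \<open>p\<close> one has
  \<open>K * g = transpose_mat p * K\<close>. Multiplying the conjugate of \<open>half_inv\<close>
  by \<open>gram\<close> therefore yields a congruence.\<close>

lemma cayley_conj:
  fixes g p x :: "'a mat"
  assumes x: "x \<in> unip G n" and g: "g \<in> unip G n" and p: "p \<in> unip G n"
    and gp: "g * p = 1\<^sub>m m" "p * g = 1\<^sub>m m"
  shows "cayley G n (g * x * p) = transpose_mat p * cayley G n x * p"
proof -
  have K: "K \<in> carrier_mat m m" by (rule gram_carrier)
  note as = assoc_mult_mat[of _ m m _ m _ m]
  have u: "x \<in> unitri m" "g \<in> unitri m" "p \<in> unitri m" using x g p by (auto simp: unip_def)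
  have u': "g * x * p \<in> unitri m" using u by (intro unitri_mult)
  let ?y = "half_inv m x"
  have c: "x \<in> carrier_mat m m" "g \<in> carrier_mat m m" "p \<in> carrier_mat m m" "?y \<in> carrier_mat m m"
    using u half_inv(1)[OF u(1)] by (auto simp: unitri_def)
  have pKp: "transpose_mat p * K * p = K" using p by (simp add: unip_def classical_group_def)
  have hx: "half m (g * x * p) = g * half m x * p"
  proof -
    have e: "half m z = (1/2) \<cdot>\<^sub>m (z + 1\<^sub>m m)" if "z \<in> carrier_mat m m" for z :: "'a mat"
      using that by (intro eq_matI) (auto simp: half_def)
    have "g * half m x * p = (1/2) \<cdot>\<^sub>m (g * (x + 1\<^sub>m m) * p)"
      unfolding e[OF c(1)] using c by (simp add: mult_smult_distrib[of _ m m _ m] mult_smult_assoc_mat[of _ m m _ m])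
    also have "g * (x + 1\<^sub>m m) * p = g * x * p + g * p"
      using c by (simp add: mult_add_distrib_mat[of _ m m _ m] add_mult_distrib_mat[of _ m m _ _ m])
    finally show ?thesis using e[of "g * x * p"] c gp by simp
  qed
  have hi: "half_inv m (g * x * p) = g * ?y * p"
  proof (rule half_inv_unique[OF u'])
    have "g * half m x * p * (g * ?y * p) = g * half m x * (p * g) * ?y * p"
      using c half_carrier[of m x] by (simp add: as)
    also have "\<dots> = g * (half m x * ?y) * p" using c half_carrier[of m x] gp by (simp add: as)
    also have "\<dots> = 1\<^sub>m m" using c gp half_inv(2)[OF u(1)] by simp
    finally show "half m (g * x * p) * (g * ?y * p) = 1\<^sub>m m" unfolding hx .
  qed (use c in simp)
  have Kg: "K * g = transpose_mat p * K"
  proof -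
    have "K * g = transpose_mat p * K * p * g" using pKp by simp
    also have "\<dots> = transpose_mat p * K * (p * g)" using c K by (simp add: as)
    finally show ?thesis using gp c K by simp
  qed
  have "transpose_mat p * cayley G n x * p = transpose_mat p * K * p - transpose_mat p * (K * ?y) * p"
    unfolding cayley_def using c K
    by (simp add: mult_minus_distrib_mat[of _ m m _ m] minus_mult_distrib_mat[of _ m m _ _ m])
  also have "transpose_mat p * (K * ?y) * p = (transpose_mat p * K) * (?y * p)"
    using c K by (simp add: as)
  also have "\<dots> = K * (g * ?y * p)" unfolding Kg[symmetric] using c K by (simp add: as)
  finally show ?thesis unfolding pKp cayley_def hi by simp
qed

lemma cayley_one: "cayley G n (1\<^sub>m m :: 'a mat) = 0\<^sub>m m m"
proof -
  have "half m (1\<^sub>m m :: 'a mat) = 1\<^sub>m m" using two by (intro eq_matI) (auto simp: half_def)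
  then have "half_inv m (1\<^sub>m m :: 'a mat) = 1\<^sub>m m" by (intro half_inv_unique unitri_one) auto
  then show ?thesis using gram_carrier[of G n, where 'a = 'a] by (auto simp: cayley_def)
qed

text \<open>The relation \<open>x - 1 = 2 (1 - h\<inverse>) h = 2 h (1 - h\<inverse>)\<close>, by entries.\<close>

lemma cayley_entries:
  fixes x :: "'a mat"
  assumes x: "x \<in> unitri m" and ij: "i < m" "j < m"
  defines "A \<equiv> 1\<^sub>m m - half_inv m x"
  shows "(x - 1\<^sub>m m) $$ (i, j) = 2 * (\<Sum>k<m. A $$ (i, k) * half m x $$ (k, j))"
    "(x - 1\<^sub>m m) $$ (i, j) = 2 * (\<Sum>k<m. half m x $$ (i, k) * A $$ (k, j))"
    "A $$ (i, j) = (\<Sum>k<m. (x - 1\<^sub>m m) $$ (i, k) * half_inv m x $$ (k, j)) / 2"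
proof -
  let ?h = "half m x" and ?y = "half_inv m x"
  have c: "x \<in> carrier_mat m m" "?h \<in> carrier_mat m m" "?y \<in> carrier_mat m m"
    using x half_inv(1)[OF x] half_carrier by (auto simp: unitri_def)
  have A: "A \<in> carrier_mat m m" unfolding A_def by (rule minus_carrier_mat[OF c(3)])
  have e: "(x - 1\<^sub>m m) $$ (i, j) = 2 * (?h - 1\<^sub>m m) $$ (i, j)" if "i < m" "j < m" for i j
    using c that two by (auto simp: half_def field_simps)
  have "A * ?h = ?h - 1\<^sub>m m" "?h * A = ?h - 1\<^sub>m m"
    unfolding A_def using c half_inv(2,3)[OF x]
    by (simp_all add: minus_mult_distrib_mat[of _ m m _ _ m] mult_minus_distrib_mat[of _ m m _ m])
  then show "(x - 1\<^sub>m m) $$ (i, j) = 2 * (\<Sum>k<m. A $$ (i, k) * ?h $$ (k, j))"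
    "(x - 1\<^sub>m m) $$ (i, j) = 2 * (\<Sum>k<m. ?h $$ (i, k) * A $$ (k, j))"
    using e[OF ij] index_mult[OF A c(2) ij] index_mult[OF c(2) A ij] by simp_all
  have "A = (?h - 1\<^sub>m m) * ?y"
    unfolding A_def using c half_inv(2)[OF x] by (simp add: minus_mult_distrib_mat[of _ m m _ _ m])
  then have "A $$ (i, j) = (\<Sum>k<m. (?h - 1\<^sub>m m) $$ (i, k) * ?y $$ (k, j))"
    by (simp only: index_mult[OF minus_carrier_mat[OF one_carrier_mat] c(3) ij])
  also have "\<dots> = (\<Sum>k<m. (x - 1\<^sub>m m) $$ (i, k) * ?y $$ (k, j) / 2)"
    by (intro sum.cong refl, subst e) (use ij two in auto)
  finally show "A $$ (i, j) = (\<Sum>k<m. (x - 1\<^sub>m m) $$ (i, k) * ?y $$ (k, j)) / 2"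
    by (simp add: sum_divide_distrib)
qed

end

section \<open>Lower rows of unipotent elements\<close>

lemma antidiag_mult_index:
  fixes Z :: "'a::field mat"
  assumes "Z \<in> carrier_mat n k" "i < n" "j < k"
  shows "(antidiag n * Z) $$ (i, j) = Z $$ (n - 1 - i, j)"
proof -
  have "(antidiag n * Z) $$ (i, j) = (\<Sum>l<n. antidiag n $$ (i, l) * Z $$ (l, j))"
    by (rule index_mult) (use assms in auto)
  also have "\<dots> = (\<Sum>l<n. if l = n - 1 - i then Z $$ (n - 1 - i, j) else 0)"
    using assms by (intro sum.cong) (auto simp: antidiag_def)
  finally show ?thesis using assms by simp
qed

text \<open>In the block description the middle and bottom rows are governed by \<open>x\<close> and
  \<open>v\<close>, which are free. The remaining block \<open>w\<close> occurs only in the top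
  rows, and its relation always has a solution.\<close>

lemma unip_lower_rows:
  fixes g :: "'a::field mat"
  assumes two: "(2::'a) \<noteq> 0" and g: "g \<in> unitri (msize G n)"
  obtains h where "h \<in> unip G n"
    "\<And>i j. n \<le> i \<Longrightarrow> i < msize G n \<Longrightarrow> j < msize G n \<Longrightarrow> h $$ (i, j) = g $$ (i, j)"
proof -
  define r where "r = mid G"
  have r: "r \<le> 1" by (cases G) (auto simp: r_def)
  have ms: "msize G n = 2 * n + r" by (simp add: msize_def r_def)
  define J where "J = (antidiag n :: 'a mat)"
  have J: "J \<in> carrier_mat n n" "J * J = 1\<^sub>m n" "transpose_mat J = J" by (simp_all add: J_def)
  from unitri_ex_ublocks[OF g[unfolded ms] r] obtain A B C F H where
    c: "A \<in> carrier_mat n n" "B \<in> carrier_mat n r" "C \<in> carrier_mat n n"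
      "F \<in> carrier_mat r n" "H \<in> carrier_mat n n" "A \<in> unitri n" "H \<in> unitri n"
    and ge: "g = ublocks n r A B C F H" .
  have as: "P * Q * R = P * (Q * R)" if "P \<in> carrier_mat a b" "Q \<in> carrier_mat b c" "R \<in> carrier_mat c d"
    for P Q R :: "'a mat" and a b c d
    using that by (rule assoc_mult_mat)
  have JJ: "J * (J * Z) = Z" if "Z \<in> carrier_mat n k" for Z k
    using antidiag_cancel[OF that] by (simp add: J_def)
  have JJ': "Z * J * J = Z" if "Z \<in> carrier_mat k n" for Z k
    using as[OF that J(1) J(1)] J that by simp
  \<comment> \<open>\<open>H\<close> reflected in the antidiagonal, hence again unitriangular;
    chosen so that the bottom right block \<open>J y^T J\<close> equals \<open>H\<close>.\<close>
  define y where "y = J * (transpose_mat H * J)"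
  have Ht: "transpose_mat H \<in> carrier_mat n n" using c by simp
  have yc: "y \<in> carrier_mat n n" using J Ht by (simp add: y_def)
  have yi: "y $$ (i, j) = H $$ (n - 1 - j, n - 1 - i)" if "i < n" "j < n" for i j
  proof -
    have "y $$ (i, j) = (transpose_mat H * J) $$ (n - 1 - i, j)"
      unfolding y_def J_def using that Ht J by (intro antidiag_mult_index) (auto simp: J_def)
    also have "transpose_mat H * J = transpose_mat (J * H)"
      using transpose_mult[OF J(1) c(5)] J by simp
    also have "transpose_mat (J * H) $$ (n - 1 - i, j) = (J * H) $$ (j, n - 1 - i)"
      using that J c(5) by (subst index_transpose_mat) auto
    also have "\<dots> = H $$ (n - 1 - j, n - 1 - i)"
      unfolding J_def using that c(5) by (intro antidiag_mult_index) auto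
    finally show ?thesis .
  qed
  have yu: "y \<in> unitri n"
    using unitriD(2,3)[OF c(7)] by (intro unitriI[OF yc]) (auto simp: yi)
  obtain x where x: "x \<in> unitri n" "x * y = 1\<^sub>m n" using unitri_inverse[OF yu] by metis
  have "transpose_mat y = transpose_mat (transpose_mat H * J) * J"
    unfolding y_def using transpose_mult[OF J(1), of "transpose_mat H * J" n] Ht J by simp
  also have "transpose_mat (transpose_mat H * J) = J * H"
    using transpose_mult[OF Ht J(1)] J by simp
  finally have ty: "transpose_mat y = J * H * J" .
  have H: "J * transpose_mat y * J = H"
  proof -
    have "J * (J * H * J) = H * J" using as[OF J(1) c(5) J(1)] JJ[of "H * J" n] c(5) J by simp
    then show ?thesis unfolding ty using JJ'[OF c(5)] by simp
  qed
  define v where "v = - transpose_mat (F * J)"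
  have v: "v \<in> carrier_mat n r" using c J by (simp add: v_def)
  have tv: "transpose_mat v = - (F * J)" unfolding v_def by (simp add: transpose_uminus)
  have F: "- (transpose_mat v * J) = F"
  proof -
    have "- (F * J) * J = - (F * J * J)" using c(4) J(1) by (intro uminus_mult_left_mat) simp
    then show ?thesis unfolding tv using JJ'[OF c(4)] by simp
  qed
  \<comment> \<open>Because \<open>v * transpose_mat v\<close> is symmetric, both terms of the
    relation for \<open>w\<close> become \<open>- 1 / 2\<close> times it, which add up to the
    required value.\<close>
  define w where "w = (if G = O_odd then (- 1 / 2) \<cdot>\<^sub>m (v * transpose_mat v * J) else 0\<^sub>m n n)"
  have vv: "v * transpose_mat v \<in> carrier_mat n n" using v by simp
  have w: "w \<in> carrier_mat n n" using vv J by (simp add: w_def)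
  have Q: "case G of
      Sp \<Rightarrow> antidiag n * transpose_mat w - w * antidiag n = 0\<^sub>m n n
    | O_even \<Rightarrow> antidiag n * transpose_mat w + w * antidiag n = 0\<^sub>m n n
    | O_odd \<Rightarrow> antidiag n * transpose_mat w + w * antidiag n = - (v * transpose_mat v)"
  proof (cases "G = O_odd")
    case True
    have "transpose_mat w = (- 1 / 2) \<cdot>\<^sub>m transpose_mat (v * transpose_mat v * J)"
      using True vv J by (intro eq_matI) (auto simp: w_def)
    also have "transpose_mat (v * transpose_mat v * J) = J * (v * transpose_mat v)"
      using transpose_mult[OF vv J(1)] transpose_mult[of v n r "transpose_mat v" n] v J by simp
    finally have tw: "transpose_mat w = (- 1 / 2) \<cdot>\<^sub>m (J * (v * transpose_mat v))" .
    have "J * transpose_mat w = (- 1 / 2) \<cdot>\<^sub>m (v * transpose_mat v)"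
      unfolding tw using JJ[OF vv] J vv by (simp add: mult_smult_distrib[of _ n n _ n])
    moreover have "w * J = (- 1 / 2) \<cdot>\<^sub>m (v * transpose_mat v)"
      using True JJ'[OF vv] J vv by (simp add: w_def mult_smult_assoc_mat[of _ n n _ n])
    moreover have "(- 1 / 2) \<cdot>\<^sub>m Z + (- 1 / 2) \<cdot>\<^sub>m Z = - Z" for Z :: "'a mat"
      using two by (intro eq_matI) (auto simp: field_simps)
    ultimately show ?thesis using True by (simp add: J_def)
  next
    case False
    have "transpose_mat (0\<^sub>m n n) = (0\<^sub>m n n :: 'a mat)" by (intro eq_matI) auto
    moreover have "J * 0\<^sub>m n n = 0\<^sub>m n n" "0\<^sub>m n n * J = 0\<^sub>m n n"
      using mult_one_zero(3,4)[OF J(1)] by auto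
    moreover have "0\<^sub>m n n - 0\<^sub>m n n = (0\<^sub>m n n :: 'a mat)" by (intro eq_matI) auto
    ultimately show ?thesis using False by (cases G) (simp_all add: w_def J_def)
  qed
  define h where "h = block3 n r
       [[x, x * v, x * w],
        [0\<^sub>m r n, 1\<^sub>m r, - (transpose_mat v * antidiag n)],
        [0\<^sub>m n n, 0\<^sub>m n r, antidiag n * transpose_mat y * antidiag n]]"
  have "h \<in> unip G n"
    unfolding unip_eq_blocks h_def r_def[symmetric]
    by (rule CollectI, rule exI[of _ x], rule exI[of _ y], rule exI[of _ v], rule exI[of _ w])
      (use x yc v w Q in blast)
  moreover have "h $$ (i, j) = g $$ (i, j)" if "n \<le> i" "i < msize G n" "j < msize G n" for i j
  proof -
    have "blk n r i = 1 \<or> blk n r i = 2" using that by (auto simp: blk_def)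
    then show ?thesis
      using that H F unfolding h_def ge ublocks_def block3_def ms J_def by auto
  qed
  ultimately show ?thesis using that by blast
qed

text \<open>In the sum over the products \<open>h * g\<close> with \<open>h\<close> unipotent, \<open>g\<close> may be replaced by
  a unipotent element with the same lower rows.\<close>

lemma sum_unip_lower_rows:
  fixes F :: "'a::{field,finite} mat \<Rightarrow> complex"
  assumes two: "(2::'a) \<noteq> 0"
    and F: "\<And>g h. g \<in> unitri (msize G n) \<Longrightarrow> h \<in> unitri (msize G n) \<Longrightarrow>
      (\<And>i j. n \<le> i \<Longrightarrow> i < msize G n \<Longrightarrow> j < msize G n \<Longrightarrow> h $$ (i, j) = g $$ (i, j)) \<Longrightarrow> F g = F h"
  shows "of_nat (card (unip G n :: 'a mat set)) * (\<Sum>g\<in>unitri (msize G n). F g) =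
    of_nat (card (unitri (msize G n) :: 'a mat set)) * (\<Sum>h\<in>unip G n. F h)"
proof -
  let ?m = "msize G n"
  let ?T = "unitri ?m :: 'a mat set"
  let ?U = "unip G n :: 'a mat set"
  interpret U: group "unip_group G n :: 'a mat monoid" by (rule unip_group)
  have UT: "h \<in> ?T" if "h \<in> ?U" for h using that by (simp add: unip_def)
  note car = unitriD(1)
  have left: "(\<Sum>g\<in>?T. F (h * g)) = (\<Sum>g\<in>?T. F g)" if h: "h \<in> ?T" for h
  proof -
    obtain k where k: "k \<in> ?T" "h * k = 1\<^sub>m ?m" "k * h = 1\<^sub>m ?m" using unitri_inverse[OF h] by metis
    have "h * (k * g) = g \<and> k * (h * g) = g" if "g \<in> ?T" for g
      using car[OF h] car[OF k(1)] car[OF that] k(2,3)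
        assoc_mult_mat[of h ?m ?m k ?m g ?m] assoc_mult_mat[of k ?m ?m h ?m g ?m] by simp
    then show ?thesis
      by (intro sum.reindex_bij_witness[of _ "\<lambda>g. k * g" "\<lambda>g. h * g"])
        (use unitri_mult h k in auto)
  qed
  have right: "(\<Sum>h\<in>?U. F (h * g)) = (\<Sum>h\<in>?U. F h)" if g: "g \<in> ?T" for g
  proof -
    \<comment> \<open>Since \<open>h\<close> is upper triangular, the lower rows of
      \<open>h * g\<close> involve only the lower rows of \<open>g\<close>. Replacing
      \<open>g\<close> by \<open>g0\<close>, which lies in the group, makes the right translation a
      permutation of \<open>?U\<close>.\<close>
    obtain g0 where g0: "g0 \<in> ?U" and agree: "\<And>i j. n \<le> i \<Longrightarrow> i < ?m \<Longrightarrow> j < ?m \<Longrightarrow> g0 $$ (i, j) = g $$ (i, j)"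
      using unip_lower_rows[OF two g] by metis
    obtain k where k: "k \<in> ?U" "g0 * k = 1\<^sub>m ?m" "k * g0 = 1\<^sub>m ?m"
      using U.l_inv_ex[of g0] U.r_inv_ex[of g0] g0 U.inv_closed[of g0] U.l_inv[of g0] U.r_inv[of g0]
      by (auto simp: unip_group_def)
    have "F (h * g) = F (h * g0)" if h: "h \<in> ?U" for h
    proof (rule F)
      show "h * g \<in> ?T" "h * g0 \<in> ?T" using unitri_mult UT h g g0 by auto
      fix i j assume ij: "n \<le> i" "i < ?m" "j < ?m"
      show "(h * g0) $$ (i, j) = (h * g) $$ (i, j)"
        unfolding index_mult[OF car[OF UT[OF h]] car[OF UT[OF g0]] ij(2,3)]
          index_mult[OF car[OF UT[OF h]] car[OF g] ij(2,3)]
      proof (rule sum.cong[OF refl])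
        fix l assume l: "l \<in> {..<?m}"
        show "h $$ (i, l) * g0 $$ (l, j) = h $$ (i, l) * g $$ (l, j)"
          using agree[of l j] unitriD(3)[OF UT[OF h], of l i] ij l by (cases "n \<le> l") auto
      qed
    qed
    then have "(\<Sum>h\<in>?U. F (h * g)) = (\<Sum>h\<in>?U. F (h * g0))" by (intro sum.cong) auto
    also have "\<dots> = (\<Sum>h\<in>?U. F h)"
    proof (rule sum.reindex_bij_witness[of _ "\<lambda>h. h * k" "\<lambda>h. h * g0"])
      fix h assume h: "h \<in> ?U"
      note c = car[OF UT[OF h]] car[OF UT[OF g0]] car[OF UT[OF k(1)]]
      show "h * g0 * k = h" "h * k * g0 = h"
        using c k(2,3) assoc_mult_mat[of h ?m ?m g0 ?m k ?m] assoc_mult_mat[of h ?m ?m k ?m g0 ?m] by auto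
      show "h * g0 \<in> ?U" "h * k \<in> ?U"
        using U.m_closed[of h g0] U.m_closed[of h k] h g0 k by (auto simp: unip_group_def)
    qed auto
    finally show ?thesis .
  qed
  \<comment> \<open>The double sum of \<open>F (h * g)\<close> over both groups is evaluated in
    either order.\<close>
  have "of_nat (card ?U) * (\<Sum>g\<in>?T. F g) = (\<Sum>h\<in>?U. \<Sum>g\<in>?T. F (h * g))"
    by (simp add: left UT)
  also have "\<dots> = (\<Sum>g\<in>?T. \<Sum>h\<in>?U. F (h * g))" by (rule sum.swap)
  also have "\<dots> = of_nat (card ?T) * (\<Sum>h\<in>?U. F h)" by (simp add: right)
  finally show ?thesis .
qed

section \<open>Root subgroups\<close>

text \<open>The root with positive entry \<open>(i, j)\<close> is labelled by the position of the coordinate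
  \<open>(-i, j)\<close> of the Cayley transform; the row \<open>i\<close> has number \<open>msize G n - 1 - a\<close> there.\<close>

fun root_pair :: "family \<Rightarrow> nat \<Rightarrow> root \<Rightarrow> nat \<times> nat" where
  "root_pair G n (Diff i j) = (msize G n - i, j - 1)"
| "root_pair G n (Plus i j) = (msize G n - i, msize G n - j)"
| "root_pair G n (Twice i) = (msize G n - i, msize G n - i)"
| "root_pair G n (Single i) = (msize G n - i, n)"

lemma root_pair_bounds:
  assumes "\<alpha> \<in> roots G n" "root_pair G n \<alpha> = (a, b)"
  shows "a < msize G n" "b \<le> a" "msize G n \<le> a + b" "n + mid G \<le> a" "a = b \<Longrightarrow> G = Sp"
  using assms by (cases G; auto simp: roots_def msize_def)+

lemma root_pair_inj:
  assumes "\<alpha> \<in> roots G n" "\<beta> \<in> roots G n" "root_pair G n \<alpha> = root_pair G n \<beta>"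
  shows "\<alpha> = \<beta>"
  using assms by (cases G) (auto simp: roots_def msize_def)

text \<open>The block containing \<open>b\<close> decides the type of the root. Roots thus label
  exactly the places on or below the diagonal at which a form has a free coordinate.\<close>

lemma root_pair_surj:
  assumes "a < msize G n" "b \<le> a" "msize G n \<le> a + b" "a = b \<Longrightarrow> G = Sp"
  obtains \<alpha> where "\<alpha> \<in> roots G n" "root_pair G n \<alpha> = (a, b)"
proof -
  let ?m = "msize G n"
  have a: "n + mid G \<le> a" using assms by (cases G) (auto simp: msize_def)
  consider (D) "b < n" | (S) "n \<le> b" "b < n + mid G" | (P) "n + mid G \<le> b" "b < a" | (T) "b = a"
    using assms by linarith
  then show ?thesis
  proof cases
    case D
    then have "1 \<le> ?m - a \<and> ?m - a < b + 1 \<and> b + 1 \<le> n" using assms by auto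
    then have "Diff (?m - a) (b + 1) \<in> roots G n" unfolding roots_def by blast
    then show ?thesis using assms that[of "Diff (?m - a) (b + 1)"] by simp
  next
    case S
    then have G: "G = O_odd" and b: "b = n" by (cases G; simp)+
    then have "1 \<le> ?m - a \<and> ?m - a \<le> n" using assms by (simp add: msize_def) linarith
    then have "Single (?m - a) \<in> roots G n" unfolding roots_def G by simp
    then show ?thesis using assms b that[of "Single (?m - a)"] by simp
  next
    case P
    then have "1 \<le> ?m - a \<and> ?m - a < ?m - b \<and> ?m - b \<le> n"
      using assms by (auto simp: msize_def)
    then have "Plus (?m - a) (?m - b) \<in> roots G n" unfolding roots_def by blast
    then show ?thesis using assms that[of "Plus (?m - a) (?m - b)"] by simp
  next
    case T
    then have G: "G = Sp" using assms(4) by simp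
    then have "1 \<le> ?m - a \<and> ?m - a \<le> n" using assms T by (simp add: msize_def) linarith
    then have "Twice (?m - a) \<in> roots G n" unfolding roots_def G by simp
    then show ?thesis using assms T that[of "Twice (?m - a)"] by simp
  qed
qed

section \<open>Root characters and root subgroups in matrix coordinates\<close>

lemma root_char_eq:
  assumes "\<alpha> \<in> roots G n" "root_pair G n \<alpha> = (a, b)"
  shows "root_char G n \<theta> \<alpha> r x = \<theta> (r * x $$ (msize G n - 1 - a, b))"
proof -
  have "msize G n - Suc (msize G n - i) = i - 1" if "1 \<le> i" "i \<le> n" for i
    using that by (simp add: msize_def)
  moreover have "nat (int i - 1) = i - 1" if "1 \<le> i" for i using that by simp
  moreover have "nat (int (msize G n) - int i) = msize G n - i" for i by simp
  ultimately show ?thesis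
    using assms by (cases G) (auto simp: roots_def root_char_def positive_entry_simps entry_def pos_def)
qed

text \<open>Starting the segment at column 0 and exempting only the diagonal costs nothing for upper
  triangular matrices, and lets one predicate express every row condition in
  \<open>root_subgroup\<close>.\<close>

definition row_trivial :: "nat \<Rightarrow> nat \<Rightarrow> 'a::zero mat \<Rightarrow> bool" where
  "row_trivial i k x \<longleftrightarrow> (\<forall>l<k. l \<noteq> i \<longrightarrow> x $$ (i, l) = 0)"

lemma row_trivial_labels:
  fixes x :: "'a::field mat"
  assumes x: "x \<in> unitri (msize G n)" and i: "1 \<le> i" "i \<le> n" "k \<le> n"
  shows "row_trivial (i - 1) k x \<longleftrightarrow> (\<forall>l. int i < l \<and> l \<le> int k \<longrightarrow> entry G n x (int i) l = 0)"
proof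
  assume *: "row_trivial (i - 1) k x"
  show "\<forall>l. int i < l \<and> l \<le> int k \<longrightarrow> entry G n x (int i) l = 0"
  proof (intro allI impI)
    fix l assume l: "int i < l \<and> l \<le> int k"
    then have "nat (l - 1) < k" "nat (l - 1) \<noteq> i - 1" using i by auto
    then show "entry G n x (int i) l = 0"
      using * l i by (simp add: row_trivial_def entry_def pos_def nat_diff_distrib)
  qed
next
  assume *: "\<forall>l. int i < l \<and> l \<le> int k \<longrightarrow> entry G n x (int i) l = 0"
  show "row_trivial (i - 1) k x"
    unfolding row_trivial_def
  proof (intro allI impI)
    fix l assume l: "l < k" "l \<noteq> i - 1"
    show "x $$ (i - 1, l) = 0"
    proof (cases "l < i - 1")
      case True
      then show ?thesis using unitriD(3)[OF x True] i by (simp add: msize_def)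
    next
      case False
      then have "entry G n x (int i) (int l + 1) = 0" using * l i by auto
      then show ?thesis using i by (simp add: entry_def pos_def nat_diff_distrib)
    qed
  qed
qed

lemma row_trivial_labels_mid:
  fixes x :: "'a::field mat"
  assumes x: "x \<in> unitri (msize G n)" and i: "1 \<le> i" "i \<le> n"
  shows "row_trivial (i - 1) (n + mid G) x \<longleftrightarrow>
    (\<forall>l\<in>labels G n. int i \<prec>\<^sub>l l \<and> l \<preceq>\<^sub>l 0 \<longrightarrow> entry G n x (int i) l = 0)"
proof -
  have lab: "(\<forall>l\<in>labels G n. int i \<prec>\<^sub>l l \<and> l \<preceq>\<^sub>l 0 \<longrightarrow> entry G n x (int i) l = 0) \<longleftrightarrow>
    (\<forall>l. int i < l \<and> l \<le> int n \<longrightarrow> entry G n x (int i) l = 0) \<and>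
    (G = O_odd \<longrightarrow> entry G n x (int i) 0 = 0)"
  proof
    assume *: "\<forall>l\<in>labels G n. int i \<prec>\<^sub>l l \<and> l \<preceq>\<^sub>l 0 \<longrightarrow> entry G n x (int i) l = 0"
    show "(\<forall>l. int i < l \<and> l \<le> int n \<longrightarrow> entry G n x (int i) l = 0) \<and>
      (G = O_odd \<longrightarrow> entry G n x (int i) 0 = 0)"
    proof (intro conjI allI impI)
      fix l assume "int i < l \<and> l \<le> int n"
      then show "entry G n x (int i) l = 0"
        using i by (intro *[rule_format]) (auto simp: labels_def prec_def)
    next
      assume "G = O_odd"
      then show "entry G n x (int i) 0 = 0"
        using i by (intro *[rule_format]) (auto simp: labels_def prec_def)
    qed
  next
    assume *: "(\<forall>l. int i < l \<and> l \<le> int n \<longrightarrow> entry G n x (int i) l = 0) \<and>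
      (G = O_odd \<longrightarrow> entry G n x (int i) 0 = 0)"
    show "\<forall>l\<in>labels G n. int i \<prec>\<^sub>l l \<and> l \<preceq>\<^sub>l 0 \<longrightarrow> entry G n x (int i) l = 0"
    proof (intro ballI impI)
      fix l assume l: "l \<in> labels G n" "int i \<prec>\<^sub>l l \<and> l \<preceq>\<^sub>l 0"
      show "entry G n x (int i) l = 0"
      proof (cases "l = 0")
        case True
        then show ?thesis using * l by (auto simp: labels_def split: if_splits)
      next
        case False
        then have "int i < l" "l \<le> int n" using l i by (auto simp: labels_def prec_def split: if_splits)
        then show ?thesis using * by blast
      qed
    qed
  qed
  have e0: "entry G n x (int i) 0 = x $$ (i - 1, n)"
    using i by (simp add: entry_def pos_def nat_diff_distrib)
  have "row_trivial (i - 1) (n + mid G) x \<longleftrightarrow>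
    row_trivial (i - 1) n x \<and> (G = O_odd \<longrightarrow> x $$ (i - 1, n) = 0)"
    using i by (cases G) (auto simp: row_trivial_def less_Suc_eq)
  then show ?thesis unfolding lab e0 using row_trivial_labels[OF x i, of n] by simp
qed

lemma row_trivial_upper:
  fixes x :: "'a::field mat"
  assumes "x \<in> unitri m" "i < m" "k \<le> Suc i"
  shows "row_trivial i k x"
  using unitriD(3)[OF assms(1) _ assms(2)] assms(3) by (auto simp: row_trivial_def)

text \<open>The second clause is the condition on row \<open>j\<close> for \<open>Plus\<close>,
  coincides with the first for \<open>Twice\<close>, and follows from triangularity for
  \<open>Diff\<close> and \<open>Single\<close>. One description thus serves all four types of
  root.\<close>

lemma root_subgroup_eq:
  assumes \<alpha>: "\<alpha> \<in> roots G n" "root_pair G n \<alpha> = (a, b)"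
  shows "root_subgroup G n \<alpha> = {x \<in> unip G n. row_trivial (msize G n - 1 - a) (min b n) x \<and>
    row_trivial (msize G n - 1 - b) (n + mid G) (x :: 'a::field mat)}"
proof -
  let ?m = "msize G n"
  have u: "x \<in> unitri ?m" if "x \<in> unip G n" for x :: "'a mat" using that by (simp add: unip_def)
  have e: "?m - 1 - (?m - i) = i - 1" if "1 \<le> i" "i \<le> n" for i using that by (simp add: msize_def)
  show ?thesis
  proof (cases \<alpha>)
    case (Diff i j)
    then have ij: "1 \<le> i" "i < j" "j \<le> n" "a = ?m - i" "b = j - 1" using \<alpha> by (auto simp: roots_def split: family.splits)
    have "row_trivial (?m - 1 - b) (n + mid G) x" if "x \<in> unip G n" for x :: "'a mat"
      using ij by (intro row_trivial_upper[OF u[OF that]]) (auto simp: msize_def)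
    moreover have "row_trivial (?m - 1 - a) (min b n) x \<longleftrightarrow>
      (\<forall>k. int i < k \<and> k < int j \<longrightarrow> entry G n x (int i) k = 0)" if "x \<in> unip G n" for x :: "'a mat"
    proof -
      have "k \<le> int (j - 1) \<longleftrightarrow> k < int j" for k using ij by auto
      moreover have "min b n = j - 1" using ij by simp
      ultimately show ?thesis
        using row_trivial_labels[OF u[OF that], of i "j - 1"] ij e[of i] by simp
    qed
    ultimately show ?thesis unfolding Diff by auto
  next
    case (Plus i j)
    then have ij: "1 \<le> i" "i < j" "j \<le> n" "a = ?m - i" "b = ?m - j" using \<alpha> by (auto simp: roots_def split: family.splits)
    have "min b n = n" using ij by (simp add: msize_def)
    then have "row_trivial (?m - 1 - a) (min b n) x \<longleftrightarrow>
      (\<forall>k. int i < k \<and> k \<le> int n \<longrightarrow> entry G n x (int i) k = 0)" if "x \<in> unip G n" for x :: "'a mat"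
      using row_trivial_labels[OF u[OF that], of i n] ij e[of i] by simp
    moreover have "row_trivial (?m - 1 - b) (n + mid G) x \<longleftrightarrow>
      (\<forall>l\<in>labels G n. int j \<prec>\<^sub>l l \<and> l \<preceq>\<^sub>l 0 \<longrightarrow> entry G n x (int j) l = 0)"
      if "x \<in> unip G n" for x :: "'a mat"
      using row_trivial_labels_mid[OF u[OF that], of j] ij e[of j] by simp
    ultimately show ?thesis unfolding Plus root_subgroup.simps by blast
  next
    case (Twice i)
    then have i: "1 \<le> i" "i \<le> n" "a = ?m - i" "b = ?m - i" "G = Sp" using \<alpha> by (auto simp: roots_def split: family.splits)
    have "min b n = n" "n + mid G = n" using i by (simp_all add: msize_def)
    then have "row_trivial (?m - 1 - a) (min b n) x \<longleftrightarrow>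
      (\<forall>k. int i < k \<and> k \<le> int n \<longrightarrow> entry G n x (int i) k = 0)"
      "row_trivial (?m - 1 - b) (n + mid G) x \<longleftrightarrow>
      (\<forall>k. int i < k \<and> k \<le> int n \<longrightarrow> entry G n x (int i) k = 0)" if "x \<in> unip G n" for x :: "'a mat"
      using row_trivial_labels[OF u[OF that], of i n] i e[of i] by simp_all
    then show ?thesis unfolding Twice root_subgroup.simps by blast
  next
    case (Single i)
    then have i: "1 \<le> i" "i \<le> n" "a = ?m - i" "b = n" "G = O_odd" using \<alpha> by (auto simp: roots_def split: family.splits)
    have "row_trivial (?m - 1 - b) (n + mid G) x" if "x \<in> unip G n" for x :: "'a mat"
      using i by (intro row_trivial_upper[OF u[OF that]]) (auto simp: msize_def)
    moreover have "row_trivial (?m - 1 - a) (min b n) x \<longleftrightarrow>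
      (\<forall>k. int i < k \<and> k \<le> int n \<longrightarrow> entry G n x (int i) k = 0)" if "x \<in> unip G n" for x :: "'a mat"
      using row_trivial_labels[OF u[OF that], of i n] i e[of i] by simp
    ultimately show ?thesis unfolding Single root_subgroup.simps by blast
  qed
qed

text \<open>On columns of index less than \<open>k\<close> the row acts like a row of the identity:
  entries of \<open>x\<close> from place \<open>k\<close> on meet only zeros of the triangular
  matrix \<open>y\<close>.\<close>

lemma row_trivial_mult:
  fixes x y :: "'a::field mat"
  assumes x: "x \<in> unitri m" and y: "y \<in> unitri m" and i: "i < m" and k: "k \<le> m"
    and t: "row_trivial i k x" and l: "l < k"
  shows "(x * y) $$ (i, l) = y $$ (i, l)"
proof -
  have "(x * y) $$ (i, l) = (\<Sum>j<m. x $$ (i, j) * y $$ (j, l))"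
    by (rule index_mult[OF unitriD(1)[OF x] unitriD(1)[OF y] i]) (use k l in simp)
  also have "\<dots> = (\<Sum>j<m. if j = i then y $$ (i, l) else 0)"
  proof (rule sum.cong[OF refl])
    fix j assume j: "j \<in> {..<m}"
    show "x $$ (i, j) * y $$ (j, l) = (if j = i then y $$ (i, l) else 0)"
    proof (cases "j < k")
      case True
      then show ?thesis using t unitriD(2)[OF x i] by (auto simp: row_trivial_def)
    next
      case False
      then show ?thesis using unitriD(3)[OF y, of l j] unitriD(2)[OF x i] j l by auto
    qed
  qed
  finally show ?thesis using i by simp
qed

lemma row_trivial_inverse:
  fixes x y :: "'a::field mat"
  assumes "x \<in> unitri m" "y \<in> unitri m" "x * y = 1\<^sub>m m" "i < m" "k \<le> m" "row_trivial i k x"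
  shows "row_trivial i k y"
  unfolding row_trivial_def
proof (intro allI impI)
  fix l assume l: "l < k" "l \<noteq> i"
  have "y $$ (i, l) = (x * y) $$ (i, l)" using row_trivial_mult[OF assms(1,2,4,5,6) l(1)] by simp
  then show "y $$ (i, l) = 0" using assms(3,4,5) l by simp
qed

text \<open>Up to a factor 2, each of \<open>x - 1\<close> and \<open>1 - half_inv\<close> is the
  other multiplied on the right by a unitriangular matrix, and such a factor preserves the vanishing
  of an initial segment of a row.\<close>

lemma row_trivial_cayley:
  fixes x :: "'a::field mat"
  assumes two: "(2::'a) \<noteq> 0" and x: "x \<in> unitri (msize G n)" and i: "i < msize G n" and k: "k \<le> msize G n"
  shows "row_trivial (msize G n - 1 - i) k x \<longleftrightarrow> (\<forall>l<k. cayley G n x $$ (i, l) = 0)"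
proof -
  let ?m = "msize G n" and ?i = "msize G n - 1 - i"
  let ?A = "1\<^sub>m ?m - half_inv ?m x"
  have i': "?i < ?m" using i by simp
  note y = half_inv(1)[OF two x]
  have S: "cayley G n x $$ (i, l) = 0 \<longleftrightarrow> ?A $$ (?i, l) = 0" if "l < ?m" for l
    using cayley_index[OF two x i that] by (simp del: index_minus_mat)
  have xx: "(x - 1\<^sub>m ?m) $$ (?i, l) = (if l = ?i then 0 else x $$ (?i, l))" if "l < ?m" for l
    using that i' unitriD(1)[OF x] unitriD(2)[OF x i'] by auto
  have tri: "(\<Sum>j<?m. p j * h $$ (j, l)) = 0"
    if "\<forall>j<k. p j = 0" "h \<in> unitri ?m" "l < k" for p :: "nat \<Rightarrow> 'a" and h l
  proof (rule sum.neutral, rule ballI)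
    fix j assume "j \<in> {..<?m}"
    then show "p j * h $$ (j, l) = 0" using that unitriD(3)[OF that(2), of l j] by (cases "j < k") auto
  qed
  show ?thesis
  proof
    assume t: "row_trivial ?i k x"
    have "(x - 1\<^sub>m ?m) $$ (?i, l) = 0" if "l < k" for l
      using xx[of l] t that k by (auto simp: row_trivial_def simp del: index_minus_mat)
    then have "?A $$ (?i, l) = 0" if "l < k" for l
      using cayley_entries(3)[OF two x i', of l] tri[OF _ y that] that k
      by (simp del: index_minus_mat)
    then show "\<forall>l<k. cayley G n x $$ (i, l) = 0" using S k by (simp del: index_minus_mat)
  next
    assume "\<forall>l<k. cayley G n x $$ (i, l) = 0"
    then have "\<forall>l<k. ?A $$ (?i, l) = 0" using S k by (simp del: index_minus_mat)
    then have "(x - 1\<^sub>m ?m) $$ (?i, l) = 0" if "l < k" for l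
      using cayley_entries(1)[OF two x i', of l] tri[OF _ half_unitri[OF two x] that] that k
      by (simp del: index_minus_mat)
    then show "row_trivial ?i k x"
      using xx k by (fastforce simp: row_trivial_def simp del: index_minus_mat)
  qed
qed

section \<open>Root subgroups in Cayley coordinates\<close>

context
  fixes G :: family and n :: nat and \<alpha> a b
  assumes \<alpha>: "\<alpha> \<in> roots G n" "root_pair G n \<alpha> = (a, b)"
begin

lemma root_subgroup_cayley:
  fixes x :: "'a::field mat"
  assumes two: "(2::'a) \<noteq> 0"
  shows "x \<in> root_subgroup G n \<alpha> \<longleftrightarrow> x \<in> unip G n \<and>
    (\<forall>k<min b n. cayley G n x $$ (a, k) = 0) \<and> (\<forall>l<n + mid G. cayley G n x $$ (b, l) = 0)"
proof (cases "x \<in> unip G n")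
  case True
  then have u: "x \<in> unitri (msize G n)" by (simp add: unip_def)
  have "a < msize G n" "b < msize G n" "min b n \<le> msize G n" "n + mid G \<le> msize G n"
    using root_pair_bounds[OF \<alpha>] by (auto simp: msize_def)
  then show ?thesis
    unfolding root_subgroup_eq[OF \<alpha>] using True row_trivial_cayley[OF two u] by simp
qed (simp add: root_subgroup_eq[OF \<alpha>])

text \<open>Symmetry of the form turns the condition on row \<open>b\<close> of the Cayley transform
  into one on column \<open>b\<close>. This makes the coordinate at the root additive on the
  subgroup and proportional to the Cayley coordinate.\<close>

lemma root_subgroup_column:
  fixes x :: "'a::field mat"
  assumes two: "(2::'a) \<noteq> 0" and x: "x \<in> root_subgroup G n \<alpha>" and l: "n \<le> l" "l < b"
  shows "x $$ (l, b) = 0" "half (msize G n) x $$ (l, b) = 0"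
proof -
  let ?m = "msize G n"
  let ?A = "1\<^sub>m ?m - half_inv ?m x"
  note bnd = root_pair_bounds[OF \<alpha>]
  have xU: "x \<in> unip G n" using x root_subgroup_eq[OF \<alpha>] by blast
  then have u: "x \<in> unitri ?m" by (simp add: unip_def)
  have bm: "b < ?m" "l < ?m" using bnd l by auto
  have S: "cayley G n x \<in> lie_forms G n" using cayley_bij[OF two] xU bij_betwE by blast
  have A0: "?A $$ (k, b) = 0" if k: "n \<le> k" "k < ?m" for k
  proof (cases "k < b")
    case True
    have "?m - 1 - k < n + mid G" using k by (simp add: msize_def)
    then have "cayley G n x $$ (b, ?m - 1 - k) = 0" using x root_subgroup_cayley[OF two] by blast
    then have "cayley G n x $$ (?m - 1 - k, b) = 0"
      using lie_formsD(2)[OF S, of b "?m - 1 - k"] bm k by simp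
    then show ?thesis using cayley_index[OF two u, of "?m - 1 - k" b] bm k
      by (simp del: index_minus_mat split: if_splits)
  next
    case False
    then show ?thesis
      using unitriD[OF half_inv(1)[OF two u]] k bm by (cases "k = b") auto
  qed
  have "(x - 1\<^sub>m ?m) $$ (l, b) = 2 * (\<Sum>k<?m. half ?m x $$ (l, k) * ?A $$ (k, b))"
    by (rule cayley_entries(2)[OF two u bm(2,1)])
  also have "(\<Sum>k<?m. half ?m x $$ (l, k) * ?A $$ (k, b)) = 0"
  proof (rule sum.neutral, rule ballI)
    fix k assume "k \<in> {..<?m}"
    then show "half ?m x $$ (l, k) * ?A $$ (k, b) = 0"
      using A0[of k] unitriD(3)[OF half_unitri[OF two u], of k l] l bm
      by (cases "n \<le> k") (auto simp del: index_minus_mat)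
  qed
  finally show "x $$ (l, b) = 0" using bm l unitriD(1)[OF u] by auto
  then show "half ?m x $$ (l, b) = 0" using bm l by (simp add: half_def)
qed

text \<open>The origin of the factor \<open>- 2 * form_sign G\<close>: the 2 stems from
  \<open>x - 1 = 2 A h\<close>, the sign from the rows \<open>a \<ge> n\<close> of
  \<open>gram\<close>. In the product \<open>A h\<close> the terms before \<open>b\<close> die in
  one factor or the other, those after \<open>b\<close> by triangularity, and only the diagonal
  entry of \<open>h\<close> at \<open>b\<close> remains.\<close>

lemma root_subgroup_value:
  fixes x :: "'a::field mat"
  assumes two: "(2::'a) \<noteq> 0" and x: "x \<in> root_subgroup G n \<alpha>"
  shows "x $$ (msize G n - 1 - a, b) = - 2 * form_sign G * cayley G n x $$ (a, b)"
proof -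
  let ?m = "msize G n" and ?i = "msize G n - 1 - a"
  let ?A = "1\<^sub>m ?m - half_inv ?m x"
  note bnd = root_pair_bounds[OF \<alpha>]
  have xU: "x \<in> unip G n" using x root_subgroup_eq[OF \<alpha>] by blast
  then have u: "x \<in> unitri ?m" by (simp add: unip_def)
  have bm: "b < ?m" "?i < ?m" "?i < b" using bnd by auto
  note h = half_unitri[OF two u]
  have S: "cayley G n x $$ (a, k) = - form_sign G * ?A $$ (?i, k)" if "k < ?m" for k
    using cayley_index[OF two u bnd(1) that] bnd(4) by (simp add: form_sign_def del: index_minus_mat)
  have "(x - 1\<^sub>m ?m) $$ (?i, b) = 2 * (\<Sum>k<?m. ?A $$ (?i, k) * half ?m x $$ (k, b))"
    by (rule cayley_entries(1)[OF two u bm(2,1)])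
  also have "(\<Sum>k<?m. ?A $$ (?i, k) * half ?m x $$ (k, b)) = (\<Sum>k<?m. if k = b then ?A $$ (?i, b) else 0)"
  proof (rule sum.cong[OF refl])
    fix k assume k: "k \<in> {..<?m}"
    consider "k < min b n" | "n \<le> k" "k < b" | "k = b" | "b < k" by linarith
    then show "?A $$ (?i, k) * half ?m x $$ (k, b) = (if k = b then ?A $$ (?i, b) else 0)"
    proof cases
      case 1
      then have "cayley G n x $$ (a, k) = 0" using x root_subgroup_cayley[OF two] by blast
      then have "?A $$ (?i, k) = 0" using S[of k] k by (auto simp: form_sign_def simp del: index_minus_mat split: if_splits)
      then show ?thesis using 1 by (simp del: index_minus_mat)
    next
      case 2
      then show ?thesis using root_subgroup_column(2)[OF two x 2] by simp
    next
      case 3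
      then show ?thesis using unitriD(2)[OF h bm(1)] by simp
    next
      case 4
      then show ?thesis using unitriD(3)[OF h, of b k] k by simp
    qed
  qed
  also have "2 * \<dots> = 2 * ?A $$ (?i, b)" using bm by simp
  also have "\<dots> = - 2 * form_sign G * cayley G n x $$ (a, b)"
    using S[OF bm(1)] by (simp add: form_sign_def del: index_minus_mat)
  finally show ?thesis using bm unitriD(1)[OF u] by simp
qed

lemma root_subgroup_subgroup:
  "subgroup (root_subgroup G n \<alpha>) (unip_group G n :: 'a::field mat monoid)"
proof -
  let ?m = "msize G n"
  interpret U: group "unip_group G n :: 'a mat monoid" by (rule unip_group)
  have u: "x \<in> unitri ?m" if "x \<in> unip G n" for x :: "'a mat" using that by (simp add: unip_def)
  have bd: "?m - 1 - a < ?m" "?m - 1 - b < ?m" "min b n \<le> ?m" "n + mid G \<le> ?m"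
    using root_pair_bounds[OF \<alpha>] by (auto simp: msize_def)
  show ?thesis
  proof (rule U.subgroupI)
    show "root_subgroup G n \<alpha> \<subseteq> carrier (unip_group G n :: 'a mat monoid)"
      by (auto simp: root_subgroup_eq[OF \<alpha>] unip_group_def)
    have "1\<^sub>m ?m \<in> (root_subgroup G n \<alpha> :: 'a mat set)"
      using U.one_closed bd by (auto simp: root_subgroup_eq[OF \<alpha>] unip_group_def row_trivial_def)
    then show "root_subgroup G n \<alpha> \<noteq> ({} :: 'a mat set)" by blast
  next
    fix x :: "'a mat" assume x: "x \<in> root_subgroup G n \<alpha>"
    then have xU: "x \<in> unip G n" by (simp add: root_subgroup_eq[OF \<alpha>])
    let ?y = "inv\<^bsub>unip_group G n\<^esub> x"
    have y: "?y \<in> unip G n" "x * ?y = 1\<^sub>m ?m"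
      using U.inv_closed[of x] U.r_inv[of x] xU by (auto simp: unip_group_def)
    show "?y \<in> root_subgroup G n \<alpha>"
      using x y row_trivial_inverse[OF u[OF xU] u[OF y(1)] y(2)] bd by (simp add: root_subgroup_eq[OF \<alpha>])
  next
    fix x y :: "'a mat" assume x: "x \<in> root_subgroup G n \<alpha>" and y: "y \<in> root_subgroup G n \<alpha>"
    then have U: "x \<in> unip G n" "y \<in> unip G n" by (auto simp: root_subgroup_eq[OF \<alpha>])
    have "x * y \<in> unip G n" using U.m_closed[of x y] U by (simp add: unip_group_def)
    moreover have "row_trivial i k (x * y)" if "i < ?m" "k \<le> ?m" "row_trivial i k x" "row_trivial i k y" for i k
      using row_trivial_mult[OF u[OF U(1)] u[OF U(2)] that(1,2,3)] that(4) by (simp add: row_trivial_def)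
    ultimately show "x \<otimes>\<^bsub>unip_group G n\<^esub> y \<in> root_subgroup G n \<alpha>"
      using x y bd by (simp add: root_subgroup_eq[OF \<alpha>] unip_group_def)
  qed
qed

text \<open>Between the two indices, row triviality of \<open>x\<close> covers the top columns and
  the vanishing part of column \<open>b\<close> of \<open>y\<close> covers the rest, so only the two
  terms with a diagonal entry survive.\<close>

lemma root_subgroup_add:
  fixes x y :: "'a::field mat"
  assumes two: "(2::'a) \<noteq> 0" and x: "x \<in> root_subgroup G n \<alpha>" and y: "y \<in> root_subgroup G n \<alpha>"
  shows "(x * y) $$ (msize G n - 1 - a, b) = x $$ (msize G n - 1 - a, b) + y $$ (msize G n - 1 - a, b)"
proof -
  let ?m = "msize G n" and ?i = "msize G n - 1 - a"
  note bnd = root_pair_bounds[OF \<alpha>]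
  have u: "x \<in> unitri ?m" "y \<in> unitri ?m" using x y by (auto simp: root_subgroup_eq[OF \<alpha>] unip_def)
  have bm: "b < ?m" "?i < ?m" "?i < b" using bnd by auto
  have "(x * y) $$ (?i, b) = (\<Sum>l<?m. x $$ (?i, l) * y $$ (l, b))"
    by (rule index_mult[OF unitriD(1)[OF u(1)] unitriD(1)[OF u(2)] bm(2,1)])
  also have "\<dots> = (\<Sum>l<?m. (if l = b then x $$ (?i, b) else 0) + (if l = ?i then y $$ (?i, b) else 0))"
  proof (rule sum.cong[OF refl])
    fix l assume l: "l \<in> {..<?m}"
    have t: "row_trivial ?i (min b n) x" using x by (simp add: root_subgroup_eq[OF \<alpha>])
    consider "l = ?i" | "l \<noteq> ?i" "l < min b n" | "l \<noteq> ?i" "n \<le> l" "l < b" | "l = b" | "b < l" by linarith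
    then show "x $$ (?i, l) * y $$ (l, b) =
      (if l = b then x $$ (?i, b) else 0) + (if l = ?i then y $$ (?i, b) else 0)"
    proof cases
      case 1
      then show ?thesis using unitriD(2)[OF u(1) bm(2)] bm by simp
    next
      case 2
      then show ?thesis using t by (simp add: row_trivial_def)
    next
      case 3
      then show ?thesis using root_subgroup_column(1)[OF two y 3(2,3)] by simp
    next
      case 4
      then show ?thesis using unitriD(2)[OF u(2) bm(1)] bm by simp
    next
      case 5
      then show ?thesis using unitriD(3)[OF u(2), of b l] l bm by simp
    qed
  qed
  also have "\<dots> = x $$ (?i, b) + y $$ (?i, b)" using bm by (simp add: sum.distrib)
  finally show ?thesis .
qed

end

section \<open>Elementary characters as averages over unitriangular matrices\<close>

definition row_apply :: "nat \<Rightarrow> 'a::field mat \<Rightarrow> (nat \<Rightarrow> 'a) \<Rightarrow> nat \<Rightarrow> 'a" where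
  "row_apply m S u l = (\<Sum>k<m. u k * S $$ (k, l))"

definition form_apply :: "nat \<Rightarrow> 'a::field mat \<Rightarrow> (nat \<Rightarrow> 'a) \<Rightarrow> (nat \<Rightarrow> 'a) \<Rightarrow> 'a" where
  "form_apply m S u w = (\<Sum>l<m. row_apply m S u l * w l)"

abbreviation column :: "'a mat \<Rightarrow> nat \<Rightarrow> nat \<Rightarrow> 'a" where
  "column g j \<equiv> \<lambda>i. g $$ (i, j)"

lemma congruence_index:
  fixes g S :: "'a::field mat"
  assumes g: "g \<in> carrier_mat m m" and S: "S \<in> carrier_mat m m" and ij: "a < m" "b < m"
  shows "(transpose_mat g * S * g) $$ (a, b) = form_apply m S (column g a) (column g b)"
proof -
  have t: "transpose_mat g \<in> carrier_mat m m" using g by simp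
  have "(transpose_mat g * S * g) $$ (a, b) = (\<Sum>l<m. (transpose_mat g * S) $$ (a, l) * g $$ (l, b))"
    by (rule index_mult[OF mult_carrier_mat[OF t S] g ij])
  also have "\<dots> = form_apply m S (column g a) (column g b)"
    unfolding form_apply_def row_apply_def
    by (intro sum.cong refl, subst index_mult[OF t S ij(1)]) (use g ij in auto)
  finally show ?thesis .
qed

lemma form_apply_swap:
  fixes S :: "'a::field mat"
  assumes S: "S \<in> lie_forms G n"
  shows "form_apply (msize G n) S u w = (\<Sum>k<msize G n. u k * (form_sign G * row_apply (msize G n) S w k))"
proof -
  have "form_apply (msize G n) S u w = (\<Sum>l<msize G n. \<Sum>k<msize G n. u k * S $$ (k, l) * w l)"
    by (simp add: form_apply_def row_apply_def sum_distrib_right)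
  also have "\<dots> = (\<Sum>k<msize G n. \<Sum>l<msize G n. u k * S $$ (k, l) * w l)" by (rule sum.swap)
  also have "\<dots> = (\<Sum>k<msize G n. \<Sum>l<msize G n. u k * (form_sign G * (w l * S $$ (l, k))))"
  proof (intro sum.cong refl)
    fix k l assume "k \<in> {..<msize G n}" "l \<in> {..<msize G n}"
    then have "S $$ (k, l) = form_sign G * S $$ (l, k)" by (intro lie_formsD(2)[OF S]) auto
    then show "u k * S $$ (k, l) * w l = u k * (form_sign G * (w l * S $$ (l, k)))"
      by (simp only: mult_ac)
  qed
  finally show ?thesis by (simp add: row_apply_def sum_distrib_left)
qed

lemma row_apply_add: "row_apply m S (\<lambda>k. u k + p k) l = row_apply m S u l + row_apply m S p l"
  by (simp add: row_apply_def distrib_right sum.distrib)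

lemma form_apply_add:
  "form_apply m S (\<lambda>k. u k + p k) w = form_apply m S u w + form_apply m S p w"
  "form_apply m S u (\<lambda>k. w k + q k) = form_apply m S u w + form_apply m S u q"
  by (simp_all add: form_apply_def row_apply_add distrib_right distrib_left sum.distrib)

lemma row_apply_cong:
  "(\<And>k. k < m \<Longrightarrow> u k = u' k) \<Longrightarrow> row_apply m S u l = row_apply m S u' l"
  unfolding row_apply_def by (intro sum.cong) auto

lemma form_apply_cong:
  "(\<And>k. k < m \<Longrightarrow> u k = u' k) \<Longrightarrow> (\<And>k. k < m \<Longrightarrow> w k = w' k) \<Longrightarrow>
    form_apply m S u w = form_apply m S u' w'"
  unfolding form_apply_def using row_apply_cong[of m u u' S] by (intro sum.cong) auto

text \<open>The entries above the diagonal are free coordinates on \<open>T\<close>. The change is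
  additive in one of them rather than multiplication by an elementary matrix, so nothing else
  moves.\<close>

definition shift_entry :: "nat \<Rightarrow> nat \<Rightarrow> nat \<Rightarrow> 'a::field \<Rightarrow> 'a mat \<Rightarrow> 'a mat" where
  "shift_entry m l j t g = mat m m (\<lambda>(i, k). g $$ (i, k) + (if i = l \<and> k = j then t else 0))"

lemma shift_entry_index:
  "i < m \<Longrightarrow> k < m \<Longrightarrow>
    shift_entry m l j t g $$ (i, k) = g $$ (i, k) + (if i = l \<and> k = j then t else 0)"
  by (simp add: shift_entry_def)

lemma shift_entry_unitri:
  assumes "g \<in> unitri m" "l < j"
  shows "shift_entry m l j t g \<in> unitri m"
  using unitriD(2,3)[OF assms(1)] assms(2)
  by (intro unitriI) (auto simp: shift_entry_index, auto simp: shift_entry_def)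

lemma shift_entry_inverse:
  assumes "g \<in> unitri m"
  shows "shift_entry m l j (- t) (shift_entry m l j t g) = g"
  using unitriD(1)[OF assms] by (intro eq_matI) (auto simp: shift_entry_def)

lemma row_apply_unit:
  assumes "l < m"
  shows "row_apply m S (\<lambda>k. if k = l then t else 0) i = t * S $$ (l, i)"
proof -
  have "row_apply m S (\<lambda>k. if k = l then t else 0) i = (\<Sum>k<m. if k = l then t * S $$ (l, i) else 0)"
    unfolding row_apply_def by (intro sum.cong) auto
  then show ?thesis using assms by simp
qed

lemma form_apply_unit_right:
  assumes "l < m"
  shows "form_apply m S u (\<lambda>k. if k = l then t else 0) = t * row_apply m S u l"
proof -
  have "form_apply m S u (\<lambda>k. if k = l then t else 0) = (\<Sum>k<m. if k = l then t * row_apply m S u l else 0)"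
    unfolding form_apply_def by (intro sum.cong) auto
  then show ?thesis using assms by simp
qed

lemma form_apply_unit_left:
  assumes "S \<in> lie_forms G n" "l < msize G n"
  shows "form_apply (msize G n) S (\<lambda>k. if k = l then t else 0) w =
    t * (form_sign G * row_apply (msize G n) S w l)"
proof -
  let ?m = "msize G n"
  have "form_apply ?m S (\<lambda>k. if k = l then t else 0) w =
    (\<Sum>k<?m. if k = l then t * (form_sign G * row_apply ?m S w l) else 0)"
    unfolding form_apply_swap[OF assms(1)] by (intro sum.cong) auto
  then show ?thesis using assms by simp
qed

lemma row_apply_shift:
  assumes "l < m" "a < m"
  shows "row_apply m S (column (shift_entry m l j t g) a) i =
    row_apply m S (column g a) i + (if a = j then t * S $$ (l, i) else 0)"
proof -
  have "row_apply m S (column (shift_entry m l j t g) a) i =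
    row_apply m S (\<lambda>k. g $$ (k, a) + (if k = l then if a = j then t else 0 else 0)) i"
    by (rule row_apply_cong) (use assms in \<open>auto simp: shift_entry_index\<close>)
  then show ?thesis unfolding row_apply_add row_apply_unit[OF assms(1)] by simp
qed

lemma form_apply_shift:
  assumes S: "S \<in> lie_forms G n" and l: "l < msize G n" and ab: "a < msize G n" "b < msize G n"
  shows "form_apply (msize G n) S (column (shift_entry (msize G n) l j t g) a) (column (shift_entry (msize G n) l j t g) b) =
    form_apply (msize G n) S (column g a) (column g b) +
    (if b = j then t * row_apply (msize G n) S (column g a) l else 0) +
    (if a = j then t * (form_sign G * row_apply (msize G n) S (column g b) l) else 0) +
    (if a = j \<and> b = j then t * t * S $$ (l, l) else 0)"
proof -
  let ?m = "msize G n"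
  define ta where "ta = (if a = j then t else 0)"
  define tb where "tb = (if b = j then t else 0)"
  have "form_apply ?m S (column (shift_entry ?m l j t g) a) (column (shift_entry ?m l j t g) b) =
    form_apply ?m S (\<lambda>k. g $$ (k, a) + (if k = l then ta else 0)) (\<lambda>k. g $$ (k, b) + (if k = l then tb else 0))"
    by (rule form_apply_cong) (use ab in \<open>auto simp: shift_entry_index ta_def tb_def\<close>)
  also have "\<dots> = form_apply ?m S (column g a) (column g b) + tb * row_apply ?m S (column g a) l +
      ta * (form_sign G * row_apply ?m S (column g b) l) + tb * (ta * S $$ (l, l))"
    by (simp add: form_apply_add form_apply_unit_right[OF l] form_apply_unit_left[OF S l] row_apply_unit[OF l])
  finally show ?thesis by (auto simp: ta_def tb_def)
qed

text \<open>The first \<open>k\<close> entries of the product are the first \<open>k\<close> entries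
  of \<open>v\<close> multiplied by the leading block of \<open>h\<close>, which is
  invertible.\<close>

lemma triangular_zero_iff:
  fixes h :: "'a::field mat"
  assumes h: "h \<in> unitri m" and k: "k \<le> m"
  shows "(\<forall>l<k. (\<Sum>i<m. v i * h $$ (i, l)) = 0) \<longleftrightarrow> (\<forall>l<k. v l = 0)"
proof
  assume v: "\<forall>l<k. v l = 0"
  show "\<forall>l<k. (\<Sum>i<m. v i * h $$ (i, l)) = 0"
  proof (intro allI impI sum.neutral ballI)
    fix l i assume "l < k" "i \<in> {..<m}"
    then show "v i * h $$ (i, l) = 0" using v unitriD(3)[OF h, of l i] by (cases "i < k") auto
  qed
next
  assume s: "\<forall>l<k. (\<Sum>i<m. v i * h $$ (i, l)) = 0"
  have "v l = 0" if "l < k" for l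
    using that
  proof (induction l rule: less_induct)
    case (less l)
    have "(\<Sum>i<m. v i * h $$ (i, l)) = (\<Sum>i<m. if i = l then v l else 0)"
    proof (rule sum.cong[OF refl])
      fix i assume i: "i \<in> {..<m}"
      consider "i < l" | "i = l" | "l < i" by linarith
      then show "v i * h $$ (i, l) = (if i = l then v l else 0)"
      proof cases
        case 1
        then show ?thesis using less by simp
      next
        case 2
        then show ?thesis using unitriD(2)[OF h] i by simp
      next
        case 3
        then show ?thesis using unitriD(3)[OF h 3] i by simp
      qed
    qed
    then show ?case using s less.prems k by simp
  qed
  then show "\<forall>l<k. v l = 0" by blast
qed

text \<open>The condition of \<open>root_subgroup_cayley\<close> for the congruent form
  \<open>g^T S g\<close>, with the right factor \<open>g\<close> removed by
  \<open>triangular_zero_iff\<close>. In this shape each equation is linear in a single column of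
  \<open>g\<close>.\<close>

definition root_vanish :: "family \<Rightarrow> nat \<Rightarrow> nat \<Rightarrow> nat \<Rightarrow> 'a::field mat \<Rightarrow> 'a mat \<Rightarrow> bool" where
  "root_vanish G n a b S g \<longleftrightarrow> (\<forall>k<min b n. row_apply (msize G n) S (column g a) k = 0) \<and>
     (\<forall>l<n + mid G. row_apply (msize G n) S (column g b) l = 0)"

section \<open>From induction over the unipotent group to averages over all unitriangular
  matrices\<close>

context
  fixes G :: family and n :: nat and \<theta> :: "'a::{field,finite} \<Rightarrow> complex" and \<alpha> a b
  assumes \<alpha>: "\<alpha> \<in> roots G n" "root_pair G n \<alpha> = (a, b)" and two: "(2::'a) \<noteq> 0"
    and nt: "nontrivial_additive_character \<theta>"
begin

text \<open>Shifting one entry of column \<open>a\<close> or \<open>b\<close> changes the exponent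
  by \<open>t\<close> times a nonzero multiple of one of the quantities in
  \<open>root_vanish\<close>. These quantities are themselves untouched by the shifts, because
  \<open>S\<close> is zero at the places where row and column of the shift could interact. Hence
  everything outside \<open>root_vanish\<close> cancels.\<close>

lemma sum_unitri_vanish:
  assumes S: "S \<in> lie_forms G n" and c: "c \<noteq> 0"
  shows "(\<Sum>g\<in>unitri (msize G n). \<theta> (c * form_apply (msize G n) S (column g a) (column g b))) =
    (\<Sum>g | g \<in> unitri (msize G n) \<and> root_vanish G n a b S g.
       \<theta> (c * form_apply (msize G n) S (column g a) (column g b)))"
proof -
  let ?m = "msize G n"
  note bnd = root_pair_bounds[OF \<alpha>]
  have am: "a < ?m" and bm: "b < ?m" using bnd by auto
  have S0: "S $$ (l, k) = 0" "S $$ (k, l) = 0" if "l < n + mid G" "k < n" for l k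
    using that by (auto simp: msize_def intro!: lie_formsD(3)[OF S])
  have fs: "form_sign G \<noteq> (0::'a)" by (simp add: form_sign_def)
  have add: "\<theta> (c * (p + q)) = \<theta> (c * p) * \<theta> (c * q)" for p q
    by (simp add: distrib_left additive_character_add[OF nt])
  show ?thesis
  proof (cases "a = b")
    case True
    then have G: "G = Sp" using bnd(5) by simp
    have nb: "min b n = n" "n \<le> b" "mid G = 0" "form_sign G = (1::'a)" using bnd(4) True G by (auto simp: form_sign_def)
    \<comment> \<open>For a root \<open>Twice i\<close> both columns coincide and the exponent is
      quadratic. This gives the factor 2 in the frequency; the term in the square of
      \<open>t\<close> vanishes with \<open>S $$ (l, l)\<close>.\<close>
    let ?v = "\<lambda>k g. 2 * c * row_apply ?m S (column g a) k"
    have "(\<Sum>g\<in>unitri ?m. \<theta> (c * form_apply ?m S (column g a) (column g b))) =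
      (\<Sum>g | g \<in> unitri ?m \<and> (\<forall>k\<in>{..<n}. ?v k g = 0). \<theta> (c * form_apply ?m S (column g a) (column g b)))"
    proof (rule sum_restrict_kernel[OF nt, where \<tau> = "\<lambda>l t. shift_entry ?m l a t"])
      fix l t and g :: "'a mat" assume l: "l \<in> {..<n}" and g: "g \<in> unitri ?m"
      then have lm: "l < ?m" "l < a" using nb True by (auto simp: msize_def)
      show "shift_entry ?m l a t g \<in> unitri ?m" by (rule shift_entry_unitri[OF g lm(2)])
      show "shift_entry ?m l a (- t) (shift_entry ?m l a t g) = g" by (rule shift_entry_inverse[OF g])
      show "?v k (shift_entry ?m l a t g) = ?v k g" if "k \<in> {..<n}" for k
        using S0[of l k] l that by (simp add: row_apply_shift[OF lm(1) am])
      show "\<theta> (c * form_apply ?m S (column (shift_entry ?m l a t g) a) (column (shift_entry ?m l a t g) b)) =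
        \<theta> (c * form_apply ?m S (column g a) (column g b)) * \<theta> (t * ?v l g)"
      proof -
        have "c * form_apply ?m S (column (shift_entry ?m l a t g) a) (column (shift_entry ?m l a t g) b) =
          c * form_apply ?m S (column g a) (column g b) + t * ?v l g"
          unfolding form_apply_shift[OF S lm(1) am bm] using S0[of l l] l True nb
          by (simp add: algebra_simps)
        then show ?thesis by (simp only: additive_character_add[OF nt])
      qed
    qed (auto simp: finite_unitri)
    also have "{g. g \<in> unitri ?m \<and> (\<forall>k\<in>{..<n}. ?v k g = 0)} = {g. g \<in> unitri ?m \<and> root_vanish G n a b S g}"
      using True nb two c by (auto simp: root_vanish_def)
    finally show ?thesis .
  next
    case False
    define v where "v i g = (case i of Inl l \<Rightarrow> c * (form_sign G * row_apply ?m S (column g b) l)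
      | Inr k \<Rightarrow> c * row_apply ?m S (column g a) k)" for i g
    define \<tau> where "\<tau> i t = (case i of Inl l \<Rightarrow> shift_entry ?m l a t | Inr k \<Rightarrow> shift_entry ?m k b t)"
      for i and t :: 'a
    \<comment> \<open>\<open>Inl l\<close> stands for a shift in column \<open>a\<close>,
      \<open>Inr k\<close> for one in column \<open>b\<close>. The ranges keep the shifted entries
      above the diagonal and the interaction inside the zero block of \<open>S\<close>.\<close>
    let ?I = "{..<n + mid G} <+> {..<min b n}"
    have "(\<Sum>g\<in>unitri ?m. \<theta> (c * form_apply ?m S (column g a) (column g b))) =
      (\<Sum>g | g \<in> unitri ?m \<and> (\<forall>i\<in>?I. v i g = 0). \<theta> (c * form_apply ?m S (column g a) (column g b)))"
    proof (rule sum_restrict_kernel[OF nt, where \<tau> = \<tau>])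
      fix i t and g :: "'a mat" assume i: "i \<in> ?I" and g: "g \<in> unitri ?m"
      show "\<tau> i t g \<in> unitri ?m"
        using i bnd(4) by (cases i) (auto simp: \<tau>_def intro!: shift_entry_unitri[OF g])
      show "\<tau> i (- t) (\<tau> i t g) = g"
        by (cases i) (auto simp: \<tau>_def shift_entry_inverse[OF g])
      show "v j (\<tau> i t g) = v j g" if j: "j \<in> ?I" for j
      proof (cases i)
        case (Inl l)
        then have "l < ?m" "l < n + mid G" using i by (auto simp: msize_def)
        then show ?thesis using Inl False j S0[of l]
          by (cases j) (auto simp: v_def \<tau>_def row_apply_shift am bm)
      next
        case (Inr k)
        then have "k < ?m" "k < n" using i bm by auto
        then show ?thesis using Inr False j S0(2)[of _ k]
          by (cases j) (auto simp: v_def \<tau>_def row_apply_shift am bm)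
      qed
      show "\<theta> (c * form_apply ?m S (column (\<tau> i t g) a) (column (\<tau> i t g) b)) =
        \<theta> (c * form_apply ?m S (column g a) (column g b)) * \<theta> (t * v i g)"
      proof -
        have "c * form_apply ?m S (column (\<tau> i t g) a) (column (\<tau> i t g) b) =
          c * form_apply ?m S (column g a) (column g b) + t * v i g"
        proof (cases i)
          case (Inl l)
          then have "l < ?m" using i by (auto simp: msize_def)
          then show ?thesis using Inl False
            by (simp add: v_def \<tau>_def form_apply_shift[OF S _ am bm] algebra_simps)
        next
          case (Inr k)
          then have "k < ?m" using i bm by auto
          then show ?thesis using Inr False
            by (simp add: v_def \<tau>_def form_apply_shift[OF S _ am bm] algebra_simps)
        qed
        then show ?thesis by (simp only: additive_character_add[OF nt])
      qed
    qed (auto simp: finite_unitri)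
    also have "{g. g \<in> unitri ?m \<and> (\<forall>i\<in>?I. v i g = 0)} = {g. g \<in> unitri ?m \<and> root_vanish G n a b S g}"
    proof -
      have "(\<forall>i\<in>?I. v i g = 0) \<longleftrightarrow> root_vanish G n a b S g" for g
      proof -
        have "(\<forall>i\<in>?I. v i g = 0) \<longleftrightarrow> (\<forall>l<n + mid G. v (Inl l) g = 0) \<and> (\<forall>k<min b n. v (Inr k) g = 0)"
          by (auto simp: Plus_def)
        then show ?thesis using c fs by (auto simp: root_vanish_def v_def)
      qed
      then show ?thesis by simp
    qed
    finally show ?thesis .
  qed
qed

text \<open>A change of the top rows alters columns \<open>a\<close> and \<open>b\<close> by vectors
  supported in the first \<open>n\<close> places, on which \<open>S\<close> pairs trivially. The
  cross terms with the old columns are exactly those that \<open>root_vanish\<close> makes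
  zero.\<close>

lemma root_vanish_lower_rows:
  assumes S: "S \<in> lie_forms G n" and g: "g \<in> unitri (msize G n)" and h: "h \<in> unitri (msize G n)"
    and eq: "\<And>i j. n \<le> i \<Longrightarrow> i < msize G n \<Longrightarrow> j < msize G n \<Longrightarrow> h $$ (i, j) = g $$ (i, j)"
  shows "root_vanish G n a b S h \<longleftrightarrow> root_vanish G n a b S g"
    and "root_vanish G n a b S g \<Longrightarrow> form_apply (msize G n) S (column h a) (column h b) =
      form_apply (msize G n) S (column g a) (column g b)"
proof -
  let ?m = "msize G n"
  note bnd = root_pair_bounds[OF \<alpha>]
  have am: "a < ?m" and bm: "b < ?m" using bnd by auto
  have row: "row_apply ?m S (column h j) l = row_apply ?m S (column g j) l"
    if "l < n + mid G" "j < ?m" for l j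
    unfolding row_apply_def
  proof (rule sum.cong[OF refl])
    fix k assume k: "k \<in> {..<?m}"
    show "h $$ (k, j) * S $$ (k, l) = g $$ (k, j) * S $$ (k, l)"
    proof (cases "n \<le> k")
      case True
      then show ?thesis using eq[of k j] k that by simp
    next
      case False
      then have "S $$ (k, l) = 0" using that by (intro lie_formsD(3)[OF S]) (auto simp: msize_def)
      then show ?thesis by simp
    qed
  qed
  show "root_vanish G n a b S h \<longleftrightarrow> root_vanish G n a b S g"
    using row am bm by (auto simp: root_vanish_def)
  assume van: "root_vanish G n a b S g"
  define p where "p i = h $$ (i, a) - g $$ (i, a)" for i
  define q where "q i = h $$ (i, b) - g $$ (i, b)" for i
  have p0: "p i = 0" if "n \<le> i" "i < ?m" for i using eq[OF that am] by (simp add: p_def)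
  \<comment> \<open>Unitriangular columns are also prescribed from the diagonal on, so
    \<open>q\<close> fits the range \<open>min b n\<close> that \<open>root_vanish\<close> grants
    for column \<open>a\<close>.\<close>
  have q0: "q i = 0" if "min b n \<le> i" "i < ?m" for i
  proof (cases "n \<le> i")
    case True
    then show ?thesis using eq[OF True that(2) bm] by (simp add: q_def)
  next
    case False
    then have "b \<le> i" using that by simp
    then show ?thesis
      using unitriD(2)[OF g that(2)] unitriD(2)[OF h that(2)]
        unitriD(3)[OF g _ that(2), of b] unitriD(3)[OF h _ that(2), of b]
      by (cases "b = i") (auto simp: q_def)
  qed
  have r0: "row_apply ?m S p l = 0" if "l < n" for l
    unfolding row_apply_def
  proof (rule sum.neutral, rule ballI)
    fix k assume k: "k \<in> {..<?m}"
    show "p k * S $$ (k, l) = 0"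
    proof (cases "n \<le> k")
      case False
      then have "S $$ (k, l) = 0" using that by (intro lie_formsD(3)[OF S]) (auto simp: msize_def)
      then show ?thesis by simp
    qed (use p0 k in auto)
  qed
  have "form_apply ?m S (column h a) (column h b) =
    form_apply ?m S (\<lambda>i. g $$ (i, a) + p i) (\<lambda>i. g $$ (i, b) + q i)"
    by (simp add: p_def q_def)
  also have "\<dots> = form_apply ?m S (column g a) (column g b) + form_apply ?m S p (column g b) +
      (form_apply ?m S (column g a) q + form_apply ?m S p q)"
    by (simp add: form_apply_add)
  also have "form_apply ?m S p (column g b) = 0"
    unfolding form_apply_swap[OF S]
  proof (rule sum.neutral, rule ballI)
    fix k assume k: "k \<in> {..<?m}"
    show "p k * (form_sign G * row_apply ?m S (column g b) k) = 0"
      using p0[of k] van k by (cases "n \<le> k") (auto simp: root_vanish_def)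
  qed
  also have "form_apply ?m S (column g a) q = 0"
    unfolding form_apply_def
  proof (rule sum.neutral, rule ballI)
    fix k assume k: "k \<in> {..<?m}"
    show "row_apply ?m S (column g a) k * q k = 0"
    proof (cases "min b n \<le> k")
      case False
      then have "k < min b n" unfolding not_le .
      then show ?thesis using van unfolding root_vanish_def by simp
    qed (use q0 k in auto)
  qed
  also have "form_apply ?m S p q = 0"
    unfolding form_apply_def
  proof (rule sum.neutral, rule ballI)
    fix k assume k: "k \<in> {..<?m}"
    show "row_apply ?m S p k * q k = 0"
      using q0[of k] r0[of k] k by (cases "min b n \<le> k") auto
  qed
  finally show "form_apply ?m S (column h a) (column h b) = form_apply ?m S (column g a) (column g b)"
    by simp
qed

text \<open>In Cayley coordinates the conjugates in the inducing sum are congruences by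
  \<open>p\<close>, the inverse of \<open>g\<close>. Membership in the root subgroup becomes
  \<open>root_vanish\<close> at \<open>p\<close>, and the value of the linear character is the
  coordinate at the root.\<close>

lemma elementary_char_average:
  assumes x: "x \<in> unip G n" and r: "r \<noteq> 0"
  shows "elementary_char G n \<theta> \<alpha> r x =
    of_nat (card (unip G n :: 'a mat set)) /
      (of_nat (card (root_subgroup G n \<alpha> :: 'a mat set)) * of_nat (card (unitri (msize G n) :: 'a mat set))) *
    (\<Sum>g\<in>unitri (msize G n).
       \<theta> (- 2 * form_sign G * r * form_apply (msize G n) (cayley G n x) (column g a) (column g b)))"
proof -
  let ?m = "msize G n"
  let ?U = "unip G n :: 'a mat set" and ?T = "unitri ?m :: 'a mat set"
  let ?H = "root_subgroup G n \<alpha> :: 'a mat set"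
  interpret U: group "unip_group G n :: 'a mat monoid" by (rule unip_group)
  have Ucar: "carrier (unip_group G n :: 'a mat monoid) = ?U" by (simp add: unip_group_def)
  have um: "g \<otimes>\<^bsub>unip_group G n\<^esub> h = g * h" for g h :: "'a mat" by (simp add: unip_group_def)
  define S where "S = cayley G n x"
  have S: "S \<in> lie_forms G n" unfolding S_def using cayley_bij[OF two] x bij_betwE by blast
  define c where "c = - 2 * form_sign G * r"
  have c: "c \<noteq> 0" using two r by (simp add: c_def form_sign_def)
  define Q where "Q g = \<theta> (c * form_apply ?m S (column g a) (column g b))" for g
  \<comment> \<open>Membership is moved into the summand, so that one function can be summed over
    both groups.\<close>
  define F where "F g = (if root_vanish G n a b S g then Q g else 0)" for g
  note bnd = root_pair_bounds[OF \<alpha>]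
  have am: "a < ?m" and bm: "b < ?m" and k: "min b n \<le> ?m" "n + mid G \<le> ?m"
    using bnd by (auto simp: msize_def)
  have F: "(if g * x * inv\<^bsub>unip_group G n\<^esub> g \<in> ?H
      then root_char G n \<theta> \<alpha> r (g * x * inv\<^bsub>unip_group G n\<^esub> g) else 0) = F (inv\<^bsub>unip_group G n\<^esub> g)"
    if g: "g \<in> ?U" for g
  proof -
    define p where "p = inv\<^bsub>unip_group G n\<^esub> g"
    have p: "p \<in> ?U" "g * p = 1\<^sub>m ?m" "p * g = 1\<^sub>m ?m"
      using U.inv_closed[of g] U.r_inv[of g] U.l_inv[of g] g unfolding p_def by (auto simp: unip_group_def)
    have pT: "p \<in> unitri ?m" using p(1) by (simp add: unip_def)
    have cay: "cayley G n (g * x * p) = transpose_mat p * S * p"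
      unfolding S_def by (rule cayley_conj[OF two x g p])
    have ent: "cayley G n (g * x * p) $$ (i, j) = form_apply ?m S (column p i) (column p j)"
      if "i < ?m" "j < ?m" for i j
      unfolding cay by (rule congruence_index[OF unitriD(1)[OF pT] lie_formsD(1)[OF S] that])
    have mem: "g * x * p \<in> ?U" using U.m_closed[of "g * x" p] U.m_closed[of g x] g x p by (simp add: Ucar um)
    have "(\<forall>k<min b n. cayley G n (g * x * p) $$ (a, k) = 0) \<longleftrightarrow>
      (\<forall>k<min b n. (\<Sum>l<?m. row_apply ?m S (column p a) l * p $$ (l, k)) = 0)"
      using ent[OF am] k by (simp add: form_apply_def)
    also have "\<dots> \<longleftrightarrow> (\<forall>k<min b n. row_apply ?m S (column p a) k = 0)"
      by (rule triangular_zero_iff[OF pT k(1)])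
    finally have 1: "(\<forall>k<min b n. cayley G n (g * x * p) $$ (a, k) = 0) \<longleftrightarrow> \<dots>" .
    have "(\<forall>k<n + mid G. cayley G n (g * x * p) $$ (b, k) = 0) \<longleftrightarrow>
      (\<forall>k<n + mid G. (\<Sum>l<?m. row_apply ?m S (column p b) l * p $$ (l, k)) = 0)"
      using ent[OF bm] k by (simp add: form_apply_def)
    also have "\<dots> \<longleftrightarrow> (\<forall>k<n + mid G. row_apply ?m S (column p b) k = 0)"
      by (rule triangular_zero_iff[OF pT k(2)])
    finally have 2: "(\<forall>k<n + mid G. cayley G n (g * x * p) $$ (b, k) = 0) \<longleftrightarrow> \<dots>" .
    have iff: "g * x * p \<in> ?H \<longleftrightarrow> root_vanish G n a b S p"
      unfolding root_subgroup_cayley[OF \<alpha> two] 1 2 root_vanish_def using mem by blast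
    have "root_char G n \<theta> \<alpha> r (g * x * p) = Q p" if "g * x * p \<in> ?H"
      unfolding root_char_eq[OF \<alpha>] root_subgroup_value[OF \<alpha> two that] ent[OF am bm] Q_def c_def
      by (simp add: mult_ac)
    then show ?thesis unfolding p_def[symmetric] F_def using iff by simp
  qed
  have "elementary_char G n \<theta> \<alpha> r x =
    (\<Sum>g | g \<in> ?U \<and> g * x * inv\<^bsub>unip_group G n\<^esub> g \<in> ?H.
       root_char G n \<theta> \<alpha> r (g * x * inv\<^bsub>unip_group G n\<^esub> g)) / of_nat (card ?H)"
    unfolding elementary_char_def induced_fun_def Ucar um ..
  also have "\<dots> = (\<Sum>g\<in>?U. F (inv\<^bsub>unip_group G n\<^esub> g)) / of_nat (card ?H)"
    unfolding sum.inter_filter[OF finite_unip] by (simp add: F cong: sum.cong)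
  also have "(\<Sum>g\<in>?U. F (inv\<^bsub>unip_group G n\<^esub> g)) = (\<Sum>g\<in>?U. F g)"
    using U.sum_inverse[of F] unfolding Ucar .
  also have "(\<Sum>g\<in>?U. F g) = of_nat (card ?U) * (\<Sum>g\<in>?T. F g) / of_nat (card ?T)"
  proof -
    have "of_nat (card ?U) * (\<Sum>g\<in>?T. F g) = of_nat (card ?T) * (\<Sum>g\<in>?U. F g)"
    proof (rule sum_unip_lower_rows[OF two])
      fix g h :: "'a mat" assume gh: "g \<in> ?T" "h \<in> ?T"
        and eq: "\<And>i j. n \<le> i \<Longrightarrow> i < ?m \<Longrightarrow> j < ?m \<Longrightarrow> h $$ (i, j) = g $$ (i, j)"
      show "F g = F h"
        using root_vanish_lower_rows[OF S gh eq] by (simp add: F_def Q_def)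
    qed
    moreover have "card ?T \<noteq> 0" using finite_unitri unitri_one[of ?m] by (auto simp: card_eq_0_iff)
    ultimately show ?thesis by (simp add: field_simps)
  qed
  also have "(\<Sum>g\<in>?T. F g) = (\<Sum>g | g \<in> ?T \<and> root_vanish G n a b S g. Q g)"
    unfolding F_def sum.inter_filter[OF finite_unitri] ..
  also have "\<dots> = (\<Sum>g\<in>?T. Q g)" unfolding Q_def by (rule sum_unitri_vanish[OF S c, symmetric])
  finally show ?thesis unfolding Q_def S_def c_def by simp
qed

lemma positive_type_elementary:
  "positive_type (unip_group G n) (elementary_char G n \<theta> \<alpha> r)"
proof -
  interpret U: group "unip_group G n :: 'a mat monoid" by (rule unip_group)
  show ?thesis
    unfolding elementary_char_def
  proof (rule U.positive_type_induced)
    show "finite (carrier (unip_group G n :: 'a mat monoid))" using finite_unip by (simp add: unip_group_def)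
    show "subgroup (root_subgroup G n \<alpha>) (unip_group G n :: 'a mat monoid)"
      by (rule root_subgroup_subgroup[OF \<alpha>])
  next
    fix x y :: "'a mat" assume x: "x \<in> root_subgroup G n \<alpha>" and y: "y \<in> root_subgroup G n \<alpha>"
    show "root_char G n \<theta> \<alpha> r (x \<otimes>\<^bsub>unip_group G n\<^esub> y) = root_char G n \<theta> \<alpha> r x * root_char G n \<theta> \<alpha> r y"
      using root_subgroup_add[OF \<alpha> two x y]
      by (simp add: root_char_eq[OF \<alpha>] unip_group_def distrib_left additive_character_add[OF nt])
  next
    fix x :: "'a mat"
    show "root_char G n \<theta> \<alpha> r x * cnj (root_char G n \<theta> \<alpha> r x) = 1"
      unfolding root_char_eq[OF \<alpha>] by (rule additive_character_unit[OF nt])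
  qed
qed

end

section \<open>Independence of columns\<close>

definition mix_columns :: "nat \<Rightarrow> nat set \<Rightarrow> 'a mat \<Rightarrow> 'a mat \<Rightarrow> 'a mat" where
  "mix_columns m X g h = mat m m (\<lambda>(i, j). if j \<in> X then g $$ (i, j) else h $$ (i, j))"

definition depends_on_columns :: "nat \<Rightarrow> nat set \<Rightarrow> ('a::field mat \<Rightarrow> complex) \<Rightarrow> bool" where
  "depends_on_columns m X f \<longleftrightarrow> (\<forall>g\<in>unitri m. \<forall>h\<in>unitri m.
     (\<forall>i<m. \<forall>j<m. j \<in> X \<longrightarrow> g $$ (i, j) = h $$ (i, j)) \<longrightarrow> f g = f h)"

lemma mix_columns_unitri:
  assumes "g \<in> unitri m" "h \<in> unitri m"
  shows "mix_columns m X g h \<in> unitri m"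
  using unitriD(2,3)[OF assms(1)] unitriD(2,3)[OF assms(2)]
  by (intro unitriI) (auto simp: mix_columns_def)

lemma mix_columns_twice:
  assumes "g \<in> unitri m" "h \<in> unitri m"
  shows "mix_columns m X (mix_columns m X g h) (mix_columns m X h g) = g"
  using unitriD(1)[OF assms(1)] by (intro eq_matI) (auto simp: mix_columns_def)

text \<open>As a set, \<open>T\<close> is the product of its column spaces. Exchanging all columns
  outside \<open>X\<close> between \<open>g\<close> and \<open>h\<close> is an involution on pairs
  that matches the terms \<open>f g * F h\<close> with the terms \<open>f g * F g\<close>.\<close>

lemma sum_unitri_mult:
  fixes f F :: "'a::{field,finite} mat \<Rightarrow> complex"
  assumes f: "depends_on_columns m X f" and F: "depends_on_columns m Y F" and XY: "X \<inter> Y = {}"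
  shows "(\<Sum>g\<in>unitri m. f g) * (\<Sum>g\<in>unitri m. F g) =
    of_nat (card (unitri m :: 'a mat set)) * (\<Sum>g\<in>unitri m. f g * F g)"
proof -
  let ?T = "unitri m :: 'a mat set"
  have fm: "f (mix_columns m X g h) = f g" "F (mix_columns m X g h) = F h"
    if "g \<in> ?T" "h \<in> ?T" for g h
  proof -
    note t = mix_columns_unitri[OF that, of X]
    have "\<forall>i<m. \<forall>j<m. j \<in> X \<longrightarrow> mix_columns m X g h $$ (i, j) = g $$ (i, j)"
      by (simp add: mix_columns_def)
    then show "f (mix_columns m X g h) = f g" using f t that(1) unfolding depends_on_columns_def by blast
    have "\<forall>i<m. \<forall>j<m. j \<in> Y \<longrightarrow> mix_columns m X g h $$ (i, j) = h $$ (i, j)"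
      using XY by (auto simp: mix_columns_def)
    then show "F (mix_columns m X g h) = F h" using F t that(2) unfolding depends_on_columns_def by blast
  qed
  have "(\<Sum>g\<in>?T. f g) * (\<Sum>g\<in>?T. F g) = (\<Sum>(g, h)\<in>?T \<times> ?T. f g * F h)"
    by (simp add: sum_product sum.cartesian_product)
  also have "\<dots> = (\<Sum>(g, h)\<in>?T \<times> ?T. f g * F g)"
    by (rule sum.reindex_bij_witness[of _ "\<lambda>(g, h). (mix_columns m X g h, mix_columns m X h g)"
          "\<lambda>(g, h). (mix_columns m X g h, mix_columns m X h g)"])
      (auto simp: mix_columns_unitri mix_columns_twice fm)
  also have "\<dots> = (\<Sum>g\<in>?T. \<Sum>h\<in>?T. f g * F g)" by (simp only: sum.cartesian_product)
  also have "\<dots> = of_nat (card ?T) * (\<Sum>g\<in>?T. f g * F g)"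
    by (simp add: sum_distrib_left)
  finally show ?thesis .
qed

lemma depends_on_columns_prod:
  fixes f :: "'i \<Rightarrow> 'a::field mat \<Rightarrow> complex"
  assumes "\<And>\<alpha>. \<alpha> \<in> D \<Longrightarrow> depends_on_columns m (X \<alpha>) (f \<alpha>)"
  shows "depends_on_columns m (\<Union>\<alpha>\<in>D. X \<alpha>) (\<lambda>g. \<Prod>\<alpha>\<in>D. f \<alpha> g)"
  unfolding depends_on_columns_def
proof (intro ballI impI prod.cong refl)
  fix g h :: "'a mat" and \<alpha>
  assume "g \<in> unitri m" "h \<in> unitri m" "\<alpha> \<in> D"
    and "\<forall>i<m. \<forall>j<m. j \<in> (\<Union>\<alpha>\<in>D. X \<alpha>) \<longrightarrow> g $$ (i, j) = h $$ (i, j)"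
  then show "f \<alpha> g = f \<alpha> h" using assms[of \<alpha>] unfolding depends_on_columns_def by blast
qed

lemma prod_sum_unitri:
  fixes f :: "'i \<Rightarrow> 'a::{field,finite} mat \<Rightarrow> complex"
  assumes "finite D" and "\<And>\<alpha>. \<alpha> \<in> D \<Longrightarrow> depends_on_columns m (X \<alpha>) (f \<alpha>)"
    and "\<And>\<alpha> \<beta>. \<alpha> \<in> D \<Longrightarrow> \<beta> \<in> D \<Longrightarrow> \<alpha> \<noteq> \<beta> \<Longrightarrow> X \<alpha> \<inter> X \<beta> = {}"
  shows "(\<Prod>\<alpha>\<in>D. (\<Sum>g\<in>unitri m. f \<alpha> g) / of_nat (card (unitri m :: 'a mat set))) =
    (\<Sum>g\<in>unitri m. \<Prod>\<alpha>\<in>D. f \<alpha> g) / of_nat (card (unitri m :: 'a mat set))"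
  using assms
proof (induction D rule: finite_induct)
  case empty
  have "card (unitri m :: 'a mat set) \<noteq> 0" using finite_unitri unitri_one[of m] by (auto simp: card_eq_0_iff)
  then show ?case by simp
next
  case (insert \<alpha> D)
  let ?T = "unitri m :: 'a mat set"
  have c: "(of_nat (card ?T) :: complex) \<noteq> 0"
    using finite_unitri[where 'a = 'a] unitri_one[of m, where 'a = 'a] by (auto simp: card_eq_0_iff)
  have IH: "(\<Prod>\<alpha>\<in>D. (\<Sum>g\<in>?T. f \<alpha> g) / of_nat (card ?T)) = (\<Sum>g\<in>?T. \<Prod>\<alpha>\<in>D. f \<alpha> g) / of_nat (card ?T)"
    using insert.prems by (intro insert.IH) auto
  have "(\<Sum>g\<in>?T. f \<alpha> g) * (\<Sum>g\<in>?T. \<Prod>\<alpha>\<in>D. f \<alpha> g) = of_nat (card ?T) * (\<Sum>g\<in>?T. f \<alpha> g * (\<Prod>\<alpha>\<in>D. f \<alpha> g))"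
  proof (rule sum_unitri_mult)
    show "depends_on_columns m (X \<alpha>) (f \<alpha>)" using insert.prems by simp
    show "depends_on_columns m (\<Union>\<beta>\<in>D. X \<beta>) (\<lambda>g. \<Prod>\<beta>\<in>D. f \<beta> g)"
      using insert.prems by (intro depends_on_columns_prod) simp
    have "X \<alpha> \<inter> X \<beta> = {}" if "\<beta> \<in> D" for \<beta>
      using insert.prems(2)[of \<alpha> \<beta>] insert.hyps that by blast
    then show "X \<alpha> \<inter> (\<Union>\<beta>\<in>D. X \<beta>) = {}" by blast
  qed
  then show ?case using insert.hyps c by (simp add: IH field_simps)
qed

section \<open>Orbit sums\<close>

definition mat_pairing :: "nat \<Rightarrow> 'a::field mat \<Rightarrow> 'a mat \<Rightarrow> 'a" where
  "mat_pairing m X S = (\<Sum>p<m. \<Sum>q<m. X $$ (p, q) * S $$ (p, q))"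

lemma index_mult_triple:
  fixes A B C :: "'a::field mat"
  assumes "A \<in> carrier_mat m m" "B \<in> carrier_mat m m" "C \<in> carrier_mat m m" "a < m" "b < m"
  shows "(A * B * C) $$ (a, b) = (\<Sum>k<m. \<Sum>l<m. A $$ (a, k) * B $$ (k, l) * C $$ (l, b))"
proof -
  have "(A * B * C) $$ (a, b) = (\<Sum>l<m. \<Sum>k<m. A $$ (a, k) * B $$ (k, l) * C $$ (l, b))"
    unfolding index_mult[OF mult_carrier_mat[OF assms(1,2)] assms(3,4,5)]
    by (intro sum.cong refl, subst index_mult[OF assms(1,2,4)]) (auto simp: sum_distrib_right)
  then show ?thesis by (subst sum.swap)
qed

text \<open>Adjointness: the action on forms is carried to the coefficient matrix, so orbits can be
  studied in the dual space.\<close>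

lemma mat_pairing_congruence:
  fixes C S g :: "'a::field mat"
  assumes C: "C \<in> carrier_mat m m" and S: "S \<in> carrier_mat m m" and g: "g \<in> carrier_mat m m"
  shows "mat_pairing m (g * C * transpose_mat g) S = mat_pairing m C (transpose_mat g * S * g)"
proof -
  have t: "transpose_mat g \<in> carrier_mat m m" using g by simp
  let ?I = "{..<m} \<times> {..<m}"
  have "mat_pairing m (g * C * transpose_mat g) S =
    (\<Sum>(p, q)\<in>?I. \<Sum>(k, l)\<in>?I. g $$ (p, k) * C $$ (k, l) * g $$ (q, l) * S $$ (p, q))"
    unfolding mat_pairing_def sum.cartesian_product[symmetric]
    by (intro sum.cong refl, subst index_mult_triple[OF g C t]) (use g in \<open>auto simp: sum_distrib_right\<close>)
  also have "\<dots> = (\<Sum>(k, l)\<in>?I. \<Sum>(p, q)\<in>?I. g $$ (p, k) * C $$ (k, l) * g $$ (q, l) * S $$ (p, q))"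
    unfolding split_def by (rule sum.swap)
  also have "\<dots> = mat_pairing m C (transpose_mat g * S * g)"
    unfolding mat_pairing_def sum.cartesian_product[symmetric]
    by (intro sum.cong refl, subst index_mult_triple[OF t S g])
      (use g in \<open>auto simp: sum_distrib_left mult_ac intro!: sum.cong\<close>)
  finally show ?thesis .
qed

text \<open>Forms are zero outside the region, so a coefficient matrix represents a functional only
  through its entries with \<open>p + q \<ge> msize G n\<close>.\<close>

lemma mat_pairing_cong:
  assumes S: "S \<in> lie_forms G n"
    and "\<And>p q. p < msize G n \<Longrightarrow> q < msize G n \<Longrightarrow> msize G n \<le> p + q \<Longrightarrow> X $$ (p, q) = Y $$ (p, q)"
  shows "mat_pairing (msize G n) X S = mat_pairing (msize G n) Y S"
  unfolding mat_pairing_def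
proof (intro sum.cong refl)
  fix p q assume "p \<in> {..<msize G n}" "q \<in> {..<msize G n}"
  then show "X $$ (p, q) * S $$ (p, q) = Y $$ (p, q) * S $$ (p, q)"
    using assms(2)[of p q] lie_formsD(3)[OF S, of p q] by (cases "msize G n \<le> p + q") auto
qed

lemma mat_pairing_commute: "mat_pairing m X S = mat_pairing m S X"
  by (simp add: mat_pairing_def mult.commute)

lemma lie_forms_congruence:
  fixes S g :: "'a::field mat"
  assumes S: "S \<in> lie_forms G n" and g: "g \<in> unitri (msize G n)"
  shows "transpose_mat g * S * g \<in> lie_forms G n"
proof (rule lie_formsI)
  let ?m = "msize G n"
  note Sc = lie_formsD(1)[OF S] and gc = unitriD(1)[OF g]
  have tc: "transpose_mat g \<in> carrier_mat ?m ?m" using gc by simp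
  show "transpose_mat g * S * g \<in> carrier_mat ?m ?m" using Sc gc by simp
  fix i j assume ij: "i < ?m" "j < ?m"
  have e: "(transpose_mat g * S * g) $$ (i, j) = (\<Sum>k<?m. \<Sum>l<?m. g $$ (k, i) * S $$ (k, l) * g $$ (l, j))"
    if "i < ?m" "j < ?m" for i j
    unfolding index_mult_triple[OF tc Sc gc that] using gc that by (intro sum.cong) auto
  show "(transpose_mat g * S * g) $$ (j, i) = form_sign G * (transpose_mat g * S * g) $$ (i, j)"
    unfolding e[OF ij] e[OF ij(2,1)] sum_distrib_left
  proof (subst sum.swap, intro sum.cong refl)
    fix k l assume "k \<in> {..<?m}" "l \<in> {..<?m}"
    then have "S $$ (l, k) = form_sign G * S $$ (k, l)" by (intro lie_formsD(2)[OF S]) auto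
    then show "g $$ (l, j) * S $$ (l, k) * g $$ (k, i) = form_sign G * (g $$ (k, i) * S $$ (k, l) * g $$ (l, j))"
      by (simp only: mult_ac)
  qed
  assume lt: "i + j < ?m"
  show "(transpose_mat g * S * g) $$ (i, j) = 0"
    unfolding e[OF ij]
  proof (intro sum.neutral ballI)
    fix k l assume kl: "k \<in> {..<?m}" "l \<in> {..<?m}"
    show "g $$ (k, i) * S $$ (k, l) * g $$ (l, j) = 0"
    proof (cases "k \<le> i \<and> l \<le> j")
      case True
      then have "S $$ (k, l) = 0" using lt kl by (intro lie_formsD(3)[OF S]) auto
      then show ?thesis by simp
    next
      case False
      then show ?thesis using unitriD(3)[OF g, of i k] unitriD(3)[OF g, of j l] kl by auto
    qed
  qed
qed

text \<open>The entry at \<open>(a, b)\<close> sees only places \<open>(k, l)\<close> with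
  \<open>k \<ge> a\<close> and \<open>l \<ge> b\<close>. The action therefore descends to matrices
  truncated to the region, that is, to functionals.\<close>

lemma congruence_region:
  fixes Y Y' p q :: "'a::field mat"
  assumes Y: "Y \<in> carrier_mat m m" "Y' \<in> carrier_mat m m" and p: "p \<in> unitri m" and q: "q \<in> unitri m"
    and eq: "\<And>k l. k < m \<Longrightarrow> l < m \<Longrightarrow> m \<le> k + l \<Longrightarrow> Y $$ (k, l) = Y' $$ (k, l)"
    and ab: "a < m" "b < m" "m \<le> a + b"
  shows "(p * Y * transpose_mat q) $$ (a, b) = (p * Y' * transpose_mat q) $$ (a, b)"
proof -
  note c = unitriD(1)[OF p] unitriD(1)[OF q]
  have t: "transpose_mat q \<in> carrier_mat m m" using c by simp
  show ?thesis
    unfolding index_mult_triple[OF c(1) Y(1) t ab(1,2)] index_mult_triple[OF c(1) Y(2) t ab(1,2)]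
  proof (intro sum.cong refl)
    fix k l assume kl: "k \<in> {..<m}" "l \<in> {..<m}"
    show "p $$ (a, k) * Y $$ (k, l) * transpose_mat q $$ (l, b) = p $$ (a, k) * Y' $$ (k, l) * transpose_mat q $$ (l, b)"
    proof (cases "a \<le> k \<and> b \<le> l")
      case True
      then show ?thesis using eq[of k l] kl ab by simp
    next
      case False
      then show ?thesis using unitriD(3)[OF p, of k a] unitriD(3)[OF q, of l b] kl ab c by auto
    qed
  qed
qed

lemma finite_lie_forms: "finite (lie_forms G n :: 'a::{field,finite} mat set)"
  by (rule finite_subset[OF _ finite_carrier_mat[of "msize G n" "msize G n"]]) (use lie_formsD(1) in blast)

section \<open>Character sums over forms and over orbits\<close>

context
  fixes \<theta> :: "'a::{field,finite} \<Rightarrow> complex"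
  assumes two: "(2::'a) \<noteq> 0" and nt: "nontrivial_additive_character \<theta>"
begin

text \<open>Translating by a suitable form multiplies the sum by a value of \<open>\<theta>\<close>
  other than 1.\<close>

lemma sum_lie_forms_zero:
  fixes X :: "'a mat"
  assumes X: "\<And>i j. i < msize G n \<Longrightarrow> j < msize G n \<Longrightarrow> X $$ (j, i) = form_sign G * X $$ (i, j)"
    and pq: "p < msize G n" "q < msize G n" "msize G n \<le> p + q" "X $$ (p, q) \<noteq> 0"
  shows "(\<Sum>S\<in>lie_forms G n. \<theta> (mat_pairing (msize G n) X S)) = 0"
proof -
  let ?m = "msize G n"
  let ?e = "form_sign G :: 'a"
  have ee: "?e * ?e = 1" by (simp add: form_sign_def)
  obtain t where t: "\<theta> (t * (2 * X $$ (p, q))) \<noteq> 1"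
    using additive_character_ex[OF nt, of "2 * X $$ (p, q)"] two pq(4) by auto
  \<comment> \<open>The symmetrised matrix unit at \<open>(p, q)\<close>, skew symmetrised for sign
    \<open>- 1\<close>. Its pairing with \<open>X\<close> is \<open>2 * X $$ (p, q)\<close>, whence
    the 2 in the choice of \<open>t\<close>. If \<open>p = q\<close>, the two summands meet at one
    place and the pairing is still the same.\<close>
  define c where "c i j = (if j = q then if i = p then 1 else 0 else 0) + (if j = p then if i = q then ?e else 0 else 0)"
    for i j
  have c_sym: "c j i = ?e * c i j" for i j
    using ee by (cases "i = p"; cases "j = q"; cases "i = q"; cases "j = p") (simp_all add: c_def distrib_left)
  have c_zero: "c i j = 0" if "i + j < ?m" for i j using that pq(3) by (auto simp: c_def)
  define E where "E s = mat ?m ?m (\<lambda>(i, j). c i j * s)" for s :: 'a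
  have Ei: "E s $$ (i, j) = c i j * s" if "i < ?m" "j < ?m" for s i j
    using that by (simp add: E_def)
  have Ec: "E s \<in> carrier_mat ?m ?m" for s by (simp add: E_def)
  have EL: "S + E s \<in> lie_forms G n" if S: "S \<in> lie_forms G n" for S s
  proof (rule lie_formsI)
    note Sc = lie_formsD(1)[OF S]
    have i: "(S + E s) $$ (i, j) = S $$ (i, j) + E s $$ (i, j)" if "i < ?m" "j < ?m" for i j
      using that Sc Ec[of s] by simp
    show "S + E s \<in> carrier_mat ?m ?m" using Sc Ec by simp
    fix i j assume ij: "i < ?m" "j < ?m"
    have "E s $$ (j, i) = ?e * E s $$ (i, j)"
      unfolding Ei[OF ij] Ei[OF ij(2,1)] c_sym[of j i] by (simp only: mult.assoc)
    then show "(S + E s) $$ (j, i) = ?e * (S + E s) $$ (i, j)"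
      unfolding i[OF ij] i[OF ij(2,1)] lie_formsD(2)[OF S ij] by (simp only: distrib_left)
    assume "i + j < ?m"
    then show "(S + E s) $$ (i, j) = 0"
      unfolding i[OF ij] Ei[OF ij] using lie_formsD(3)[OF S ij] c_zero by simp
  qed
  have EE: "S + E s + E (- s) = S" if "S \<in> lie_forms G n" for S s
  proof (rule eq_matI)
    note Sc = lie_formsD(1)[OF that]
    fix i j assume "i < dim_row S" "j < dim_col S"
    then have ij: "i < ?m" "j < ?m" using Sc by auto
    have "(S + E s + E (- s)) $$ (i, j) = S $$ (i, j) + E s $$ (i, j) + E (- s) $$ (i, j)"
      using ij Sc Ec[of s] Ec[of "- s"] by simp
    then show "(S + E s + E (- s)) $$ (i, j) = S $$ (i, j)"
      unfolding Ei[OF ij] by simp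
  qed (use lie_formsD(1)[OF that] Ec[of "- s"] in auto)
  have EE': "S + E (- s) + E s = S" if "S \<in> lie_forms G n" for S s
    using EE[OF that, of "- s"] by simp
  have pairE: "mat_pairing ?m X (S + E t) = mat_pairing ?m X S + t * (2 * X $$ (p, q))"
    if S: "S \<in> lie_forms G n" for S
  proof -
    have "mat_pairing ?m X (S + E t) = mat_pairing ?m X S + (\<Sum>i<?m. \<Sum>j<?m. X $$ (i, j) * c i j) * t"
      unfolding mat_pairing_def sum_distrib_right sum.distrib[symmetric]
    proof (intro sum.cong refl)
      fix i j assume "i \<in> {..<?m}" "j \<in> {..<?m}"
      then have ij: "i < ?m" "j < ?m" by auto
      have "(S + E t) $$ (i, j) = S $$ (i, j) + E t $$ (i, j)"
        using ij lie_formsD(1)[OF S] Ec[of t] by simp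
      then show "X $$ (i, j) * (S + E t) $$ (i, j) = X $$ (i, j) * S $$ (i, j) + X $$ (i, j) * c i j * t"
        unfolding Ei[OF ij] by (simp only: distrib_left mult.assoc)
    qed
    also have "(\<Sum>i<?m. \<Sum>j<?m. X $$ (i, j) * c i j) = (\<Sum>i<?m. \<Sum>j<?m.
      (if j = q then if i = p then X $$ (p, q) else 0 else 0) +
      (if j = p then if i = q then X $$ (q, p) * ?e else 0 else 0))"
      unfolding c_def by (intro sum.cong refl) (simp add: distrib_left)
    also have "\<dots> = X $$ (p, q) + X $$ (q, p) * ?e"
      using pq(1,2) by (simp add: sum.distrib)
    also have "X $$ (q, p) * ?e = (?e * ?e) * X $$ (p, q)"
      unfolding X[OF pq(1,2)] by (simp only: mult_ac)
    finally show ?thesis by (simp add: ee mult_ac)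
  qed
  have "(\<Sum>S\<in>lie_forms G n. \<theta> (mat_pairing ?m X S)) = (\<Sum>S\<in>lie_forms G n. \<theta> (mat_pairing ?m X (S + E t)))"
    by (rule sum.reindex_bij_witness[of _ "\<lambda>S. S + E t" "\<lambda>S. S + E (- t)"]) (simp_all add: EL EE EE')
  also have "\<dots> = (\<Sum>S\<in>lie_forms G n. \<theta> (mat_pairing ?m X S)) * \<theta> (t * (2 * X $$ (p, q)))"
    by (simp add: pairE additive_character_add[OF nt] sum_distrib_right)
  finally show ?thesis using t by (metis mult_cancel_left1)
qed

text \<open>Summing over the group rather than over the orbit counts stabilisers with repetition, so
  that orbit sizes never have to be known.\<close>

definition orbit_sum :: "nat \<Rightarrow> 'a mat \<Rightarrow> 'a mat \<Rightarrow> complex" where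
  "orbit_sum m C S = (\<Sum>g\<in>unitri m. \<theta> (mat_pairing m C (transpose_mat g * S * g)))"

lemma orbit_sum_zero: "orbit_sum m C (0\<^sub>m m m) = of_nat (card (unitri m :: 'a mat set))"
proof -
  have "mat_pairing m C (transpose_mat g * 0\<^sub>m m m * g) = 0" if "g \<in> unitri m" for g :: "'a mat"
  proof -
    have "transpose_mat g * 0\<^sub>m m m * g = 0\<^sub>m m m"
      using mult_one_zero(3)[of g m m m] mult_one_zero(4)[of "transpose_mat g" m m m] unitriD(1)[OF that] by simp
    then show ?thesis by (simp add: mat_pairing_def)
  qed
  then show ?thesis by (simp add: orbit_sum_def additive_character_zero[OF nt])
qed

text \<open>The scalar product expands into character sums over \<open>lie_forms\<close> for the
  differences of points of the two orbits. Disjointness makes every such difference a nonzero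
  functional.\<close>

lemma orbit_sum_orthogonal:
  fixes C C' :: "'a mat"
  assumes C: "C \<in> carrier_mat (msize G n) (msize G n)" "C' \<in> carrier_mat (msize G n) (msize G n)"
    and sym: "\<And>i j. i < msize G n \<Longrightarrow> j < msize G n \<Longrightarrow> C $$ (j, i) = form_sign G * C $$ (i, j)"
      "\<And>i j. i < msize G n \<Longrightarrow> j < msize G n \<Longrightarrow> C' $$ (j, i) = form_sign G * C' $$ (i, j)"
    and disj: "\<And>g h. g \<in> unitri (msize G n) \<Longrightarrow> h \<in> unitri (msize G n) \<Longrightarrow>
      \<exists>p<msize G n. \<exists>q<msize G n. msize G n \<le> p + q \<and>
        (g * C * transpose_mat g) $$ (p, q) \<noteq> (h * C' * transpose_mat h) $$ (p, q)"
  shows "(\<Sum>S\<in>lie_forms G n. orbit_sum (msize G n) C S * cnj (orbit_sum (msize G n) C' S)) = 0"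
proof -
  let ?m = "msize G n"
  have symg: "(g * C * transpose_mat g) $$ (j, i) = form_sign G * (g * C * transpose_mat g) $$ (i, j)"
    if C: "C \<in> carrier_mat ?m ?m"
      and sym: "\<And>i j. i < ?m \<Longrightarrow> j < ?m \<Longrightarrow> C $$ (j, i) = form_sign G * C $$ (i, j)"
      and g: "g \<in> unitri ?m" and ij: "i < ?m" "j < ?m" for C g :: "'a mat" and i j
  proof -
    note gc = unitriD(1)[OF g]
    have tc: "transpose_mat g \<in> carrier_mat ?m ?m" using gc by simp
    have e: "(g * C * transpose_mat g) $$ (i, j) = (\<Sum>k<?m. \<Sum>l<?m. g $$ (i, k) * C $$ (k, l) * g $$ (j, l))"
      if "i < ?m" "j < ?m" for i j
      unfolding index_mult_triple[OF gc C tc that] using gc that by (intro sum.cong) auto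
    show ?thesis
      unfolding e[OF ij] e[OF ij(2,1)] sum_distrib_left
    proof (subst sum.swap, intro sum.cong refl)
      fix k l assume "k \<in> {..<?m}" "l \<in> {..<?m}"
      then have "C $$ (l, k) = form_sign G * C $$ (k, l)" by (intro sym) auto
      then show "g $$ (j, l) * C $$ (l, k) * g $$ (i, k) = form_sign G * (g $$ (i, k) * C $$ (k, l) * g $$ (j, l))"
        by (simp only: mult_ac)
    qed
  qed
  define X where "X g h = g * C * transpose_mat g - h * C' * transpose_mat h" for g h
  have Xi: "X g h $$ (i, j) = (g * C * transpose_mat g) $$ (i, j) - (h * C' * transpose_mat h) $$ (i, j)"
    if "g \<in> unitri ?m" "h \<in> unitri ?m" "i < ?m" "j < ?m" for g h i j
    unfolding X_def using that unitriD(1)[OF that(1)] unitriD(1)[OF that(2)] C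
    by (intro index_minus_mat) auto
  have X0: "(\<Sum>S\<in>lie_forms G n. \<theta> (mat_pairing ?m (X g h) S)) = 0"
    if gh: "g \<in> unitri ?m" "h \<in> unitri ?m" for g h
  proof -
    obtain p q where pq: "p < ?m" "q < ?m" "?m \<le> p + q"
      "(g * C * transpose_mat g) $$ (p, q) \<noteq> (h * C' * transpose_mat h) $$ (p, q)"
      using disj[OF gh] by blast
    show ?thesis
    proof (rule sum_lie_forms_zero[OF _ pq(1-3)])
      show "X g h $$ (p, q) \<noteq> 0" unfolding Xi[OF gh pq(1,2)] using pq(4) by simp
      show "X g h $$ (j, i) = form_sign G * X g h $$ (i, j)" if "i < ?m" "j < ?m" for i j
        using symg[OF C(1) sym(1) gh(1) that] symg[OF C(2) sym(2) gh(2) that]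
        unfolding Xi[OF gh that] Xi[OF gh that(2,1)] by (simp only: right_diff_distrib)
    qed
  qed
  have pairX: "\<theta> (mat_pairing ?m C (transpose_mat g * S * g)) * cnj (\<theta> (mat_pairing ?m C' (transpose_mat h * S * h))) =
    \<theta> (mat_pairing ?m (X g h) S)" if gh: "g \<in> unitri ?m" "h \<in> unitri ?m" and S: "S \<in> lie_forms G n" for g h S
  proof -
    note Sc = lie_formsD(1)[OF S]
    have "mat_pairing ?m (X g h) S =
      mat_pairing ?m (g * C * transpose_mat g) S - mat_pairing ?m (h * C' * transpose_mat h) S"
      unfolding mat_pairing_def sum_subtractf[symmetric]
      by (intro sum.cong refl) (use Xi[OF gh] in \<open>auto simp: left_diff_distrib\<close>)
    also have "\<dots> = mat_pairing ?m C (transpose_mat g * S * g) + - mat_pairing ?m C' (transpose_mat h * S * h)"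
      unfolding mat_pairing_congruence[OF C(1) Sc unitriD(1)[OF gh(1)]]
        mat_pairing_congruence[OF C(2) Sc unitriD(1)[OF gh(2)]] by simp
    finally show ?thesis by (simp only: additive_character_add[OF nt] additive_character_cnj[OF nt])
  qed
  have "(\<Sum>S\<in>lie_forms G n. orbit_sum ?m C S * cnj (orbit_sum ?m C' S)) =
    (\<Sum>S\<in>lie_forms G n. \<Sum>g\<in>unitri ?m. \<Sum>h\<in>unitri ?m. \<theta> (mat_pairing ?m (X g h) S))"
    unfolding orbit_sum_def cnj_sum sum_product by (intro sum.cong refl) (rule pairX)
  also have "\<dots> = (\<Sum>g\<in>unitri ?m. \<Sum>h\<in>unitri ?m. \<Sum>S\<in>lie_forms G n. \<theta> (mat_pairing ?m (X g h) S))"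
    by (subst sum.swap, rule sum.cong[OF refl], rule sum.swap)
  also have "\<dots> = 0" by (simp add: X0)
  finally show ?thesis .
qed

text \<open>Fourier inversion at zero, with \<open>lie_forms\<close> serving as its own dual.
  Congruence by \<open>g\<close> is invertible, so a nonzero \<open>S\<close> stays nonzero.\<close>

lemma sum_orbit_sum:
  fixes S :: "'a mat"
  assumes S: "S \<in> lie_forms G n"
  shows "(\<Sum>C\<in>lie_forms G n. orbit_sum (msize G n) C S) =
    (if S = 0\<^sub>m (msize G n) (msize G n)
     then of_nat (card (unitri (msize G n) :: 'a mat set)) * of_nat (card (lie_forms G n :: 'a mat set)) else 0)"
proof -
  let ?m = "msize G n"
  show ?thesis
  proof (cases "S = 0\<^sub>m ?m ?m")
    case True
    then show ?thesis by (simp add: orbit_sum_zero)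
  next
    case False
    have "(\<Sum>C\<in>lie_forms G n. \<theta> (mat_pairing ?m C (transpose_mat g * S * g))) = 0"
      if g: "g \<in> unitri ?m" for g :: "'a mat"
    proof -
      let ?S = "transpose_mat g * S * g"
      have SL: "?S \<in> lie_forms G n" by (rule lie_forms_congruence[OF S g])
      have "?S \<noteq> 0\<^sub>m ?m ?m"
      proof
        assume 0: "?S = 0\<^sub>m ?m ?m"
        obtain k where k: "k \<in> unitri ?m" "g * k = 1\<^sub>m ?m" "k * g = 1\<^sub>m ?m" using unitri_inverse[OF g] by metis
        note c = unitriD(1)[OF g] unitriD(1)[OF k(1)] lie_formsD(1)[OF S]
        have tt: "transpose_mat k * transpose_mat g = 1\<^sub>m ?m"
          unfolding transpose_mult[OF c(1,2), symmetric] k by simp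
        have "transpose_mat k * ?S * k = (transpose_mat k * transpose_mat g) * S * (g * k)"
          using c by (simp add: assoc_mult_mat[of _ ?m ?m _ ?m _ ?m])
        also have "\<dots> = S" unfolding tt k using c by simp
        finally have "S = transpose_mat k * 0\<^sub>m ?m ?m * k" unfolding 0 by simp
        also have "\<dots> = 0\<^sub>m ?m ?m"
          using mult_one_zero(3)[of k ?m ?m ?m] mult_one_zero(4)[of "transpose_mat k" ?m ?m ?m] c by simp
        finally show False using False by simp
      qed
      then obtain p q where pq: "p < ?m" "q < ?m" "?S $$ (p, q) \<noteq> 0"
        using lie_formsD(1)[OF SL] by (auto simp: mat_eq_iff simp del: index_mult_mat(1))
      then have "?m \<le> p + q" using lie_formsD(3)[OF SL pq(1,2)] by (meson not_le)
      have "(\<Sum>C\<in>lie_forms G n. \<theta> (mat_pairing ?m ?S C)) = 0"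
        by (rule sum_lie_forms_zero[OF lie_formsD(2)[OF SL] pq(1,2) \<open>?m \<le> p + q\<close> pq(3)])
      then show ?thesis by (simp only: mat_pairing_commute[of ?m _ ?S])
    qed
    then show ?thesis using False unfolding orbit_sum_def by (subst sum.swap) simp
  qed
qed

text \<open>Right translation by \<open>g\<close> permutes the group and absorbs the change of
  representative.\<close>

lemma orbit_sum_congruence:
  fixes C C' S :: "'a mat"
  assumes S: "S \<in> lie_forms G n" and C: "C \<in> carrier_mat (msize G n) (msize G n)"
    and g: "g \<in> unitri (msize G n)"
    and eq: "\<And>p q. p < msize G n \<Longrightarrow> q < msize G n \<Longrightarrow> msize G n \<le> p + q \<Longrightarrow>
      C' $$ (p, q) = (g * C * transpose_mat g) $$ (p, q)"
  shows "orbit_sum (msize G n) C' S = orbit_sum (msize G n) C S"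
proof -
  let ?m = "msize G n"
  note gc = unitriD(1)[OF g] and Sc = lie_formsD(1)[OF S]
  obtain k where k: "k \<in> unitri ?m" "g * k = 1\<^sub>m ?m" "k * g = 1\<^sub>m ?m" using unitri_inverse[OF g] by metis
  have "mat_pairing ?m C' (transpose_mat h * S * h) = mat_pairing ?m C (transpose_mat (h * g) * S * (h * g))"
    if h: "h \<in> unitri ?m" for h
  proof -
    note hc = unitriD(1)[OF h]
    have "mat_pairing ?m C' (transpose_mat h * S * h) =
      mat_pairing ?m (g * C * transpose_mat g) (transpose_mat h * S * h)"
      by (rule mat_pairing_cong[OF lie_forms_congruence[OF S h] eq])
    also have "\<dots> = mat_pairing ?m C (transpose_mat g * (transpose_mat h * S * h) * g)"
      using hc Sc by (intro mat_pairing_congruence[OF C _ gc]) auto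
    also have "transpose_mat g * (transpose_mat h * S * h) * g = transpose_mat (h * g) * S * (h * g)"
      unfolding transpose_mult[OF hc gc] using hc gc Sc by (simp add: assoc_mult_mat[of _ ?m ?m _ ?m _ ?m])
    finally show ?thesis .
  qed
  then have "orbit_sum ?m C' S = (\<Sum>h\<in>unitri ?m. \<theta> (mat_pairing ?m C (transpose_mat (h * g) * S * (h * g))))"
    unfolding orbit_sum_def by (intro sum.cong) auto
  also have "\<dots> = orbit_sum ?m C S"
    unfolding orbit_sum_def
  proof (rule sum.reindex_bij_witness[of _ "\<lambda>h. h * k" "\<lambda>h. h * g"])
    fix h :: "'a mat" assume h: "h \<in> unitri ?m"
    show "h * g * k = h" "h * k * g = h"
      using unitriD(1)[OF h] gc unitriD(1)[OF k(1)] k(2,3)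
        assoc_mult_mat[of h ?m ?m g ?m k ?m] assoc_mult_mat[of h ?m ?m k ?m g ?m] by auto
    show "h * g \<in> unitri ?m" "h * k \<in> unitri ?m" using unitri_mult h g k(1) by auto
  qed simp
  finally show ?thesis .
qed

end

section \<open>Basic pairs as monomial forms\<close>

definition pair_support :: "family \<Rightarrow> nat \<Rightarrow> root set \<Rightarrow> (nat \<times> nat) set" where
  "pair_support G n D = {(p, q). \<exists>\<alpha>\<in>D. root_pair G n \<alpha> = (p, q) \<or> root_pair G n \<alpha> = (q, p)}"

lemma pair_support_commute: "(p, q) \<in> pair_support G n D \<longleftrightarrow> (q, p) \<in> pair_support G n D"
  unfolding pair_support_def by blast

lemma finite_roots: "finite (roots G n)"
proof -
  have "roots G n \<subseteq> (\<lambda>(i, j). Diff i j) ` ({..n} \<times> {..n}) \<union> (\<lambda>(i, j). Plus i j) ` ({..n} \<times> {..n}) \<union>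
    Twice ` {..n} \<union> Single ` {..n}"
    by (cases G) (auto simp: roots_def)
  then show ?thesis by (rule finite_subset) auto
qed

lemma entries_labels:
  assumes "\<alpha> \<in> roots G n" "(i, j) \<in> entries \<alpha>"
  shows "i \<in> labels G n" "j \<in> labels G n"
  using assms by (cases G; auto simp: roots_def labels_def)+

text \<open>The two entries of a root are mirror images in the antidiagonal. Reversing the numbering
  of rows makes them mirror images in the diagonal, as the places of a symmetric form should
  be.\<close>

lemma entries_root_pair:
  assumes "\<alpha> \<in> roots G n" "root_pair G n \<alpha> = (a, b)"
  shows "(\<lambda>(i, j). (msize G n - 1 - pos G n i, pos G n j)) ` entries \<alpha> = {(a, b), (b, a)}"
proof -
  have p: "pos G n (int i) = i - 1" if "1 \<le> i" for i using that by (simp add: pos_def nat_diff_distrib)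
  have ng: "pos G n (- int i) = msize G n - i" if "1 \<le> i" "i \<le> n" for i
    using that by (auto simp: pos_def msize_def nat_diff_distrib of_nat_diff)
  have z: "pos G n 0 = n" by (simp add: pos_def)
  have e: "msize G n - 1 - (i - 1) = msize G n - i" "msize G n - 1 - (msize G n - i) = i - 1"
    if "1 \<le> i" "i \<le> n" for i
    using that by (auto simp: msize_def)
  show ?thesis
  proof (cases \<alpha>)
    case (Diff i j)
    then have "1 \<le> i" "i < j" "j \<le> n" using assms by (auto simp: roots_def split: family.splits)
    then show ?thesis using assms(2) Diff p[of i] p[of j] ng[of i] ng[of j] e[of i] e[of j] by simp
  next
    case (Plus i j)
    then have "1 \<le> i" "i < j" "j \<le> n" using assms by (auto simp: roots_def split: family.splits)
    then show ?thesis using assms(2) Plus p[of i] p[of j] ng[of i] ng[of j] e[of i] e[of j] by simp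
  next
    case (Twice i)
    then have "1 \<le> i" "i \<le> n" using assms by (auto simp: roots_def split: family.splits)
    then show ?thesis using assms(2) Twice p[of i] ng[of i] e[of i] by simp
  next
    case (Single i)
    then have "1 \<le> i" "i \<le> n" "G = O_odd" using assms by (auto simp: roots_def split: family.splits)
    then show ?thesis using assms(2) Single p[of i] ng[of i] e[of i] z by (auto simp add: msize_def)
  qed
qed

text \<open>The reversed support is symmetric, so the condition on rows contains the condition on
  columns.\<close>

lemma basic_set_iff:
  "basic_set G n D \<longleftrightarrow> D \<subseteq> roots G n \<and>
    (\<forall>p q q'. (p, q) \<in> pair_support G n D \<longrightarrow> (p, q') \<in> pair_support G n D \<longrightarrow> q = q')"
proof (cases "D \<subseteq> roots G n")
  case D: True
  let ?f = "\<lambda>(i, j). (msize G n - 1 - pos G n i, pos G n j)"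
  let ?E = "\<Union> (entries ` D)" and ?P = "pair_support G n D"
  have img: "?P = ?f ` ?E"
  proof -
    have "?f ` entries \<alpha> = {(p, q). root_pair G n \<alpha> = (p, q) \<or> root_pair G n \<alpha> = (q, p)}" if "\<alpha> \<in> D" for \<alpha>
    proof -
      obtain a b where ab: "root_pair G n \<alpha> = (a, b)" by (cases "root_pair G n \<alpha>")
      have "\<alpha> \<in> roots G n" using D that by blast
      moreover have "{(p, q). root_pair G n \<alpha> = (p, q) \<or> root_pair G n \<alpha> = (q, p)} = {(a, b), (b, a)}"
        unfolding ab by auto
      ultimately show ?thesis using entries_root_pair[of \<alpha> G n a b] ab by simp
    qed
    then have "?f ` ?E = (\<Union>\<alpha>\<in>D. {(p, q). root_pair G n \<alpha> = (p, q) \<or> root_pair G n \<alpha> = (q, p)})"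
      by (simp add: image_UN)
    then show ?thesis unfolding pair_support_def by blast
  qed
  have lab: "i \<in> labels G n" "j \<in> labels G n" if "(i, j) \<in> ?E" for i j
    using that D entries_labels by blast+
  have inj: "i = j" if "i \<in> labels G n" "j \<in> labels G n" "pos G n i = pos G n j" for i j
    by (rule inj_onD[OF bij_betw_imp_inj_on[OF pos_bij[of G n]] that(3) that(1,2)])
  have lt: "pos G n i < msize G n" if "i \<in> labels G n" for i
    using bij_betwE[OF pos_bij[of G n]] that by blast
  have inj': "i = j" if "i \<in> labels G n" "j \<in> labels G n" "msize G n - 1 - pos G n i = msize G n - 1 - pos G n j" for i j
    using inj[OF that(1,2)] lt[OF that(1)] lt[OF that(2)] that(3) by linarith
  have P: "(msize G n - 1 - pos G n i, pos G n j) \<in> ?P" if "(i, j) \<in> ?E" for i j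
    unfolding img using that by (intro image_eqI[of _ _ "(i, j)"]) auto
  have P': "\<exists>i j. (i, j) \<in> ?E \<and> p = msize G n - 1 - pos G n i \<and> q = pos G n j" if "(p, q) \<in> ?P" for p q
    using that unfolding img by auto
  show ?thesis
  proof
    assume b: "basic_set G n D"
    have "q = q'" if PQ: "(p, q) \<in> ?P" "(p, q') \<in> ?P" for p q q'
    proof -
      obtain i j where ij: "(i, j) \<in> ?E" "p = msize G n - 1 - pos G n i" "q = pos G n j" using P'[OF PQ(1)] by blast
      obtain k l where kl: "(k, l) \<in> ?E" "p = msize G n - 1 - pos G n k" "q' = pos G n l" using P'[OF PQ(2)] by blast
      have "i = k" using inj'[of i k] ij kl lab(1)[OF ij(1)] lab(1)[OF kl(1)] by simp
      then have "j = l" using b ij(1) kl(1) unfolding basic_set_def by blast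
      then show ?thesis using ij kl by simp
    qed
    then show "D \<subseteq> roots G n \<and> (\<forall>p q q'. (p, q) \<in> ?P \<longrightarrow> (p, q') \<in> ?P \<longrightarrow> q = q')" using D by blast
  next
    assume b: "D \<subseteq> roots G n \<and> (\<forall>p q q'. (p, q) \<in> ?P \<longrightarrow> (p, q') \<in> ?P \<longrightarrow> q = q')"
    have "j = j'" if "(i, j) \<in> ?E" "(i, j') \<in> ?E" for i j j'
      using inj[OF lab(2)[OF that(1)] lab(2)[OF that(2)]] b P[OF that(1)] P[OF that(2)] by blast
    moreover have "i = i'" if "(i, j) \<in> ?E" "(i', j) \<in> ?E" for i i' j
      using inj'[OF lab(1)[OF that(1)] lab(1)[OF that(2)]] b P[OF that(1)] P[OF that(2)]
        pair_support_commute by blast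
    ultimately show "basic_set G n D" unfolding basic_set_def using D by blast
  qed
qed (simp add: basic_set_def)

lemma root_pair_same:
  assumes "\<alpha> \<in> roots G n" "\<beta> \<in> roots G n" "root_pair G n \<alpha> = (a, b)"
    and "root_pair G n \<beta> = (a, b) \<or> root_pair G n \<beta> = (b, a)"
  shows "\<alpha> = \<beta>"
proof (rule root_pair_inj[OF assms(1,2)])
  show "root_pair G n \<alpha> = root_pair G n \<beta>"
    using assms(4)
  proof
    assume "root_pair G n \<beta> = (b, a)"
    then have "a = b" using root_pair_bounds(2)[OF assms(2)] root_pair_bounds(2)[OF assms(1,3)] by fastforce
    then show ?thesis using assms(3) \<open>root_pair G n \<beta> = (b, a)\<close> by simp
  qed (simp add: assms(3))
qed

definition root_columns :: "family \<Rightarrow> nat \<Rightarrow> root \<Rightarrow> nat set" where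
  "root_columns G n \<alpha> = {fst (root_pair G n \<alpha>), snd (root_pair G n \<alpha>)}"

text \<open>Where basicness enters the product of elementary characters: the factors use disjoint
  sets of columns of \<open>g\<close> and are independent.\<close>

lemma basic_set_columns:
  assumes D: "basic_set G n D" and \<alpha>: "\<alpha> \<in> D" "\<beta> \<in> D" "\<alpha> \<noteq> \<beta>"
  shows "root_columns G n \<alpha> \<inter> root_columns G n \<beta> = {}"
proof (rule ccontr)
  assume ne: "root_columns G n \<alpha> \<inter> root_columns G n \<beta> \<noteq> {}"
  obtain a b where ab: "root_pair G n \<alpha> = (a, b)" by (cases "root_pair G n \<alpha>")
  obtain a' b' where ab': "root_pair G n \<beta> = (a', b')" by (cases "root_pair G n \<beta>")
  have r: "\<alpha> \<in> roots G n" "\<beta> \<in> roots G n" using D \<alpha> by (auto simp: basic_set_iff)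
  have row: "q = q'" if "(p, q) \<in> pair_support G n D" "(p, q') \<in> pair_support G n D" for p q q'
    using D that unfolding basic_set_iff by blast
  have s: "(a, b) \<in> pair_support G n D" "(b, a) \<in> pair_support G n D"
    "(a', b') \<in> pair_support G n D" "(b', a') \<in> pair_support G n D"
    using \<alpha> ab ab' unfolding pair_support_def by auto
  have "a = a' \<or> a = b' \<or> b = a' \<or> b = b'" using ne by (auto simp: root_columns_def ab ab')
  then have "(a', b') = (a, b) \<or> (a', b') = (b, a)"
  proof (elim disjE)
    assume "a = a'" then show ?thesis using row[OF s(1), of b'] s(3) by simp
  next
    assume "a = b'" then show ?thesis using row[OF s(1), of a'] s(4) by simp
  next
    assume "b = a'" then show ?thesis using row[OF s(2), of b'] s(3) by simp
  next
    assume "b = b'" then show ?thesis using row[OF s(2), of a'] s(4) by simp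
  qed
  then show False using root_pair_same[OF r ab] ab' \<alpha>(3) by simp
qed

text \<open>Normalised so that pairing with a form gives the coordinate of \<open>\<alpha>\<close>
  the factor \<open>- 2 * form_sign G * \<phi> \<alpha>\<close>, in agreement with
  \<open>elementary_char_average\<close>. At a diagonal place the two summands fall together and
  double the coefficient.\<close>

definition basic_coeff :: "family \<Rightarrow> nat \<Rightarrow> root set \<Rightarrow> (root \<Rightarrow> 'a::field) \<Rightarrow> nat \<Rightarrow> nat \<Rightarrow> 'a" where
  "basic_coeff G n D \<phi> p q = (\<Sum>\<alpha>\<in>D. - form_sign G * \<phi> \<alpha> *
     (of_bool (root_pair G n \<alpha> = (p, q)) + form_sign G * of_bool (root_pair G n \<alpha> = (q, p))))"

definition basic_form :: "family \<Rightarrow> nat \<Rightarrow> root set \<Rightarrow> (root \<Rightarrow> 'a::field) \<Rightarrow> 'a mat" where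
  "basic_form G n D \<phi> = mat (msize G n) (msize G n) (\<lambda>(p, q). basic_coeff G n D \<phi> p q)"

lemma basic_coeff_sym:
  "basic_coeff G n D \<phi> q p = form_sign G * (basic_coeff G n D \<phi> p q :: 'a::field)"
proof -
  have "- form_sign G * f * (y + form_sign G * x) = form_sign G * (- form_sign G * f * (x + form_sign G * y))"
    for f x y :: 'a
    by (cases "G = Sp") (simp_all add: form_sign_def algebra_simps)
  then show ?thesis unfolding basic_coeff_def sum_distrib_left by (rule sum.cong[OF refl])
qed

lemma basic_coeff_support:
  assumes "basic_coeff G n D \<phi> p q \<noteq> 0"
  shows "(p, q) \<in> pair_support G n D"
proof (rule ccontr)
  assume "(p, q) \<notin> pair_support G n D"
  then have "\<forall>\<alpha>\<in>D. root_pair G n \<alpha> \<noteq> (p, q) \<and> root_pair G n \<alpha> \<noteq> (q, p)"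
    unfolding pair_support_def by blast
  then have "basic_coeff G n D \<phi> p q = 0" unfolding basic_coeff_def by (intro sum.neutral) auto
  then show False using assms by simp
qed

lemma basic_coeff_root:
  fixes \<phi> :: "root \<Rightarrow> 'a::field"
  assumes D: "D \<subseteq> roots G n" and \<alpha>: "\<alpha> \<in> D" "root_pair G n \<alpha> = (a, b)"
  shows "basic_coeff G n D \<phi> a b = - form_sign G * \<phi> \<alpha> * (if a = b then 2 else 1)"
proof -
  have fin: "finite D" using D finite_roots finite_subset by blast
  have r: "\<alpha> \<in> roots G n" using D \<alpha> by blast
  have 0: "root_pair G n \<beta> \<noteq> (a, b) \<and> root_pair G n \<beta> \<noteq> (b, a)" if "\<beta> \<in> D - {\<alpha>}" for \<beta>
    using root_pair_same[OF r _ \<alpha>(2)] that D by blast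
  have "basic_coeff G n D \<phi> a b = - form_sign G * \<phi> \<alpha> *
     (of_bool (root_pair G n \<alpha> = (a, b)) + form_sign G * of_bool (root_pair G n \<alpha> = (b, a)))"
    unfolding basic_coeff_def sum.remove[OF fin \<alpha>(1)] using 0 by simp
  then show ?thesis using \<alpha>(2) root_pair_bounds(5)[OF r \<alpha>(2)] by (auto simp: form_sign_def)
qed

lemma basic_coeff_bounds:
  assumes "D \<subseteq> roots G n" "basic_coeff G n D \<phi> p q \<noteq> 0"
  shows "p < msize G n \<and> q < msize G n \<and> msize G n \<le> p + q"
proof -
  obtain \<alpha> where \<alpha>: "\<alpha> \<in> D" "root_pair G n \<alpha> = (p, q) \<or> root_pair G n \<alpha> = (q, p)"
    using basic_coeff_support[OF assms(2)] unfolding pair_support_def by blast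
  have r: "\<alpha> \<in> roots G n" using \<alpha>(1) assms(1) by blast
  from \<alpha>(2) show ?thesis
  proof
    assume "root_pair G n \<alpha> = (p, q)"
    from root_pair_bounds(1-3)[OF r this] show ?thesis by linarith
  next
    assume "root_pair G n \<alpha> = (q, p)"
    from root_pair_bounds(1-3)[OF r this] show ?thesis by linarith
  qed
qed

lemma basic_coeff_monomial:
  assumes "basic_set G n D"
  shows "monomial (basic_coeff G n D \<phi>)"
proof -
  have row: "q = q'" if "(p, q) \<in> pair_support G n D" "(p, q') \<in> pair_support G n D" for p q q'
    using assms that unfolding basic_set_iff by blast
  show ?thesis
    unfolding monomial_def
  proof (intro conjI allI impI; elim conjE)
    fix i j j' assume "basic_coeff G n D \<phi> i j \<noteq> 0" "basic_coeff G n D \<phi> i j' \<noteq> 0"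
    from this[THEN basic_coeff_support] show "j = j'" by (rule row)
  next
    fix i i' j assume "basic_coeff G n D \<phi> i j \<noteq> 0" "basic_coeff G n D \<phi> i' j \<noteq> 0"
    from this[THEN basic_coeff_support] show "i = i'"
      using row pair_support_commute by blast
  qed
qed

lemma basic_form_pairing:
  fixes S :: "'a::field mat"
  assumes S: "S \<in> lie_forms G n" and D: "D \<subseteq> roots G n"
  shows "mat_pairing (msize G n) (basic_form G n D \<phi>) S =
    (\<Sum>\<alpha>\<in>D. - 2 * form_sign G * \<phi> \<alpha> * S $$ root_pair G n \<alpha>)"
proof -
  let ?m = "msize G n"
  have delta: "(\<Sum>p<?m. \<Sum>q<?m. of_bool (r = (p, q)) * S $$ (p, q)) = S $$ r"
    "(\<Sum>p<?m. \<Sum>q<?m. of_bool (r = (q, p)) * S $$ (p, q)) = S $$ (snd r, fst r)"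
    if r: "fst r < ?m" "snd r < ?m" for r
  proof -
    obtain a b where ab: "r = (a, b)" by (cases r)
    have "(\<Sum>p<?m. \<Sum>q<?m. of_bool (r = (p, q)) * S $$ (p, q)) =
      (\<Sum>p<?m. \<Sum>q<?m. if q = b then if p = a then S $$ (a, b) else 0 else 0)"
      by (intro sum.cong) (auto simp: ab)
    then show "(\<Sum>p<?m. \<Sum>q<?m. of_bool (r = (p, q)) * S $$ (p, q)) = S $$ r"
      using r ab by simp
    have "(\<Sum>p<?m. \<Sum>q<?m. of_bool (r = (q, p)) * S $$ (p, q)) =
      (\<Sum>p<?m. \<Sum>q<?m. if q = a then if p = b then S $$ (b, a) else 0 else 0)"
      by (intro sum.cong) (auto simp: ab)
    then show "(\<Sum>p<?m. \<Sum>q<?m. of_bool (r = (q, p)) * S $$ (p, q)) = S $$ (snd r, fst r)"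
      using r ab by simp
  qed
  have "mat_pairing ?m (basic_form G n D \<phi>) S = (\<Sum>p<?m. \<Sum>q<?m. \<Sum>\<alpha>\<in>D.
      - form_sign G * \<phi> \<alpha> * (of_bool (root_pair G n \<alpha> = (p, q)) * S $$ (p, q) +
        form_sign G * (of_bool (root_pair G n \<alpha> = (q, p)) * S $$ (p, q))))"
    unfolding mat_pairing_def basic_form_def
  proof (intro sum.cong refl)
    fix p q assume "p \<in> {..<?m}" "q \<in> {..<?m}"
    then have "mat ?m ?m (\<lambda>(p, q). basic_coeff G n D \<phi> p q) $$ (p, q) = basic_coeff G n D \<phi> p q" by simp
    then show "mat ?m ?m (\<lambda>(p, q). basic_coeff G n D \<phi> p q) $$ (p, q) * S $$ (p, q) = (\<Sum>\<alpha>\<in>D.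
      - form_sign G * \<phi> \<alpha> * (of_bool (root_pair G n \<alpha> = (p, q)) * S $$ (p, q) +
        form_sign G * (of_bool (root_pair G n \<alpha> = (q, p)) * S $$ (p, q))))"
      by (simp only: basic_coeff_def sum_distrib_right distrib_right distrib_left mult.assoc)
  qed
  also have "\<dots> = (\<Sum>p<?m. \<Sum>\<alpha>\<in>D. \<Sum>q<?m.
      - form_sign G * \<phi> \<alpha> * (of_bool (root_pair G n \<alpha> = (p, q)) * S $$ (p, q) +
        form_sign G * (of_bool (root_pair G n \<alpha> = (q, p)) * S $$ (p, q))))"
    by (rule sum.cong[OF refl], rule sum.swap)
  also have "\<dots> = (\<Sum>\<alpha>\<in>D. \<Sum>p<?m. \<Sum>q<?m.
      - form_sign G * \<phi> \<alpha> * (of_bool (root_pair G n \<alpha> = (p, q)) * S $$ (p, q) +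
        form_sign G * (of_bool (root_pair G n \<alpha> = (q, p)) * S $$ (p, q))))"
    by (rule sum.swap)
  also have "\<dots> = (\<Sum>\<alpha>\<in>D. - 2 * form_sign G * \<phi> \<alpha> * S $$ root_pair G n \<alpha>)"
  proof (rule sum.cong[OF refl])
    fix \<alpha> assume "\<alpha> \<in> D"
    then have r: "\<alpha> \<in> roots G n" using D by blast
    obtain a b where ab: "root_pair G n \<alpha> = (a, b)" by (cases "root_pair G n \<alpha>")
    have lt: "fst (root_pair G n \<alpha>) < ?m" "snd (root_pair G n \<alpha>) < ?m"
      using root_pair_bounds(1,2)[OF r ab] ab by auto
    have sw: "S $$ (snd (root_pair G n \<alpha>), fst (root_pair G n \<alpha>)) = form_sign G * S $$ root_pair G n \<alpha>"
      using lie_formsD(2)[OF S lt] by simp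
    have "(\<Sum>p<?m. \<Sum>q<?m. - form_sign G * \<phi> \<alpha> * (of_bool (root_pair G n \<alpha> = (p, q)) * S $$ (p, q) +
        form_sign G * (of_bool (root_pair G n \<alpha> = (q, p)) * S $$ (p, q)))) =
      - form_sign G * \<phi> \<alpha> * ((\<Sum>p<?m. \<Sum>q<?m. of_bool (root_pair G n \<alpha> = (p, q)) * S $$ (p, q)) +
        form_sign G * (\<Sum>p<?m. \<Sum>q<?m. of_bool (root_pair G n \<alpha> = (q, p)) * S $$ (p, q)))"
      by (simp only: sum_distrib_left[symmetric] sum.distrib)
    also have "\<dots> = - form_sign G * \<phi> \<alpha> * (S $$ root_pair G n \<alpha> + form_sign G * (form_sign G * S $$ root_pair G n \<alpha>))"
      unfolding delta[OF lt] sw ..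
    also have "\<dots> = - 2 * form_sign G * \<phi> \<alpha> * S $$ root_pair G n \<alpha>"
      by (simp add: form_sign_def)
    finally show "(\<Sum>p<?m. \<Sum>q<?m. - form_sign G * \<phi> \<alpha> * (of_bool (root_pair G n \<alpha> = (p, q)) * S $$ (p, q) +
        form_sign G * (of_bool (root_pair G n \<alpha> = (q, p)) * S $$ (p, q)))) =
      - 2 * form_sign G * \<phi> \<alpha> * S $$ root_pair G n \<alpha>" .
  qed
  finally show ?thesis .
qed

text \<open>Elimination is carried out on the full matrix and its result read in the region alone.
  Entries of \<open>M\<close> outside the region may be discarded by
  \<open>congruence_region\<close>.\<close>

lemma basic_form_exists:
  fixes C :: "'a::field mat"
  assumes two: "(2::'a) \<noteq> 0" and C: "C \<in> lie_forms G n"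
  obtains g D \<phi> where "g \<in> unitri (msize G n)" "basic_pair G n D (\<phi> :: root \<Rightarrow> 'a)"
    "\<And>p q. p < msize G n \<Longrightarrow> q < msize G n \<Longrightarrow> msize G n \<le> p + q \<Longrightarrow>
      C $$ (p, q) = (g * basic_form G n D \<phi> * transpose_mat g) $$ (p, q)"
proof -
  let ?m = "msize G n"
  let ?e = "form_sign G :: 'a"
  have e: "?e = 1 \<or> ?e = - 1" and ee: "?e * ?e = 1" and e0: "?e \<noteq> 0" by (auto simp: form_sign_def)
  define c where "c i j = (if i < ?m \<and> j < ?m then C $$ (i, j) else 0)" for i j
  have "monomial_form ?e {..<?m} c"
  proof (rule monomial_reduction[OF _ e two])
    show "c j i = ?e * c i j" for i j using lie_formsD(2)[OF C, of i j] by (simp add: c_def)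
    show "c i j = 0" if "i \<notin> {..<?m}" for i j using that by (simp add: c_def)
  qed simp
  then show ?thesis
  proof cases
    case (monomial_formI h M)
    note h = this(1) and Msym = this(2) and M0 = this(3) and Mrow = this(4) and cM = this(5)
    define g where "g = mat ?m ?m (\<lambda>(i, k). h k i)"
    have g: "g \<in> unitri ?m" using h by (intro unitriI) (auto simp: g_def)
    have M0': "M i j = 0" if "\<not> j < ?m" for i j
    proof -
      have "M j i = 0" using M0[of j i] that by simp
      then show ?thesis using Msym[of i j] by simp
    qed
    define D where "D = {\<alpha> \<in> roots G n. M (fst (root_pair G n \<alpha>)) (snd (root_pair G n \<alpha>)) \<noteq> 0}"
    \<comment> \<open>Solves \<open>basic_coeff_root\<close> for the value of the map: the sign is
      its own inverse, and a diagonal place counts twice.\<close>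
    define \<phi> where "\<phi> = restrict (\<lambda>\<alpha>. - ?e * M (fst (root_pair G n \<alpha>)) (snd (root_pair G n \<alpha>)) /
      (if fst (root_pair G n \<alpha>) = snd (root_pair G n \<alpha>) then 2 else 1)) D"
    have DR: "D \<subseteq> roots G n" by (auto simp: D_def)
    have supp: "M p q \<noteq> 0" if pq: "(p, q) \<in> pair_support G n D" for p q
    proof -
      obtain \<alpha> where "\<alpha> \<in> D" "root_pair G n \<alpha> = (p, q) \<or> root_pair G n \<alpha> = (q, p)"
        using pq unfolding pair_support_def by blast
      then have "M p q \<noteq> 0 \<or> M q p \<noteq> 0" by (auto simp: D_def)
      then show ?thesis using Msym[of p q] e0 by auto
    qed
    have "basic_set G n D"
      unfolding basic_set_iff
    proof (intro conjI allI impI DR)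
      fix p q q' assume "(p, q) \<in> pair_support G n D" "(p, q') \<in> pair_support G n D"
      from this[THEN supp] show "q = q'" by (rule Mrow)
    qed
    moreover have "\<phi> \<in> D \<rightarrow>\<^sub>E UNIV - {0}"
      unfolding \<phi>_def using two e0 by (auto simp: D_def)
    ultimately have bp: "basic_pair G n D \<phi>" by (simp add: basic_pair_def)
    have coeff: "basic_coeff G n D \<phi> p q = M p q" if pq: "M p q \<noteq> 0" "q \<le> p" "p < ?m" "?m \<le> p + q" for p q
    proof -
      \<comment> \<open>A nonzero diagonal entry excludes the skew case, so such a place does belong
        to a root.\<close>
      have "G = Sp" if "p = q"
      proof (rule ccontr)
        assume "G \<noteq> Sp"
        then have "M p p = - M p p" using Msym[of p p] by (simp add: form_sign_def)
        then have "2 * M p p = 0" unfolding eq_neg_iff_add_eq_0 mult_2 .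
        then show False using two pq(1) that by simp
      qed
      then obtain \<alpha> where \<alpha>: "\<alpha> \<in> roots G n" "root_pair G n \<alpha> = (p, q)"
        using root_pair_surj[OF pq(3,2,4)] by blast
      then have "\<alpha> \<in> D" using pq(1) by (simp add: D_def)
      have "\<phi> \<alpha> * (if p = q then 2 else 1) = - ?e * M p q"
        using \<open>\<alpha> \<in> D\<close> \<alpha> two by (simp add: \<phi>_def)
      then have "basic_coeff G n D \<phi> p q = - ?e * (- ?e * M p q)"
        unfolding basic_coeff_root[OF DR \<open>\<alpha> \<in> D\<close> \<alpha>(2)] by (simp only: mult.assoc)
      also have "\<dots> = (?e * ?e) * M p q" by (simp only: mult.assoc minus_mult_left[symmetric] minus_mult_right[symmetric] minus_minus)
      finally show ?thesis using ee by simp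
    qed
    have coeff': "basic_coeff G n D \<phi> p q = M p q" if pq: "p < ?m" "q < ?m" "?m \<le> p + q" for p q
    proof (cases "M p q = 0")
      case True
      then show ?thesis using basic_coeff_support[of G n D \<phi> p q] supp[of p q] by metis
    next
      case False
      show ?thesis
      proof (cases "q \<le> p")
        case True
        then show ?thesis using coeff[OF False True] pq by simp
      next
        case qp: False
        have "M q p \<noteq> 0" using Msym[of q p] Msym[of p q] False by auto
        then have "basic_coeff G n D \<phi> q p = M q p" using coeff[of q p] qp pq by simp
        then show ?thesis unfolding basic_coeff_sym[of G n D \<phi> p q] by (simp add: Msym[where i = q and j = p])
      qed
    qed
    have "C $$ (p, q) = (g * basic_form G n D \<phi> * transpose_mat g) $$ (p, q)"
      if pq: "p < ?m" "q < ?m" "?m \<le> p + q" for p q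
    proof -
      define N where "N = mat ?m ?m (\<lambda>(i, j). M i j)"
      have gc: "g \<in> carrier_mat ?m ?m" by (rule unitriD(1)[OF g])
      have "C $$ (p, q) = (\<Sum>k<?m. \<Sum>l<?m. M k l * h k p * h l q)"
        using cM[of p q] pq by (simp add: c_def)
      also have "\<dots> = (g * N * transpose_mat g) $$ (p, q)"
        by (subst index_mult_triple[of _ ?m])
          (use pq gc in \<open>auto simp: N_def g_def mult_ac intro!: sum.cong\<close>)
      also have "\<dots> = (g * basic_form G n D \<phi> * transpose_mat g) $$ (p, q)"
        by (rule congruence_region[OF _ _ g g _ pq]) (use coeff' in \<open>auto simp: N_def basic_form_def\<close>)
      finally show ?thesis .
    qed
    then show ?thesis using that[OF g bp] by blast
  qed
qed

text \<open>Multiplying by the inverse \<open>p\<close> of \<open>h\<close> on the left and the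
  transposed inverse \<open>q\<close> of \<open>g\<close> on the right gives
  \<open>p g C = C' (q h)^T\<close> in the region, which is the hypothesis of
  \<open>monomial_rigid\<close>.\<close>

lemma basic_form_unique:
  fixes \<phi> \<phi>' :: "root \<Rightarrow> 'a::field"
  assumes two: "(2::'a) \<noteq> 0" and D: "basic_pair G n D \<phi>" and D': "basic_pair G n D' \<phi>'"
    and g: "g \<in> unitri (msize G n)" and h: "h \<in> unitri (msize G n)"
    and eq: "\<And>p q. p < msize G n \<Longrightarrow> q < msize G n \<Longrightarrow> msize G n \<le> p + q \<Longrightarrow>
      (g * basic_form G n D \<phi> * transpose_mat g) $$ (p, q) =
      (h * basic_form G n D' \<phi>' * transpose_mat h) $$ (p, q)"
  shows "D = D' \<and> \<phi> = \<phi>'"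
proof -
  let ?m = "msize G n"
  let ?C = "basic_form G n D \<phi>" and ?C' = "basic_form G n D' \<phi>'"
  have b: "basic_set G n D" "basic_set G n D'" using D D' by (auto simp: basic_pair_def)
  have DR: "D \<subseteq> roots G n" "D' \<subseteq> roots G n" using b by (auto simp: basic_set_iff)
  obtain p where p: "p \<in> unitri ?m" "h * p = 1\<^sub>m ?m" "p * h = 1\<^sub>m ?m" using unitri_inverse[OF h] by metis
  obtain q where q: "q \<in> unitri ?m" "g * q = 1\<^sub>m ?m" "q * g = 1\<^sub>m ?m" using unitri_inverse[OF g] by metis
  note c = unitriD(1)[OF g] unitriD(1)[OF h] unitriD(1)[OF p(1)] unitriD(1)[OF q(1)]
  have t: "transpose_mat x \<in> carrier_mat ?m ?m" if "x \<in> carrier_mat ?m ?m" for x :: "'a mat" using that by simp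
  note as = assoc_mult_mat[of _ ?m ?m _ ?m _ ?m]
  have Cc: "?C \<in> carrier_mat ?m ?m" "?C' \<in> carrier_mat ?m ?m" by (auto simp: basic_form_def)
  have "basic_coeff G n D \<phi> = basic_coeff G n D' \<phi>'"
  proof (rule monomial_rigid[OF unitri_mult[OF p(1) g] unitri_mult[OF q(1) h]])
    show "monomial (basic_coeff G n D \<phi>)" "monomial (basic_coeff G n D' \<phi>')"
      using b by (auto intro: basic_coeff_monomial)
    show "i < ?m \<and> j < ?m \<and> ?m \<le> i + j" if "basic_coeff G n D \<phi> i j \<noteq> 0" for i j
      by (rule basic_coeff_bounds[OF DR(1) that])
    show "i < ?m \<and> j < ?m \<and> ?m \<le> i + j" if "basic_coeff G n D' \<phi>' i j \<noteq> 0" for i j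
      by (rule basic_coeff_bounds[OF DR(2) that])
    fix i j assume ij: "i < ?m" "j < ?m" "?m \<le> i + j"
    have l: "p * (g * ?C * transpose_mat g) * transpose_mat q = p * g * ?C"
    proof -
      have "transpose_mat g * transpose_mat q = 1\<^sub>m ?m"
        unfolding transpose_mult[OF c(4) c(1), symmetric] q by simp
      then show ?thesis using c Cc by (simp add: as)
    qed
    have r: "p * (h * ?C' * transpose_mat h) * transpose_mat q = ?C' * transpose_mat (q * h)"
    proof -
      have "p * (h * ?C' * transpose_mat h) * transpose_mat q = (p * h) * ?C' * (transpose_mat h * transpose_mat q)"
        using c Cc by (simp add: as)
      then show ?thesis unfolding p transpose_mult[OF c(4) c(2)] using Cc by simp
    qed
    have "(p * (g * ?C * transpose_mat g) * transpose_mat q) $$ (i, j) =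
      (p * (h * ?C' * transpose_mat h) * transpose_mat q) $$ (i, j)"
      by (rule congruence_region[OF _ _ p(1) q(1) eq ij]) (use c Cc in auto)
    then have "(p * g * ?C) $$ (i, j) = (?C' * transpose_mat (q * h)) $$ (i, j)" unfolding l r .
    moreover have "(p * g * ?C) $$ (i, j) = (\<Sum>k<?m. (p * g) $$ (i, k) * basic_coeff G n D \<phi> k j)"
      unfolding index_mult[OF mult_carrier_mat[OF c(3) c(1)] Cc(1) ij(1,2)]
      by (intro sum.cong refl) (use ij in \<open>simp add: basic_form_def\<close>)
    moreover have "(?C' * transpose_mat (q * h)) $$ (i, j) = (\<Sum>k<?m. basic_coeff G n D' \<phi>' i k * (q * h) $$ (j, k))"
      unfolding index_mult[OF Cc(2) t[OF mult_carrier_mat[OF c(4) c(2)]] ij(1,2)]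
      by (intro sum.cong refl) (use ij c in \<open>auto simp: basic_form_def simp del: index_mult_mat(1)\<close>)
    ultimately show "(\<Sum>k<?m. (p * g) $$ (i, k) * basic_coeff G n D \<phi> k j) =
      (\<Sum>k<?m. basic_coeff G n D' \<phi>' i k * (q * h) $$ (j, k))" by simp
  qed
  then have eqc: "basic_coeff G n D \<phi> i j = basic_coeff G n D' \<phi>' i j" for i j by simp
  \<comment> \<open>Stated for arbitrary pairs because it is used in both directions. A nonzero
    coefficient at the place of \<open>\<alpha>\<close> forces a root of the other set at the same
    place.\<close>
  have step: "\<alpha> \<in> D2 \<and> \<phi>1 \<alpha> = \<phi>2 \<alpha>"
    if D1: "basic_pair G n D1 \<phi>1" and D2: "basic_pair G n D2 \<phi>2" and \<alpha>: "\<alpha> \<in> D1"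
      and eqc: "\<And>i j. basic_coeff G n D1 \<phi>1 i j = basic_coeff G n D2 \<phi>2 i j"
    for D1 D2 and \<phi>1 \<phi>2 :: "root \<Rightarrow> 'a" and \<alpha>
  proof -
    have R: "D1 \<subseteq> roots G n" "D2 \<subseteq> roots G n" using D1 D2 by (auto simp: basic_pair_def basic_set_iff)
    obtain a b where ab: "root_pair G n \<alpha> = (a, b)" by (cases "root_pair G n \<alpha>")
    have nz: "\<phi>1 \<alpha> \<noteq> 0" using D1 \<alpha> by (auto simp: basic_pair_def)
    note v = basic_coeff_root[OF R(1) \<alpha> ab, of \<phi>1]
    have "basic_coeff G n D1 \<phi>1 a b \<noteq> 0" unfolding v using nz two by (auto simp: form_sign_def)
    then have "(a, b) \<in> pair_support G n D2" unfolding eqc by (rule basic_coeff_support)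
    then obtain \<beta> where \<beta>: "\<beta> \<in> D2" "root_pair G n \<beta> = (a, b) \<or> root_pair G n \<beta> = (b, a)"
      unfolding pair_support_def by blast
    have "\<alpha> = \<beta>" by (rule root_pair_same[OF _ _ ab \<beta>(2)]) (use R \<alpha> \<beta> in auto)
    then have \<alpha>2: "\<alpha> \<in> D2" using \<beta> by simp
    have "- form_sign G * \<phi>1 \<alpha> * (if a = b then 2 else 1) = - form_sign G * \<phi>2 \<alpha> * (if a = b then 2 else (1::'a))"
      using eqc[of a b] unfolding v basic_coeff_root[OF R(2) \<alpha>2 ab, of \<phi>2] .
    moreover have "form_sign G \<noteq> (0::'a)" by (simp add: form_sign_def)
    ultimately have "\<phi>1 \<alpha> = \<phi>2 \<alpha>" using two by (cases "a = b") simp_all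
    then show ?thesis using \<alpha>2 by blast
  qed
  have DD: "D = D'"
    using step[OF D D' _ eqc] step[OF D' D _ eqc[symmetric]] by blast
  have "\<phi> = \<phi>'"
  proof (rule PiE_ext)
    show "\<phi> \<in> D \<rightarrow>\<^sub>E UNIV - {0}" "\<phi>' \<in> D \<rightarrow>\<^sub>E UNIV - {0}" using D D' DD by (auto simp: basic_pair_def)
    show "\<phi> \<alpha> = \<phi>' \<alpha>" if "\<alpha> \<in> D" for \<alpha> using step[OF D D' that eqc] by blast
  qed
  with DD show ?thesis by blast
qed

section \<open>Supercharacters\<close>

context
  fixes G :: family and n :: nat and \<theta> :: "'a::{field,finite} \<Rightarrow> complex"
  assumes two: "(2::'a) \<noteq> 0" and nt: "nontrivial_additive_character \<theta>"
begin

text \<open>The product of the indices of the root subgroups is the degree of the supercharacter, as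
  \<open>supercharacter_one\<close> confirms.\<close>

definition root_index_prod :: "root set \<Rightarrow> complex" where
  "root_index_prod D = (\<Prod>\<alpha>\<in>D. of_nat (card (unip G n :: 'a mat set)) /
     of_nat (card (root_subgroup G n \<alpha> :: 'a mat set)))"

lemma card_unitri_nonzero: "(of_nat (card (unitri k :: 'a mat set)) :: complex) \<noteq> 0"
  using finite_unitri[where 'a = 'a] unitri_one[of k, where 'a = 'a] by (auto simp: card_eq_0_iff)

lemma one_in_unip: "1\<^sub>m (msize G n) \<in> (unip G n :: 'a mat set)"
  using group.is_monoid[OF unip_group[of G n, where 'a = 'a], THEN monoid.one_closed]
  by (simp add: unip_group_def)

lemma root_index_prod_nonzero:
  assumes "D \<subseteq> roots G n"
  shows "root_index_prod D \<noteq> 0"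
proof -
  have U: "card (unip G n :: 'a mat set) \<noteq> 0"
    using finite_unip[where 'a = 'a] one_in_unip by (auto simp: card_eq_0_iff)
  have H: "card (root_subgroup G n \<alpha> :: 'a mat set) \<noteq> 0" if "\<alpha> \<in> D" for \<alpha>
  proof -
    obtain a b where ab: "root_pair G n \<alpha> = (a, b)" by (cases "root_pair G n \<alpha>")
    have \<alpha>: "\<alpha> \<in> roots G n" using that assms by blast
    have "1\<^sub>m (msize G n) \<in> (root_subgroup G n \<alpha> :: 'a mat set)"
      using subgroup.one_closed[OF root_subgroup_subgroup[OF \<alpha> ab, where 'a = 'a]] by (simp add: unip_group_def)
    moreover have "finite (root_subgroup G n \<alpha> :: 'a mat set)"
      using finite_unip by (rule finite_subset[rotated]) (auto simp: root_subgroup_eq[OF \<alpha> ab])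
    ultimately show ?thesis by (auto simp: card_eq_0_iff)
  qed
  have "finite D" using assms finite_roots finite_subset by blast
  then show ?thesis using U H by (simp add: root_index_prod_def)
qed

text \<open>Independence turns the product of averages into the average of the product, and the
  exponents of the factors then add up to the pairing with \<open>basic_form\<close>.\<close>

lemma supercharacter_orbit_sum:
  assumes D: "basic_pair G n D \<phi>" and x: "x \<in> unip G n"
  shows "supercharacter G n \<theta> D \<phi> x = root_index_prod D / of_nat (card (unitri (msize G n) :: 'a mat set)) *
    orbit_sum \<theta> (msize G n) (basic_form G n D \<phi>) (cayley G n x)"
proof -
  let ?m = "msize G n"
  let ?T = "unitri ?m :: 'a mat set"
  have b: "basic_set G n D" and \<phi>: "\<phi> \<in> D \<rightarrow>\<^sub>E UNIV - {0}" using D by (auto simp: basic_pair_def)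
  have DR: "D \<subseteq> roots G n" using b by (simp add: basic_set_iff)
  have fin: "finite D" using DR finite_roots finite_subset by blast
  define S where "S = cayley G n x"
  have S: "S \<in> lie_forms G n" unfolding S_def using cayley_bij[OF two] x bij_betwE by blast
  define f where "f \<alpha> g = \<theta> (- 2 * form_sign G * \<phi> \<alpha> * form_apply ?m S
    (column g (fst (root_pair G n \<alpha>))) (column g (snd (root_pair G n \<alpha>))))" for \<alpha> g
  have el: "elementary_char G n \<theta> \<alpha> (\<phi> \<alpha>) x =
    of_nat (card (unip G n :: 'a mat set)) / of_nat (card (root_subgroup G n \<alpha> :: 'a mat set)) *
    ((\<Sum>g\<in>?T. f \<alpha> g) / of_nat (card ?T))" if "\<alpha> \<in> D" for \<alpha>
  proof -
    obtain a b where ab: "root_pair G n \<alpha> = (a, b)" by (cases "root_pair G n \<alpha>")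
    have \<alpha>: "\<alpha> \<in> roots G n" using that DR by blast
    have "\<phi> \<alpha> \<noteq> 0" using \<phi> that by auto
    from elementary_char_average[OF \<alpha> ab two nt x this] show ?thesis
      by (simp add: f_def ab S_def)
  qed
  have "supercharacter G n \<theta> D \<phi> x = root_index_prod D * (\<Prod>\<alpha>\<in>D. (\<Sum>g\<in>?T. f \<alpha> g) / of_nat (card ?T))"
    unfolding supercharacter_def root_index_prod_def prod.distrib[symmetric]
    by (rule prod.cong[OF refl]) (rule el)
  also have "(\<Prod>\<alpha>\<in>D. (\<Sum>g\<in>?T. f \<alpha> g) / of_nat (card ?T)) = (\<Sum>g\<in>?T. \<Prod>\<alpha>\<in>D. f \<alpha> g) / of_nat (card ?T)"
  proof (rule prod_sum_unitri[OF fin])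
    fix \<alpha> assume \<alpha>: "\<alpha> \<in> D"
    obtain a b where ab: "root_pair G n \<alpha> = (a, b)" by (cases "root_pair G n \<alpha>")
    have lt: "a < ?m" "b < ?m" using root_pair_bounds(1,2)[OF subsetD[OF DR \<alpha>] ab] by simp_all
    show "depends_on_columns ?m (root_columns G n \<alpha>) (f \<alpha>)"
      unfolding depends_on_columns_def
    proof (intro ballI impI)
      fix g h :: "'a mat" assume "\<forall>i<?m. \<forall>j<?m. j \<in> root_columns G n \<alpha> \<longrightarrow> g $$ (i, j) = h $$ (i, j)"
      then have "form_apply ?m S (column g a) (column g b) = form_apply ?m S (column h a) (column h b)"
        using lt by (intro form_apply_cong) (auto simp: root_columns_def ab)
      then show "f \<alpha> g = f \<alpha> h" by (simp add: f_def ab)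
    qed
  next
    show "root_columns G n \<alpha> \<inter> root_columns G n \<beta> = {}" if "\<alpha> \<in> D" "\<beta> \<in> D" "\<alpha> \<noteq> \<beta>" for \<alpha> \<beta>
      by (rule basic_set_columns[OF b that])
  qed
  also have "(\<Sum>g\<in>?T. \<Prod>\<alpha>\<in>D. f \<alpha> g) = orbit_sum \<theta> ?m (basic_form G n D \<phi>) S"
    unfolding orbit_sum_def[OF two nt]
  proof (rule sum.cong[OF refl])
    fix g assume g: "g \<in> ?T"
    have "(\<Prod>\<alpha>\<in>D. f \<alpha> g) = \<theta> (\<Sum>\<alpha>\<in>D. - 2 * form_sign G * \<phi> \<alpha> * (transpose_mat g * S * g) $$ root_pair G n \<alpha>)"
      unfolding additive_character_sum[OF nt]
    proof (rule prod.cong[OF refl])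
      fix \<alpha> assume \<alpha>: "\<alpha> \<in> D"
      obtain a b where ab: "root_pair G n \<alpha> = (a, b)" by (cases "root_pair G n \<alpha>")
      have lt: "a < ?m" "b < ?m" using root_pair_bounds(1,2)[OF subsetD[OF DR \<alpha>] ab] by simp_all
      show "f \<alpha> g = \<theta> (- 2 * form_sign G * \<phi> \<alpha> * (transpose_mat g * S * g) $$ root_pair G n \<alpha>)"
        unfolding ab f_def fst_conv snd_conv congruence_index[OF unitriD(1)[OF g] lie_formsD(1)[OF S] lt] ..
    qed
    then show "(\<Prod>\<alpha>\<in>D. f \<alpha> g) = \<theta> (mat_pairing ?m (basic_form G n D \<phi>) (transpose_mat g * S * g))"
      unfolding basic_form_pairing[OF lie_forms_congruence[OF S g] DR] .
  qed
  finally show ?thesis unfolding S_def by simp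
qed

lemma positive_type_supercharacter:
  assumes "basic_pair G n D \<phi>"
  shows "positive_type (unip_group G n) (supercharacter G n \<theta> D \<phi>)"
proof -
  have DR: "D \<subseteq> roots G n" using assms by (simp add: basic_pair_def basic_set_iff)
  then have fin: "finite D" using finite_roots finite_subset by blast
  have "positive_type (unip_group G n) (\<lambda>x. \<Prod>\<alpha>\<in>D. elementary_char G n \<theta> \<alpha> (\<phi> \<alpha>) x)"
  proof (rule positive_type_prod[OF fin])
    fix \<alpha> assume "\<alpha> \<in> D"
    then have "\<alpha> \<in> roots G n" using DR by blast
    then show "positive_type (unip_group G n) (elementary_char G n \<theta> \<alpha> (\<phi> \<alpha>))"
      by (rule positive_type_elementary[OF _ prod.collapse[symmetric] two nt])
  qed
  then show ?thesis by (simp add: supercharacter_def[abs_def])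
qed

lemma supercharacter_one:
  assumes "basic_pair G n D \<phi>"
  shows "supercharacter G n \<theta> D \<phi> (1\<^sub>m (msize G n)) = root_index_prod D"
  unfolding supercharacter_orbit_sum[OF assms one_in_unip] cayley_one[OF two] orbit_sum_zero[OF two nt]
  using card_unitri_nonzero by simp

section \<open>Orthogonality, the regular character and convolution\<close>

lemma basic_form_sym:
  fixes \<phi> :: "root \<Rightarrow> 'a"
  assumes "i < msize G n" "j < msize G n"
  shows "basic_form G n D \<phi> $$ (j, i) = form_sign G * basic_form G n D \<phi> $$ (i, j)"
  using assms basic_coeff_sym[of G n D \<phi> j i] by (simp add: basic_form_def)

lemma supercharacter_orthogonal:
  assumes D: "basic_pair G n D \<phi>" and D': "basic_pair G n D' \<phi>'" and ne: "(D, \<phi>) \<noteq> (D', \<phi>')"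
  shows "(\<Sum>x\<in>unip G n. supercharacter G n \<theta> D \<phi> x * cnj (supercharacter G n \<theta> D' \<phi>' x)) = 0"
proof -
  let ?m = "msize G n"
  define k where "k = root_index_prod D / of_nat (card (unitri ?m :: 'a mat set)) *
    cnj (root_index_prod D' / of_nat (card (unitri ?m :: 'a mat set)))"
  let ?O = "\<lambda>S. orbit_sum \<theta> ?m (basic_form G n D \<phi>) S * cnj (orbit_sum \<theta> ?m (basic_form G n D' \<phi>') S)"
  have "(\<Sum>x\<in>unip G n. supercharacter G n \<theta> D \<phi> x * cnj (supercharacter G n \<theta> D' \<phi>' x)) =
    (\<Sum>x\<in>unip G n. k * ?O (cayley G n x))"
    by (intro sum.cong refl)
      (simp add: supercharacter_orbit_sum[OF D] supercharacter_orbit_sum[OF D'] k_def)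
  also have "\<dots> = k * (\<Sum>S\<in>lie_forms G n. ?O S)"
    unfolding sum_distrib_left using sum.reindex_bij_betw[OF cayley_bij[OF two], of "\<lambda>S. k * ?O S"] .
  also have "(\<Sum>S\<in>lie_forms G n. ?O S) = 0"
  proof (rule orbit_sum_orthogonal[OF two nt])
    show "basic_form G n D \<phi> \<in> carrier_mat ?m ?m" "basic_form G n D' \<phi>' \<in> carrier_mat ?m ?m"
      by (auto simp: basic_form_def)
    show "basic_form G n D \<phi> $$ (j, i) = form_sign G * basic_form G n D \<phi> $$ (i, j)"
      "basic_form G n D' \<phi>' $$ (j, i) = form_sign G * basic_form G n D' \<phi>' $$ (i, j)"
      if "i < ?m" "j < ?m" for i j
      using that by (rule basic_form_sym)+
    show "\<exists>p<?m. \<exists>q<?m. ?m \<le> p + q \<and>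
        (g * basic_form G n D \<phi> * transpose_mat g) $$ (p, q) \<noteq> (h * basic_form G n D' \<phi>' * transpose_mat h) $$ (p, q)"
      if "g \<in> unitri ?m" "h \<in> unitri ?m" for g h
      using basic_form_unique[OF two D D' that] ne by blast
  qed
  finally show ?thesis by simp
qed

text \<open>The sum runs over all functionals \<open>C\<close>, each replaced by a basic pair of its
  orbit. The repetitions supply the correct positive weights, so neither the set of basic pairs nor
  the orbit sizes have to be described.\<close>

lemma regular_decomposition:
  obtains B :: "'a mat set" and E :: "'a mat \<Rightarrow> root set" and \<psi> :: "'a mat \<Rightarrow> root \<Rightarrow> 'a"
  where "finite B" "\<And>C. C \<in> B \<Longrightarrow> basic_pair G n (E C) (\<psi> C)"
    "\<And>x. x \<in> unip G n \<Longrightarrow> (\<Sum>C\<in>B. supercharacter G n \<theta> (E C) (\<psi> C) x / root_index_prod (E C)) =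
      of_nat (card B) * of_bool (x = 1\<^sub>m (msize G n))"
    "B \<noteq> {}"
proof -
  let ?m = "msize G n"
  let ?T = "unitri ?m :: 'a mat set"
  let ?L = "lie_forms G n :: 'a mat set"
  have "\<exists>D \<phi>. basic_pair G n D (\<phi> :: root \<Rightarrow> 'a) \<and>
    (\<forall>S\<in>?L. orbit_sum \<theta> ?m C S = orbit_sum \<theta> ?m (basic_form G n D \<phi>) S)" if C: "C \<in> ?L" for C
  proof (rule basic_form_exists[OF two C])
    fix g D \<phi>
    assume g: "g \<in> ?T" "basic_pair G n D (\<phi> :: root \<Rightarrow> 'a)"
      and eq: "\<And>p q. p < ?m \<Longrightarrow> q < ?m \<Longrightarrow> ?m \<le> p + q \<Longrightarrow>
        C $$ (p, q) = (g * basic_form G n D \<phi> * transpose_mat g) $$ (p, q)"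
    have "orbit_sum \<theta> ?m C S = orbit_sum \<theta> ?m (basic_form G n D \<phi>) S" if "S \<in> ?L" for S
      by (rule orbit_sum_congruence[OF two nt that _ g(1) eq]) (simp add: basic_form_def)
    then show ?thesis using g(2) by blast
  qed
  then obtain E \<psi> where E: "\<And>C. C \<in> ?L \<Longrightarrow> basic_pair G n (E C) (\<psi> C :: root \<Rightarrow> 'a)"
    and orb: "\<And>C S. C \<in> ?L \<Longrightarrow> S \<in> ?L \<Longrightarrow>
      orbit_sum \<theta> ?m C S = orbit_sum \<theta> ?m (basic_form G n (E C) (\<psi> C)) S"
    by metis
  have zero: "0\<^sub>m ?m ?m \<in> ?L" by (rule lie_formsI) auto
  have "(\<Sum>C\<in>?L. supercharacter G n \<theta> (E C) (\<psi> C) x / root_index_prod (E C)) =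
    of_nat (card ?L) * of_bool (x = 1\<^sub>m ?m)" if x: "x \<in> unip G n" for x
  proof -
    have S: "cayley G n x \<in> ?L" using cayley_bij[OF two] x bij_betwE by blast
    have "supercharacter G n \<theta> (E C) (\<psi> C) x / root_index_prod (E C) =
      orbit_sum \<theta> ?m C (cayley G n x) / of_nat (card ?T)" if C: "C \<in> ?L" for C
    proof -
      have "root_index_prod (E C) \<noteq> 0"
        using E[OF C] by (intro root_index_prod_nonzero) (simp add: basic_pair_def basic_set_iff)
      then show ?thesis
        unfolding supercharacter_orbit_sum[OF E[OF C] x] orb[OF C S] by simp
    qed
    then have "(\<Sum>C\<in>?L. supercharacter G n \<theta> (E C) (\<psi> C) x / root_index_prod (E C)) =
      (\<Sum>C\<in>?L. orbit_sum \<theta> ?m C (cayley G n x)) / of_nat (card ?T)"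
      unfolding sum_divide_distrib by (intro sum.cong) auto
    also have "\<dots> = of_nat (card ?L) * of_bool (cayley G n x = 0\<^sub>m ?m ?m)"
      unfolding sum_orbit_sum[OF two nt S] using card_unitri_nonzero by simp
    also have "cayley G n x = 0\<^sub>m ?m ?m \<longleftrightarrow> x = 1\<^sub>m ?m"
      using bij_betw_imp_inj_on[OF cayley_bij[OF two]] cayley_one[OF two] x one_in_unip
      by (metis inj_onD)
    finally show ?thesis .
  qed
  then show ?thesis using that[of ?L E \<psi>] finite_lie_forms E zero by blast
qed

text \<open>The combination from \<open>regular_decomposition\<close> is a multiple of the identity
  for convolution. Convolving \<open>\<xi>\<close> with it leaves only the terms belonging to
  \<open>(D, \<phi>)\<close>, so \<open>\<xi>\<close> is proportional to its convolution square, and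
  evaluation at the identity finds the constant.\<close>

lemma supercharacter_convolution:
  assumes D: "basic_pair G n D \<phi>" and D': "basic_pair G n D' \<phi>'"
  defines "U \<equiv> unip_group G n :: 'a mat monoid"
    and "\<xi> \<equiv> supercharacter G n \<theta> D \<phi>"
    and "\<xi>' \<equiv> supercharacter G n \<theta> D' \<phi>'"
  assumes z: "z \<in> carrier U"
  shows "convolution U \<xi> \<xi>' z = of_bool (D = D') * of_bool (\<phi> = \<phi>') *
    (of_nat (card (carrier U)) * frobenius_prod U \<xi> \<xi> / \<xi> \<one>\<^bsub>U\<^esub>) * \<xi> z"
proof (cases "(D, \<phi>) = (D', \<phi>')")
  case False
  interpret U: group U unfolding U_def by (rule unip_group)
  have car: "carrier U = unip G n" by (simp add: U_def unip_group_def)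
  have fin: "finite (carrier U)" unfolding car by (rule finite_unip)
  have "(\<Sum>x\<in>carrier U. \<xi> x * \<xi>' (z \<otimes>\<^bsub>U\<^esub> inv\<^bsub>U\<^esub> x)) = 0"
    by (rule U.convolution_zero[OF fin _ _ _ z])
      (use positive_type_supercharacter[OF D] positive_type_supercharacter[OF D']
        supercharacter_orthogonal[OF D D' False] in \<open>simp_all add: U_def \<xi>_def \<xi>'_def unip_group_def\<close>)
  then show ?thesis using False by (auto simp: convolution_def)
next
  case True
  interpret U: group U unfolding U_def by (rule unip_group)
  have car: "carrier U = unip G n" and one: "\<one>\<^bsub>U\<^esub> = 1\<^sub>m (msize G n)" by (simp_all add: U_def unip_group_def)
  have fin: "finite (carrier U)" unfolding car by (rule finite_unip)
  have DR: "D \<subseteq> roots G n" using D by (simp add: basic_pair_def basic_set_iff)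
  show ?thesis
  proof (rule regular_decomposition)
    fix B :: "'a mat set" and E :: "'a mat \<Rightarrow> root set" and \<psi> :: "'a mat \<Rightarrow> root \<Rightarrow> 'a"
    assume B: "finite B" "\<And>C. C \<in> B \<Longrightarrow> basic_pair G n (E C) (\<psi> C)"
      and reg: "\<And>x. x \<in> unip G n \<Longrightarrow> (\<Sum>C\<in>B. supercharacter G n \<theta> (E C) (\<psi> C) x / root_index_prod (E C)) =
        of_nat (card B) * of_bool (x = 1\<^sub>m (msize G n))" "B \<noteq> {}"
    \<comment> \<open>The total weight of \<open>(D, \<phi>)\<close> in the decomposition. It is
      never computed: it is nonzero because \<open>\<xi>\<close> does not vanish at the identity,
      and it cancels in the end.\<close>
    define k where "k = (\<Sum>C\<in>B. if (D, \<phi>) = (E C, \<psi> C) then 1 / root_index_prod D else 0)"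
    have conv: "of_nat (card B) * \<xi> y = k * convolution U \<xi> \<xi> y" if y: "y \<in> carrier U" for y
    proof -
      have "of_nat (card B) * \<xi> y = (\<Sum>x\<in>carrier U. if x = y then of_nat (card B) * \<xi> x else 0)"
        using fin y by simp
      also have "\<dots> = (\<Sum>x\<in>carrier U. \<xi> x * (\<Sum>C\<in>B. supercharacter G n \<theta> (E C) (\<psi> C) (y \<otimes>\<^bsub>U\<^esub> inv\<^bsub>U\<^esub> x) / root_index_prod (E C)))"
      proof (rule sum.cong[OF refl])
        fix x assume x: "x \<in> carrier U"
        have yx: "y \<otimes>\<^bsub>U\<^esub> inv\<^bsub>U\<^esub> x \<in> unip G n" using x y U.m_closed U.inv_closed unfolding car by metis
        have "y \<otimes>\<^bsub>U\<^esub> inv\<^bsub>U\<^esub> x = 1\<^sub>m (msize G n) \<longleftrightarrow> x = y"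
          using U.inv_solve_right'[of "\<one>\<^bsub>U\<^esub>" y x] x y unfolding one[symmetric] by auto
        then show "(if x = y then of_nat (card B) * \<xi> x else 0) =
          \<xi> x * (\<Sum>C\<in>B. supercharacter G n \<theta> (E C) (\<psi> C) (y \<otimes>\<^bsub>U\<^esub> inv\<^bsub>U\<^esub> x) / root_index_prod (E C))"
          unfolding reg(1)[OF yx] by simp
      qed
      also have "\<dots> = (\<Sum>C\<in>B. (\<Sum>x\<in>carrier U. \<xi> x * supercharacter G n \<theta> (E C) (\<psi> C) (y \<otimes>\<^bsub>U\<^esub> inv\<^bsub>U\<^esub> x)) / root_index_prod (E C))"
        unfolding sum_distrib_left sum_divide_distrib by (subst sum.swap) simp
      also have "\<dots> = (\<Sum>C\<in>B. (if (D, \<phi>) = (E C, \<psi> C) then 1 / root_index_prod D else 0) * convolution U \<xi> \<xi> y)"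
      proof (rule sum.cong[OF refl])
        fix C assume C: "C \<in> B"
        show "(\<Sum>x\<in>carrier U. \<xi> x * supercharacter G n \<theta> (E C) (\<psi> C) (y \<otimes>\<^bsub>U\<^esub> inv\<^bsub>U\<^esub> x)) / root_index_prod (E C) =
          (if (D, \<phi>) = (E C, \<psi> C) then 1 / root_index_prod D else 0) * convolution U \<xi> \<xi> y"
        proof (cases "(D, \<phi>) = (E C, \<psi> C)")
          case True
          then show ?thesis by (auto simp: convolution_def \<xi>_def)
        next
          case False
          have "(\<Sum>x\<in>carrier U. \<xi> x * supercharacter G n \<theta> (E C) (\<psi> C) (y \<otimes>\<^bsub>U\<^esub> inv\<^bsub>U\<^esub> x)) = 0"
            by (rule U.convolution_zero[OF fin _ _ _ y])
              (use positive_type_supercharacter[OF D] positive_type_supercharacter[OF B(2)[OF C]]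
                supercharacter_orthogonal[OF D B(2)[OF C] False] in \<open>simp_all add: U_def \<xi>_def unip_group_def\<close>)
          then show ?thesis unfolding if_not_P[OF False] by simp
        qed
      qed
      also have "\<dots> = k * convolution U \<xi> \<xi> y" by (simp add: k_def sum_distrib_right)
      finally show ?thesis .
    qed
    have \<xi>1: "\<xi> \<one>\<^bsub>U\<^esub> \<noteq> 0"
      unfolding one \<xi>_def supercharacter_one[OF D] by (rule root_index_prod_nonzero[OF DR])
    have B0: "(of_nat (card B) :: complex) \<noteq> 0" using B(1) reg(2) by (simp add: card_eq_0_iff)
    \<comment> \<open>Positive type gives \<open>\<xi> (inv x) = cnj (\<xi> x)\<close>, so at the
      identity the convolution is the scalar product.\<close>
    have conv1: "convolution U \<xi> \<xi> \<one>\<^bsub>U\<^esub> = of_nat (card (carrier U)) * frobenius_prod U \<xi> \<xi>"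
    proof -
      have "\<xi> (inv\<^bsub>U\<^esub> x) = cnj (\<xi> x)" if "x \<in> carrier U" for x
        using positive_type_supercharacter[OF D] that unfolding \<xi>_def U_def[symmetric] by (rule U.positive_type_inv)
      then have "convolution U \<xi> \<xi> \<one>\<^bsub>U\<^esub> = (\<Sum>x\<in>carrier U. \<xi> x * cnj (\<xi> x))"
        unfolding convolution_def by (intro sum.cong) auto
      moreover have "card (carrier U) \<noteq> 0" using fin U.one_closed by (auto simp: card_eq_0_iff)
      ultimately show ?thesis by (simp add: frobenius_prod_def)
    qed
    have e1: "of_nat (card B) * \<xi> \<one>\<^bsub>U\<^esub> = k * (of_nat (card (carrier U)) * frobenius_prod U \<xi> \<xi>)"
      using conv[OF U.one_closed] unfolding conv1 .
    then have k: "k \<noteq> 0" using \<xi>1 B0 by auto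
    have "k * (convolution U \<xi> \<xi> z * \<xi> \<one>\<^bsub>U\<^esub>) = of_nat (card B) * \<xi> z * \<xi> \<one>\<^bsub>U\<^esub>"
      using conv[OF z] by simp
    also have "\<dots> = k * (of_nat (card (carrier U)) * frobenius_prod U \<xi> \<xi> * \<xi> z)"
      using e1 by (simp add: mult_ac)
    finally have "convolution U \<xi> \<xi> z * \<xi> \<one>\<^bsub>U\<^esub> = of_nat (card (carrier U)) * frobenius_prod U \<xi> \<xi> * \<xi> z"
      using k by simp
    then have "convolution U \<xi> \<xi> z = of_nat (card (carrier U)) * frobenius_prod U \<xi> \<xi> / \<xi> \<one>\<^bsub>U\<^esub> * \<xi> z"
      using \<xi>1 by (simp add: field_simps)
    then show ?thesis using True by (simp add: \<xi>_def \<xi>'_def)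
  qed
qed

end

text \<open>Translation by 1 permutes the field, so the sum of all elements shows that
  \<open>q\<close> is zero in it; with 2 also zero, this is impossible for odd
  \<open>q\<close>.\<close>

lemma odd_card_two_nonzero:
  assumes "CARD('a::{field,finite}) = q" "odd q"
  shows "(2::'a) \<noteq> 0"
proof
  assume two: "(2::'a) = 0"
  have "(\<Sum>x\<in>(UNIV::'a set). x) = (\<Sum>x\<in>(UNIV::'a set). x + 1)"
    by (rule sum.reindex_bij_witness[of _ "\<lambda>x. x + 1" "\<lambda>x. x - 1"]) auto
  also have "\<dots> = (\<Sum>x\<in>(UNIV::'a set). x) + of_nat CARD('a)" by (simp add: sum.distrib)
  finally have "(of_nat q :: 'a) = 0" using assms(1) by simp
  moreover obtain k where "q = 2 * k + 1" using assms(2) oddE by blast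
  ultimately show False using two by simp
qed

theorem theorem6p1:
  fixes G :: family and n p e :: nat
    and \<theta> :: "'a::{field,finite} \<Rightarrow> complex"
    and D D' :: "root set" and \<phi> \<phi>' :: "root \<Rightarrow> 'a"
  defines "U \<equiv> unip_group G n :: 'a mat monoid"
    and "\<xi> \<equiv> supercharacter G n \<theta> D \<phi>"
    and "\<xi>' \<equiv> supercharacter G n \<theta> D' \<phi>'"
  assumes "prime p" and "odd p" and "e \<ge> 1" and "CARD('a) = p ^ e" and "n \<ge> 1"
    and "nontrivial_additive_character \<theta>"
    and "basic_pair G n D \<phi>" and "basic_pair G n D' \<phi>'"
  shows "(\<forall>z\<in>carrier U. convolution U \<xi> \<xi>' z =
           of_bool (D = D') * of_bool (\<phi> = \<phi>') *
           (of_nat (card (carrier U)) * frobenius_prod U \<xi> \<xi> / \<xi> \<one>\<^bsub>U\<^esub>) * \<xi> z) \<and>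
         (\<forall>z\<in>carrier U.
           1 / of_nat (card (carrier U)) * (\<Sum>x\<in>carrier U. \<xi> x * \<xi>' (z \<otimes>\<^bsub>U\<^esub> inv\<^bsub>U\<^esub> x)) =
           of_bool (D = D') * of_bool (\<phi> = \<phi>') *
           (frobenius_prod U \<xi> \<xi> * \<xi> z / \<xi> \<one>\<^bsub>U\<^esub>))"
proof (intro conjI ballI)
  have two: "(2::'a) \<noteq> 0" using odd_card_two_nonzero[OF \<open>CARD('a) = p ^ e\<close>] \<open>odd p\<close> by simp
  fix z assume z: "z \<in> carrier U"
  show *: "convolution U \<xi> \<xi>' z = of_bool (D = D') * of_bool (\<phi> = \<phi>') *
      (of_nat (card (carrier U)) * frobenius_prod U \<xi> \<xi> / \<xi> \<one>\<^bsub>U\<^esub>) * \<xi> z"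
    using supercharacter_convolution[OF two] assms z unfolding U_def \<xi>_def \<xi>'_def by blast
  have "(of_nat (card (carrier U)) :: complex) \<noteq> 0"
    using z finite_unip[of G n, where 'a = 'a] by (auto simp: U_def unip_group_def card_eq_0_iff)
  then show "1 / of_nat (card (carrier U)) * (\<Sum>x\<in>carrier U. \<xi> x * \<xi>' (z \<otimes>\<^bsub>U\<^esub> inv\<^bsub>U\<^esub> x)) =
      of_bool (D = D') * of_bool (\<phi> = \<phi>') * (frobenius_prod U \<xi> \<xi> * \<xi> z / \<xi> \<one>\<^bsub>U\<^esub>)"
    using * unfolding convolution_def by simp
qed

end
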